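(* Let $(M,\Pi)\stackrel{\phi}{\to}(B,\pi)$ be an NCI system of rank $r$ with compact fibers. Suppose that its action lattice sheaf $\mathcal L_B$ admits a trivialization on $B$, defined by sections $\ell_1,\dots,\ell_r$ of $\mathcal L_B$ over $B$. Then the following conditions are equivalent: (i) There exists a global action foliation (an action foliation of $B$) for the NCI system. (ii) For $i=1,\dots,r$, the class $\operatorname{Obs}(\ell_i)\in H^1(B,\mathcal{C}as_B^M)$ is representable by constants.
   Context: All manifolds and objects are smooth and real. For a Poisson manifold $(M,\Pi)$ write $\{f,g\}=\Pi(df,dg)$; the Hamiltonian vector field $X_h$ is given by $X_h(g)=\{g,h\}$, and $\Pi^\sharp:T^*M\to TM$ is the induced bundle map, with $\Pi^\sharp(dh)=-X_h$. A (local) first integral of a foliation is a (locally defined) function constant on its leaves. An abstract NCI system of rank $r$ on $(M,\Pi)$ is an $r$-dimensional foliation $\mathfrak F$ of $M$ whose tangent bundle is spanned by Hamiltonian vector fields of local first integrals: each $m\in M$ has a neighborhood on which there are first integrals $f_1,\dots,f_r$ of $\mathfrak F$ such that $X_{f_1},\dots,X_{f_r}$ span $T\mathfrak F$ at every point. An NCI system $(M,\Pi)\stackrel{\phi}{\to}(B,\pi)$ of rank $r$ is such an abstract NCI system whose leaf space $B$ is a smooth Hausdorff manifold; $\phi:M\to B$ is the quotient map, a surjective submersion whose fibers are the (connected) leaves of $\mathfrak F$, and $\pi$ is the unique Poisson structure on $B$ making $\phi$ a Poisson map. It has compact fibers if all fibers of $\phi$ are compact. Action bundle and lattice. The action sheaf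 is $\mathcal E_B=\operatorname{Ker}\pi^\sharp/\operatorname{Ker}(\Pi^\sharp\circ\phi^* )$ (quotient of sheaves of 1-forms $\omega$ on open subsets of $B$ with $\pi^\sharp\omega=0$, respectively $\Pi^\sharp(\phi^*\omega)=0$); it is the sheaf of sections of a rank $r$ vector bundle $E\to B$ with fiber $E_b=\operatorname{Ker}(\pi_b^\sharp)/\{\xi\in T_b^*B\mid \Pi_m^\sharp(\phi^*\xi)=0\}$ ($m\in\phi^{-1}(b)$ arbitrary). The class of $\omega$ is denoted $[\omega]$. For $\alpha\in E_b$ the action vector field on $\phi^{-1}(b)$ is $X_\alpha(m)=\Pi_m^\sharp(\phi^*\alpha)$. When the fibers are compact, $L_b:=\{\alpha\in E_b\mid \text{the time 1 flow of }X_\alpha\text{ is the identity of }\phi^{-1}(b)\}$ is a lattice in $E_b$; these form a bundle $L\to B$ with fiber $\mathbb Z^r$, and $\mathcal L_B$ denotes its sheaf of local sections. A trivialization of $\mathcal L_B$ on an open set $V$ is an isomorphism with the constant sheaf $\mathbb Z^r$ on $V$, i.e. an $r$-tuple of sections over $V$ whose values at each $b\in V$ form a $\mathbb Z$-basis of $L_b$. Local action variables on an open $V\subset B$ are functions $p_1,\dots,p_r$ on $V$ (which are Casimirs of $\pi$) such that $[dp_1],\dots,[dp_r]$ define a trivialization of $\mathcal L_B$ on $V$. An action foliation is a foliation $\mathfrak A$ of $B$ such that every $b\in B$ has a neighborhood $V$ with local action variables $p_1,\dots,p_r$ on $V$ that define $\mathfrak A$ on $V$ (i.e. $T\mathfrak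 A=\bigcap_i\ker dp_i$ on $V$). Obstruction map. $\mathcal{C}as_B$ is the sheaf of Casimir functions of $\pi$; $\mathcal{C}as_B^M$ is the sheaf of functions $F$ on open $V\subset B$ such that $F\circ\phi$ is a Casimir of $\Pi|_{\phi^{-1}(V)}$; $\mathcal E_B^0\subset\mathcal E_B$ is the subsheaf of sections locally of the form $[dg]$ with $g$ a local Casimir of $\pi$. There is a short exact sequence of sheaves of real vector spaces $0\to\mathcal{C}as_B^M\to\mathcal{C}as_B\xrightarrow{[d\,\cdot]}\mathcal E_B^0\to0$, and $\operatorname{Obs}:H^0(B,\mathcal E_B^0)\to H^1(B,\mathcal{C}as_B^M)$ is its connecting homomorphism; $\mathcal L_B$ is a subsheaf of $\mathcal E_B^0$. With $\mathbb R$ the sheaf of locally constant functions on $B$, a class in $H^1(B,\mathcal{C}as_B^M)$ is representable by constants if it lies in the image of $H^1(B,\mathbb R)\to H^1(B,\mathcal{C}as_B^M)$ induced by the inclusion $\mathbb R\subset\mathcal{C}as_B^M$. *)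

theory Defs
  imports "HOL-Analysis.Analysis"
begin

section \<open>Smooth functions and manifolds\<close>

primrec Ck_on :: "nat \<Rightarrow> 'a::euclidean_space set \<Rightarrow> ('a \<Rightarrow> real) \<Rightarrow> bool" where
  "Ck_on 0 S f = continuous_on S f"
| "Ck_on (Suc k) S f =
     ((\<forall>x\<in>S. f differentiable (at x)) \<and>
      (\<forall>i\<in>Basis. Ck_on k S (\<lambda>x. frechet_derivative f (at x) i)))"

text \<open>Only used for open sets \<open>S\<close>.\<close>

definition Cinf_on :: "'a::euclidean_space set \<Rightarrow> ('a \<Rightarrow> real) \<Rightarrow> bool" where
  "Cinf_on S f \<longleftrightarrow> (\<forall>k. Ck_on k S f)"

text \<open>A chart \<open>(U, x)\<close> takes values in an open subset of an \<open>n\<close>-dimensional linear subspace of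
  the type \<open>'e\<close>, so that the dimension \<open>n\<close> of a manifold is a number and may be \<open>0\<close>. Accordingly a
  function is smooth in a chart if locally it is \<open>g \<circ> x\<close> with \<open>g\<close> smooth on an open subset of \<open>'e\<close>.
  The manifold is the whole topological space \<open>'m\<close>.\<close>

type_synonym ('m, 'e) atlas = "('m set \<times> ('m \<Rightarrow> 'e)) set"

definition smooth_in_chart ::
    "'m::topological_space set \<times> ('m \<Rightarrow> 'e::euclidean_space) \<Rightarrow> 'm set \<Rightarrow> ('m \<Rightarrow> real) \<Rightarrow> bool" where
  "smooth_in_chart c S f \<longleftrightarrow>
     (\<forall>m \<in> S \<inter> fst c. \<exists>Q g. open Q \<and> snd c m \<in> Q \<and> Cinf_on Q g \<and>
        (\<forall>m' \<in> S \<inter> fst c. snd c m' \<in> Q \<longrightarrow> f m' = g (snd c m')))"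

definition smooth_manifold ::
    "nat \<Rightarrow> ('m::{t2_space, second_countable_topology}, 'e::euclidean_space) atlas \<Rightarrow> bool" where
  "smooth_manifold n A \<longleftrightarrow>
     (\<Union>c\<in>A. fst c) = UNIV \<and>
     (\<forall>(U, x) \<in> A. open U \<and> (\<exists>y. homeomorphism U (x ` U) x y) \<and>
        (\<exists>V. subspace V \<and> dim V = n \<and> openin (top_of_set V) (x ` U))) \<and>
     (\<forall>(U, x) \<in> A. \<forall>(W, y) \<in> A. \<forall>i\<in>Basis. smooth_in_chart (U, x) (U \<inter> W) (\<lambda>m. y m \<bullet> i))"

definition smooth_fun ::
    "('m::topological_space, 'e::euclidean_space) atlas \<Rightarrow> 'm set \<Rightarrow> ('m \<Rightarrow> real) \<Rightarrow> bool" where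
  "smooth_fun A S f \<longleftrightarrow> (\<forall>c\<in>A. smooth_in_chart c S f)"

definition smooth_at ::
    "('m::topological_space, 'e::euclidean_space) atlas \<Rightarrow> 'm \<Rightarrow> ('m \<Rightarrow> real) \<Rightarrow> bool" where
  "smooth_at A m f \<longleftrightarrow> (\<exists>U. open U \<and> m \<in> U \<and> smooth_fun A U f)"

section \<open>Tangent and cotangent vectors\<close>

text \<open>Tangent vectors at \<open>m\<close> are the derivations of germs of smooth functions at \<open>m\<close>, and covectors
  are linear forms on them; both are set to \<open>0\<close> outside their domain, so that equality is equality
  of functions.\<close>

type_synonym 'm vec = "('m \<Rightarrow> real) \<Rightarrow> real"
type_synonym 'm covec = "'m vec \<Rightarrow> real"

definition tangent_space ::
    "('m::topological_space, 'e::euclidean_space) atlas \<Rightarrow> 'm \<Rightarrow> 'm vec set" where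
  "tangent_space A m = {v.
     (\<forall>f. \<not> smooth_at A m f \<longrightarrow> v f = 0) \<and>
     (\<forall>f g. smooth_at A m f \<and> smooth_at A m g \<and> (\<forall>\<^sub>F x in nhds m. f x = g x) \<longrightarrow> v f = v g) \<and>
     (\<forall>f g a b. smooth_at A m f \<and> smooth_at A m g \<longrightarrow>
        v (\<lambda>x. a * f x + b * g x) = a * v f + b * v g) \<and>
     (\<forall>f g. smooth_at A m f \<and> smooth_at A m g \<longrightarrow>
        v (\<lambda>x. f x * g x) = f m * v g + g m * v f)}"

definition cotangent_space ::
    "('m::topological_space, 'e::euclidean_space) atlas \<Rightarrow> 'm \<Rightarrow> 'm covec set" where
  "cotangent_space A m = {\<xi>.
     (\<forall>v. v \<notin> tangent_space A m \<longrightarrow> \<xi> v = 0) \<and>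
     (\<forall>v\<in>tangent_space A m. \<forall>w\<in>tangent_space A m. \<forall>a b.
        \<xi> (\<lambda>f. a * v f + b * w f) = a * \<xi> v + b * \<xi> w)}"

definition differential ::
    "('m::topological_space, 'e::euclidean_space) atlas \<Rightarrow> ('m \<Rightarrow> real) \<Rightarrow> 'm \<Rightarrow> 'm covec" where
  "differential A f m = (\<lambda>v. if v \<in> tangent_space A m then v f else 0)"

definition smooth_form ::
    "('m::topological_space, 'e::euclidean_space) atlas \<Rightarrow> 'm set \<Rightarrow> ('m \<Rightarrow> 'm covec) \<Rightarrow> bool" where
  "smooth_form A V \<omega> \<longleftrightarrow>
     (\<forall>m\<in>V. \<omega> m \<in> cotangent_space A m) \<and>
     (\<forall>(U, x) \<in> A. \<exists>a. (\<forall>i\<in>Basis. smooth_fun A (V \<inter> U) (a i)) \<and>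
        (\<forall>m \<in> V \<inter> U. \<omega> m = (\<lambda>v. \<Sum>i\<in>Basis. a i m * differential A (\<lambda>m. x m \<bullet> i) m v)))"

definition smooth_map ::
    "('m::topological_space, 'e::euclidean_space) atlas \<Rightarrow>
     ('b::topological_space, 'f::euclidean_space) atlas \<Rightarrow> ('m \<Rightarrow> 'b) \<Rightarrow> bool" where
  "smooth_map A B \<phi> \<longleftrightarrow> continuous_on UNIV \<phi> \<and>
     (\<forall>U f. open U \<and> smooth_fun B U f \<longrightarrow> smooth_fun A (\<phi> -` U) (f \<circ> \<phi>))"

definition pushforward ::
    "('b::topological_space, 'f::euclidean_space) atlas \<Rightarrow> ('m \<Rightarrow> 'b) \<Rightarrow> 'm \<Rightarrow> 'm vec \<Rightarrow> 'b vec" where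
  "pushforward B \<phi> m v = (\<lambda>g. if smooth_at B (\<phi> m) g then v (g \<circ> \<phi>) else 0)"

definition pullback ::
    "('m::topological_space, 'e::euclidean_space) atlas \<Rightarrow>
     ('b::topological_space, 'f::euclidean_space) atlas \<Rightarrow>
     ('m \<Rightarrow> 'b) \<Rightarrow> 'm \<Rightarrow> 'b covec \<Rightarrow> 'm covec" where
  "pullback A B \<phi> m \<xi> =
     (\<lambda>v. if v \<in> tangent_space A m then \<xi> (pushforward B \<phi> m v) else 0)"

definition submersion ::
    "('m::topological_space, 'e::euclidean_space) atlas \<Rightarrow>
     ('b::topological_space, 'f::euclidean_space) atlas \<Rightarrow> ('m \<Rightarrow> 'b) \<Rightarrow> bool" where
  "submersion A B \<phi> \<longleftrightarrow> smooth_map A B \<phi> \<and>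
     (\<forall>m. pushforward B \<phi> m ` tangent_space A m = tangent_space B (\<phi> m))"

definition smooth_curve ::
    "('m::topological_space, 'e::euclidean_space) atlas \<Rightarrow> (real \<Rightarrow> 'm) \<Rightarrow> bool" where
  "smooth_curve A c \<longleftrightarrow> continuous_on UNIV c \<and>
     (\<forall>U f. open U \<and> smooth_fun A U f \<longrightarrow> Cinf_on (c -` U) (f \<circ> c))"

definition velocity ::
    "('m::topological_space, 'e::euclidean_space) atlas \<Rightarrow> (real \<Rightarrow> 'm) \<Rightarrow> real \<Rightarrow> 'm vec" where
  "velocity A c t = (\<lambda>f. if smooth_at A (c t) f then deriv (f \<circ> c) t else 0)"

text \<open>\<open>\<Phi>\<close> is the flow on \<open>S\<close> of a vector field \<open>X\<close> that is tangent to \<open>S\<close> and complete there.\<close>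

definition is_flow_on ::
    "('m::topological_space, 'e::euclidean_space) atlas \<Rightarrow> 'm set \<Rightarrow> ('m \<Rightarrow> 'm vec) \<Rightarrow>
     (real \<Rightarrow> 'm \<Rightarrow> 'm) \<Rightarrow> bool" where
  "is_flow_on A S X \<Phi> \<longleftrightarrow> (\<forall>m\<in>S. \<Phi> 0 m = m \<and> smooth_curve A (\<lambda>t. \<Phi> t m) \<and>
     (\<forall>t. \<Phi> t m \<in> S \<and> velocity A (\<lambda>t. \<Phi> t m) t = X (\<Phi> t m)))"

section \<open>Foliations\<close>

text \<open>A foliation is given by its tangent distribution \<open>D\<close>, which locally is the kernel of the
  differential of a submersion \<open>(y 0, \<dots>, y (n - k - 1))\<close> into the space of real
  \<open>n - k\<close>-tuples, \<open>n\<close> being the dimension of the manifold and \<open>k\<close> that of the leaves.\<close>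

definition foliation ::
    "nat \<Rightarrow> nat \<Rightarrow> ('m::topological_space, 'e::euclidean_space) atlas \<Rightarrow> ('m \<Rightarrow> 'm vec set) \<Rightarrow> bool" where
  "foliation n k A D \<longleftrightarrow> k \<le> n \<and>
     (\<forall>m. \<exists>U y. open U \<and> m \<in> U \<and>
        (\<forall>j<n-k. smooth_fun A U (y j)) \<and>
        (\<forall>m'\<in>U. \<forall>a :: nat \<Rightarrow> real.
           (\<lambda>v. \<Sum>j<n-k. a j * differential A (y j) m' v) = (\<lambda>v. 0) \<longrightarrow> (\<forall>j<n-k. a j = 0)) \<and>
        (\<forall>m'\<in>U. D m' = {v \<in> tangent_space A m'. \<forall>j<n-k. differential A (y j) m' v = 0}))"

text \<open>The leaf through \<open>m\<close> of the restriction of the foliation to \<open>U\<close>. Piecewise smooth tangent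
  paths can be reparametrized so as to become constant near their break points and end points, so
  it is enough to use smooth curves defined on the whole real line.\<close>

definition leaf_on ::
    "('m::topological_space, 'e::euclidean_space) atlas \<Rightarrow> ('m \<Rightarrow> 'm vec set) \<Rightarrow> 'm set \<Rightarrow> 'm \<Rightarrow> 'm set" where
  "leaf_on A D U m = {c 1 | c. smooth_curve A c \<and> c 0 = m \<and>
     (\<forall>t. c t \<in> U \<and> velocity A c t \<in> D (c t))}"

definition first_integral ::
    "('m::topological_space, 'e::euclidean_space) atlas \<Rightarrow> ('m \<Rightarrow> 'm vec set) \<Rightarrow> 'm set \<Rightarrow>
     ('m \<Rightarrow> real) \<Rightarrow> bool" where
  "first_integral A D U f \<longleftrightarrow> smooth_fun A U f \<and> (\<forall>m\<in>U. \<forall>m'\<in>leaf_on A D U m. f m' = f m)"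

section \<open>Poisson manifolds\<close>

type_synonym 'm bivector = "'m \<Rightarrow> 'm covec \<Rightarrow> 'm covec \<Rightarrow> real"

definition poisson_bracket ::
    "('m::topological_space, 'e::euclidean_space) atlas \<Rightarrow> 'm bivector \<Rightarrow>
     ('m \<Rightarrow> real) \<Rightarrow> ('m \<Rightarrow> real) \<Rightarrow> 'm \<Rightarrow> real" where
  "poisson_bracket A P f g = (\<lambda>m. P m (differential A f m) (differential A g m))"

definition poisson_manifold ::
    "nat \<Rightarrow> ('m::{t2_space, second_countable_topology}, 'e::euclidean_space) atlas \<Rightarrow> 'm bivector \<Rightarrow> bool" where
  "poisson_manifold n A P \<longleftrightarrow> smooth_manifold n A \<and>
     (\<forall>m. \<forall>\<xi>\<in>cotangent_space A m. \<forall>\<eta>\<in>cotangent_space A m. P m \<xi> \<eta> = - P m \<eta> \<xi>) \<and>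
     (\<forall>m. \<forall>\<xi>\<in>cotangent_space A m. \<forall>\<eta>\<in>cotangent_space A m. \<forall>\<zeta>\<in>cotangent_space A m. \<forall>a b.
        P m (\<lambda>v. a * \<xi> v + b * \<eta> v) \<zeta> = a * P m \<xi> \<zeta> + b * P m \<eta> \<zeta>) \<and>
     (\<forall>U f g. open U \<and> smooth_fun A U f \<and> smooth_fun A U g \<longrightarrow>
        smooth_fun A U (poisson_bracket A P f g)) \<and>
     (\<forall>U f g h. open U \<and> smooth_fun A U f \<and> smooth_fun A U g \<and> smooth_fun A U h \<longrightarrow>
        (\<forall>m\<in>U. poisson_bracket A P f (poisson_bracket A P g h) m +
                poisson_bracket A P g (poisson_bracket A P h f) m +
                poisson_bracket A P h (poisson_bracket A P f g) m = 0))"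

definition sharp ::
    "('m::topological_space, 'e::euclidean_space) atlas \<Rightarrow> 'm bivector \<Rightarrow> 'm \<Rightarrow> 'm covec \<Rightarrow> 'm vec" where
  "sharp A P m \<xi> = (\<lambda>g. if smooth_at A m g then P m \<xi> (differential A g m) else 0)"

definition hamiltonian_vf ::
    "('m::topological_space, 'e::euclidean_space) atlas \<Rightarrow> 'm bivector \<Rightarrow> ('m \<Rightarrow> real) \<Rightarrow> 'm \<Rightarrow> 'm vec" where
  "hamiltonian_vf A P h m = (\<lambda>g. if smooth_at A m g then poisson_bracket A P g h m else 0)"

definition casimir ::
    "('m::topological_space, 'e::euclidean_space) atlas \<Rightarrow> 'm bivector \<Rightarrow> 'm set \<Rightarrow> ('m \<Rightarrow> real) \<Rightarrow> bool" where
  "casimir A P U F \<longleftrightarrow> smooth_fun A U F \<and> (\<forall>m\<in>U. hamiltonian_vf A P F m = (\<lambda>g. 0))"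

definition poisson_map ::
    "('m::topological_space, 'e::euclidean_space) atlas \<Rightarrow> 'm bivector \<Rightarrow>
     ('b::topological_space, 'f::euclidean_space) atlas \<Rightarrow> 'b bivector \<Rightarrow> ('m \<Rightarrow> 'b) \<Rightarrow> bool" where
  "poisson_map A P B Q \<phi> \<longleftrightarrow> smooth_map A B \<phi> \<and>
     (\<forall>U f g. open U \<and> smooth_fun B U f \<and> smooth_fun B U g \<longrightarrow>
        (\<forall>m \<in> \<phi> -` U. poisson_bracket A P (f \<circ> \<phi>) (g \<circ> \<phi>) m = poisson_bracket B Q f g (\<phi> m)))"

section \<open>NCI systems\<close>

definition abstract_nci ::
    "nat \<Rightarrow> nat \<Rightarrow> ('m::{t2_space, second_countable_topology}, 'e::euclidean_space) atlas \<Rightarrow>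
     'm bivector \<Rightarrow> ('m \<Rightarrow> 'm vec set) \<Rightarrow> bool" where
  "abstract_nci n r A P D \<longleftrightarrow> poisson_manifold n A P \<and> foliation n r A D \<and>
     (\<forall>m. \<exists>U f. open U \<and> m \<in> U \<and> (\<forall>i<r. first_integral A D U (f i)) \<and>
        (\<forall>m'\<in>U. D m' = {\<lambda>g. \<Sum>i<r. a i * hamiltonian_vf A P (f i) m' g | a :: nat \<Rightarrow> real. True}))"

text \<open>The data of \<open>\<phi> : (M, \<Pi>) \<rightarrow> (B, \<pi>)\<close>.\<close>

record ('m, 'e, 'b, 'f) nci_data =
  atlasM :: "('m, 'e) atlas"
  poisM :: "'m bivector"
  atlasB :: "('b, 'f) atlas"
  poisB :: "'b bivector"
  proj :: "'m \<Rightarrow> 'b"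

text \<open>The fibers of \<open>\<phi>\<close> are exactly the leaves of the foliation \<open>D\<close>. Since \<open>\<phi>\<close> is a surjective
  submersion, \<open>B\<close> then carries the quotient topology and \<open>\<pi>\<close> is determined by \<open>\<Pi>\<close>.\<close>

definition nci_system ::
    "nat \<Rightarrow> nat \<Rightarrow> nat \<Rightarrow> ('m \<Rightarrow> 'm vec set) \<Rightarrow>
     ('m::{t2_space, second_countable_topology}, 'e::euclidean_space,
      'b::{t2_space, second_countable_topology}, 'f::euclidean_space) nci_data \<Rightarrow> bool" where
  "nci_system dM dB r D S \<longleftrightarrow>
     abstract_nci dM r (atlasM S) (poisM S) D \<and>
     poisson_manifold dB (atlasB S) (poisB S) \<and>
     submersion (atlasM S) (atlasB S) (proj S) \<and> surj (proj S) \<and>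
     (\<forall>m. proj S -` {proj S m} = leaf_on (atlasM S) D UNIV m) \<and>
     poisson_map (atlasM S) (poisM S) (atlasB S) (poisB S) (proj S)"

definition compact_fibers ::
    "('m::topological_space, 'e::euclidean_space, 'b::topological_space, 'f::euclidean_space) nci_data
     \<Rightarrow> bool" where
  "compact_fibers S \<longleftrightarrow> (\<forall>b. compact (proj S -` {b}))"

section \<open>Action bundle, action lattice, action foliations\<close>

definition ker_sharpB ::
    "('m::topological_space, 'e::euclidean_space, 'b::topological_space, 'f::euclidean_space) nci_data
     \<Rightarrow> 'b \<Rightarrow> 'b covec set" where
  "ker_sharpB S b = {\<xi> \<in> cotangent_space (atlasB S) b. sharp (atlasB S) (poisB S) b \<xi> = (\<lambda>g. 0)}"

definition action_vf_form ::
    "('m::topological_space, 'e::euclidean_space, 'b::topological_space, 'f::euclidean_space) nci_data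
     \<Rightarrow> 'b covec \<Rightarrow> 'm \<Rightarrow> 'm vec" where
  "action_vf_form S \<xi> m = sharp (atlasM S) (poisM S) m (pullback (atlasM S) (atlasB S) (proj S) m \<xi>)"

text \<open>For an NCI system the condition does not depend on the point \<open>m\<close> of the fiber.\<close>

definition ker_sharpM ::
    "('m::topological_space, 'e::euclidean_space, 'b::topological_space, 'f::euclidean_space) nci_data
     \<Rightarrow> 'b \<Rightarrow> 'b covec set" where
  "ker_sharpM S b =
     {\<xi> \<in> cotangent_space (atlasB S) b. \<forall>m \<in> proj S -` {b}. action_vf_form S \<xi> m = (\<lambda>g. 0)}"

text \<open>Elements of the quotient \<open>E_b\<close> are cosets.\<close>

definition action_class ::
    "('m::topological_space, 'e::euclidean_space, 'b::topological_space, 'f::euclidean_space) nci_data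
     \<Rightarrow> 'b \<Rightarrow> 'b covec \<Rightarrow> 'b covec set" where
  "action_class S b \<xi> = {\<lambda>v. \<xi> v + \<kappa> v | \<kappa>. \<kappa> \<in> ker_sharpM S b}"

definition action_fiber ::
    "('m::topological_space, 'e::euclidean_space, 'b::topological_space, 'f::euclidean_space) nci_data
     \<Rightarrow> 'b \<Rightarrow> 'b covec set set" where
  "action_fiber S b = action_class S b ` ker_sharpB S b"

definition action_vf ::
    "('m::topological_space, 'e::euclidean_space, 'b::topological_space, 'f::euclidean_space) nci_data
     \<Rightarrow> 'b covec set \<Rightarrow> 'm \<Rightarrow> 'm vec" where
  "action_vf S \<alpha> = action_vf_form S (SOME \<xi>. \<xi> \<in> \<alpha>)"

definition action_lattice ::
    "('m::topological_space, 'e::euclidean_space, 'b::topological_space, 'f::euclidean_space) nci_data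
     \<Rightarrow> 'b \<Rightarrow> 'b covec set set" where
  "action_lattice S b = {\<alpha> \<in> action_fiber S b. \<exists>\<Phi>.
     is_flow_on (atlasM S) (proj S -` {b}) (action_vf S \<alpha>) \<Phi> \<and> (\<forall>m \<in> proj S -` {b}. \<Phi> 1 m = m)}"

text \<open>A section over \<open>V\<close> of the action sheaf, seen as the map sending \<open>b\<close> to its value in \<open>E_b\<close>.\<close>

definition action_section ::
    "('m::topological_space, 'e::euclidean_space, 'b::topological_space, 'f::euclidean_space) nci_data
     \<Rightarrow> 'b set \<Rightarrow> ('b \<Rightarrow> 'b covec set) \<Rightarrow> bool" where
  "action_section S V s \<longleftrightarrow> (\<forall>b\<in>V. \<exists>W \<omega>. open W \<and> b \<in> W \<and> W \<subseteq> V \<and> smooth_form (atlasB S) W \<omega> \<and>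
     (\<forall>b'\<in>W. \<omega> b' \<in> ker_sharpB S b' \<and> s b' = action_class S b' (\<omega> b')))"

definition lattice_section ::
    "('m::topological_space, 'e::euclidean_space, 'b::topological_space, 'f::euclidean_space) nci_data
     \<Rightarrow> 'b set \<Rightarrow> ('b \<Rightarrow> 'b covec set) \<Rightarrow> bool" where
  "lattice_section S V s \<longleftrightarrow> action_section S V s \<and> (\<forall>b\<in>V. s b \<in> action_lattice S b)"

definition int_combination ::
    "('m::topological_space, 'e::euclidean_space, 'b::topological_space, 'f::euclidean_space) nci_data
     \<Rightarrow> nat \<Rightarrow> 'b \<Rightarrow> (nat \<Rightarrow> 'b covec set) \<Rightarrow> (nat \<Rightarrow> int) \<Rightarrow> 'b covec set" where
  "int_combination S r b \<alpha> k =
     action_class S b (\<lambda>v. \<Sum>i<r. of_int (k i) * (SOME \<xi>. \<xi> \<in> \<alpha> i) v)"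

text \<open>Integer \<open>r\<close>-tuples are the functions \<open>k\<close> with \<open>k i = 0\<close> for \<open>i \<ge> r\<close>.\<close>

definition lattice_basis ::
    "('m::topological_space, 'e::euclidean_space, 'b::topological_space, 'f::euclidean_space) nci_data
     \<Rightarrow> nat \<Rightarrow> 'b \<Rightarrow> (nat \<Rightarrow> 'b covec set) \<Rightarrow> bool" where
  "lattice_basis S r b \<alpha> \<longleftrightarrow> (\<forall>i<r. \<alpha> i \<in> action_lattice S b) \<and>
     bij_betw (int_combination S r b \<alpha>) {k. \<forall>i\<ge>r. k i = 0} (action_lattice S b)"

definition lattice_trivialization ::
    "('m::topological_space, 'e::euclidean_space, 'b::topological_space, 'f::euclidean_space) nci_data
     \<Rightarrow> nat \<Rightarrow> 'b set \<Rightarrow> (nat \<Rightarrow> 'b \<Rightarrow> 'b covec set) \<Rightarrow> bool" where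
  "lattice_trivialization S r V l \<longleftrightarrow>
     (\<forall>i<r. lattice_section S V (l i)) \<and> (\<forall>b\<in>V. lattice_basis S r b (\<lambda>i. l i b))"

definition action_variables ::
    "('m::topological_space, 'e::euclidean_space, 'b::topological_space, 'f::euclidean_space) nci_data
     \<Rightarrow> nat \<Rightarrow> 'b set \<Rightarrow> (nat \<Rightarrow> 'b \<Rightarrow> real) \<Rightarrow> bool" where
  "action_variables S r V p \<longleftrightarrow> (\<forall>i<r. casimir (atlasB S) (poisB S) V (p i)) \<and>
     lattice_trivialization S r V (\<lambda>i b. action_class S b (differential (atlasB S) (p i) b))"

definition action_foliation ::
    "('m::topological_space, 'e::euclidean_space, 'b::topological_space, 'f::euclidean_space) nci_data
     \<Rightarrow> nat \<Rightarrow> nat \<Rightarrow> ('b \<Rightarrow> 'b vec set) \<Rightarrow> bool" where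
  "action_foliation S dB r D \<longleftrightarrow> (\<exists>k. foliation dB k (atlasB S) D) \<and>
     (\<forall>b. \<exists>V p. open V \<and> b \<in> V \<and> action_variables S r V p \<and>
        (\<forall>b'\<in>V. D b' = {v \<in> tangent_space (atlasB S) b'.
            \<forall>i<r. differential (atlasB S) (p i) b' v = 0}))"

section \<open>First cohomology of sheaves of functions, and the obstruction map\<close>

text \<open>A sheaf \<open>F\<close> of real functions is given by the sets \<open>F U\<close> for open \<open>U\<close>; the values of elements
  of \<open>F U\<close> outside \<open>U\<close> are irrelevant. \<open>H\<^sup>1\<close> is Cech cohomology, the direct limit over all open
  covers, which in degree one is sheaf cohomology; its elements are the classes of pairs of an open
  cover and a cocycle for it.\<close>

type_synonym 'b fsheaf = "'b set \<Rightarrow> ('b \<Rightarrow> real) set"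
type_synonym 'b cech1 = "'b set set \<times> ('b set \<Rightarrow> 'b set \<Rightarrow> 'b \<Rightarrow> real)"

definition open_cover :: "'b::topological_space set set \<Rightarrow> bool" where
  "open_cover C \<longleftrightarrow> (\<forall>U\<in>C. open U) \<and> \<Union>C = UNIV"

definition cocycles :: "'b::topological_space fsheaf \<Rightarrow> 'b cech1 set" where
  "cocycles F = {(C, z). open_cover C \<and> (\<forall>U\<in>C. \<forall>V\<in>C. z U V \<in> F (U \<inter> V)) \<and>
     (\<forall>U\<in>C. \<forall>V\<in>C. \<forall>W\<in>C. \<forall>b \<in> U \<inter> V \<inter> W. z U V b + z V W b = z U W b)}"

text \<open>Two cocycles are cohomologous if they differ by a coboundary on a common refinement \<open>E\<close> of
  their covers, with refinement maps \<open>\<tau>\<close> and \<open>\<tau>'\<close>.\<close>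

definition cohomologous :: "'b::topological_space fsheaf \<Rightarrow> ('b cech1 \<times> 'b cech1) set" where
  "cohomologous F = {((C, z), (C', z')). (C, z) \<in> cocycles F \<and> (C', z') \<in> cocycles F \<and>
     (\<exists>E \<tau> \<tau>' h. open_cover E \<and>
        (\<forall>U\<in>E. \<tau> U \<in> C \<and> U \<subseteq> \<tau> U \<and> \<tau>' U \<in> C' \<and> U \<subseteq> \<tau>' U \<and> h U \<in> F U) \<and>
        (\<forall>U\<in>E. \<forall>V\<in>E. \<forall>b \<in> U \<inter> V. z (\<tau> U) (\<tau> V) b - z' (\<tau>' U) (\<tau>' V) b = h V b - h U b))}"

definition H1 :: "'b::topological_space fsheaf \<Rightarrow> 'b cech1 set set" where
  "H1 F = cocycles F // cohomologous F"

text \<open>The map \<open>H\<^sup>1(B, F) \<rightarrow> H\<^sup>1(B, G)\<close> induced by an inclusion \<open>F \<subseteq> G\<close> of sheaves; it depends on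
  \<open>G\<close> only, as a class is the set of its representatives.\<close>

definition H1_inclusion :: "'b::topological_space fsheaf \<Rightarrow> 'b cech1 set \<Rightarrow> 'b cech1 set" where
  "H1_inclusion G k = cohomologous G `` k"

definition const_sheaf :: "'b::topological_space fsheaf" where
  "const_sheaf V = {F. \<forall>b\<in>V. \<exists>W. open W \<and> b \<in> W \<and> W \<subseteq> V \<and> (\<forall>b'\<in>W. F b' = F b)}"

definition cas_sheaf ::
    "('m::topological_space, 'e::euclidean_space, 'b::topological_space, 'f::euclidean_space) nci_data
     \<Rightarrow> 'b fsheaf" where
  "cas_sheaf S V = {F. casimir (atlasB S) (poisB S) V F}"

definition casM_sheaf ::
    "('m::topological_space, 'e::euclidean_space, 'b::topological_space, 'f::euclidean_space) nci_data
     \<Rightarrow> 'b fsheaf" where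
  "casM_sheaf S V = {F. smooth_fun (atlasB S) V F \<and>
     casimir (atlasM S) (poisM S) (proj S -` V) (F \<circ> proj S)}"

text \<open>The connecting homomorphism of the sequence of Casimir sheaves: lift \<open>s\<close> to Casimirs \<open>g U\<close> on
  the members \<open>U\<close> of some open cover and take the class of the differences of these lifts. A lift
  exists exactly when \<open>s\<close> is a section of \<open>\<E>\<^sup>0\<close>; otherwise \<open>Obs S s\<close> is empty and so is not an
  element of \<open>H\<^sup>1\<close>.\<close>

definition Obs ::
    "('m::topological_space, 'e::euclidean_space, 'b::topological_space, 'f::euclidean_space) nci_data
     \<Rightarrow> ('b \<Rightarrow> 'b covec set) \<Rightarrow> 'b cech1 set" where
  "Obs S s = cohomologous (casM_sheaf S) `` {(C, \<lambda>U V b. g V b - g U b) | C g.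
     open_cover C \<and> (\<forall>U\<in>C. g U \<in> cas_sheaf S U \<and>
       (\<forall>b\<in>U. s b = action_class S b (differential (atlasB S) (g U) b)))}"

definition representable_by_constants ::
    "('m::topological_space, 'e::euclidean_space, 'b::topological_space, 'f::euclidean_space) nci_data
     \<Rightarrow> 'b cech1 set \<Rightarrow> bool" where
  "representable_by_constants S c \<longleftrightarrow> c \<in> H1_inclusion (casM_sheaf S) ` H1 const_sheaf"

end

theory Submission
  imports Defs
begin

text \<open>
  If the lifts of \<open>\<ell>\<^sub>i\<close> to local Casimirs can be chosen with locally constant differences, their
  differentials glue to closed 1-forms on \<open>B\<close>, and the common kernel of these forms is the action
  foliation. Conversely, on a domain of local action variables \<open>p\<^sub>j\<close> one has
  \<open>\<ell>\<^sub>i = \<Sum>\<^sub>j k\<^sub>i\<^sub>j [dp\<^sub>j]\<close> with locally constant integers \<open>k\<^sub>i\<^sub>j\<close>; the Casimirs \<open>\<Sum>\<^sub>j k\<^sub>i\<^sub>j p\<^sub>j\<close> are lifts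
  whose differentials vanish on the action foliation, so two of them differ by a function whose
  differential is a combination of the \<open>dp\<^sub>j\<close> with zero class in \<open>E\<^sub>b\<close>, hence is zero.

  Both directions need that a \<open>\<int>\<close>-basis of \<open>L\<^sub>b\<close> is linearly independent over \<open>\<real>\<close>. A real relation
  would, by simultaneous Dirichlet approximation, yield nonzero lattice elements with
  arbitrarily small coefficients with respect to an independent subfamily. The orbits of such an
  element have period 1 and stay close to their starting point, so by Rolle's theorem its action
  vector field almost annihilates every function, relative to the size of the coefficients.
  The local constancy of the \<open>k\<^sub>i\<^sub>j\<close> combines this independence with the openness of \<open>\<phi>\<close>.
\<close>

subsection \<open>Smooth functions on open sets\<close>

text \<open>Independence over the reals has to be proved because \<open>lattice_basis\<close> says
  only that integral combinations enumerate \<open>L_b\<close> without repetition. A subgroup of a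
  vector space can have this property and be dense, like the one generated by 1 and an irrational
  number in the line. Two points shape the argument that excludes this. The estimate along an orbit
  must be relative to the size of the coefficients, because a small lattice element has a small
  action field anyway. And it can be used for finitely many pairs (point of the fiber, test
  function) only, because the admissible size of the coefficients depends on the pair. Hence
  \<open>coercive_tests\<close>: finitely many pairs already bound the coefficients of an
  independent family. The same lemma yields the local constancy. The integers are found fiber by
  fiber, without any continuity, but two integer vectors that nearly agree in finitely many tests
  are equal. Tests are made at points of M, and openness of \<open>\<phi>\<close> lets every nearby
  b be tested close to the same points. Independence is also what gives the common kernel of the
  closed forms its codimension r.\<close>

abbreviation partial_derivative :: "('a::euclidean_space \<Rightarrow> real) \<Rightarrow> 'a \<Rightarrow> 'a \<Rightarrow> real" (\<open>\<partial>\<close>) where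
  "\<partial> f x \<equiv> frechet_derivative f (at x)"

lemma Ck_on_subset: "Ck_on k S f \<Longrightarrow> T \<subseteq> S \<Longrightarrow> Ck_on k T f"
proof (induction k arbitrary: f)
  case 0
  then show ?case by (auto intro: continuous_on_subset)
next
  case (Suc k)
  have "Ck_on k T (\<lambda>x. \<partial> f x i)" if "i \<in> Basis" for i
    using Suc.IH[of "\<lambda>x. \<partial> f x i"] Suc.prems that by simp
  then show ?case using Suc.prems by auto
qed

lemma Cinf_on_subset: "Cinf_on S f \<Longrightarrow> T \<subseteq> S \<Longrightarrow> Cinf_on T f"
  unfolding Cinf_on_def using Ck_on_subset by blast

lemma frechet_derivative_cong_open:
  assumes "open S" "x \<in> S" "\<And>y. y \<in> S \<Longrightarrow> f y = g y"
  shows "f differentiable (at x) \<longleftrightarrow> g differentiable (at x)"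
    and "\<partial> f x = \<partial> g x"
proof -
  have *: "(f has_derivative D) (at x) \<longleftrightarrow> (g has_derivative D) (at x)" for D
    using has_derivative_transform_within_open[OF _ assms(1,2)] assms(3) by (metis (full_types))
  then show "f differentiable (at x) \<longleftrightarrow> g differentiable (at x)"
    by (simp add: differentiable_def)
  show "\<partial> f x = \<partial> g x"
    unfolding frechet_derivative_def using * by simp
qed

lemma Ck_on_cong:
  assumes "open S" "\<And>y. y \<in> S \<Longrightarrow> f y = g y"
  shows "Ck_on k S f \<longleftrightarrow> Ck_on k S g"
  using assms(2)
proof (induction k arbitrary: f g)
  case 0
  then show ?case unfolding Ck_on.simps by (intro continuous_on_cong) auto
next
  case (Suc k)
  have "Ck_on k S (\<lambda>x. \<partial> f x i) \<longleftrightarrow> Ck_on k S (\<lambda>x. \<partial> g x i)" for i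
    using frechet_derivative_cong_open(2)[OF assms(1) _ Suc.prems] by (intro Suc.IH) simp
  moreover have "f differentiable (at x) \<longleftrightarrow> g differentiable (at x)" if "x \<in> S" for x
    using frechet_derivative_cong_open(1)[OF assms(1) that Suc.prems] by simp
  ultimately show ?case by simp
qed

lemma Ck_on_SucD: "Ck_on (Suc k) S f \<Longrightarrow> Ck_on k S f"
proof (induction k arbitrary: f)
  case 0
  then show ?case
    by (auto simp: continuous_at_imp_continuous_on differentiable_imp_continuous_within)
next
  case (Suc k)
  have "Ck_on k S (\<lambda>x. \<partial> f x i)" if "i \<in> Basis" for i
    using Suc.IH[of "\<lambda>x. \<partial> f x i"] Suc.prems that by simp
  then show ?case using Suc.prems by simp
qed

lemma Ck_on_imp_continuous: "Ck_on k S f \<Longrightarrow> continuous_on S f"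
  by (induction k) (simp, blast dest: Ck_on_SucD)

text \<open>Allows the derivative to be given by any formula \<open>D\<close>: on the open set
  \<open>S\<close> it agrees with \<open>frechet_derivative\<close>, in terms of which
  \<open>Ck_on\<close> is defined.\<close>

lemma Ck_on_SucI:
  assumes "open S" "\<And>x. x \<in> S \<Longrightarrow> (f has_derivative D x) (at x)"
    and "\<And>i. i \<in> Basis \<Longrightarrow> Ck_on k S (\<lambda>x. D x i)"
  shows "Ck_on (Suc k) S f"
proof -
  have "Ck_on k S (\<lambda>x. \<partial> f x i)" if "i \<in> Basis" for i
    using assms(3)[OF that]
    by (subst Ck_on_cong[OF assms(1), where g = "\<lambda>x. D x i"])
       (simp_all add: frechet_derivative_at[OF assms(2), symmetric])
  then show ?thesis using assms(2) by (auto simp: differentiable_def)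
qed

lemma Ck_on_SucE:
  assumes "Ck_on (Suc k) S f" "x \<in> S"
  shows "(f has_derivative \<partial> f x) (at x)"
  using assms by (simp add: frechet_derivative_works)

lemma Ck_on_const: "open S \<Longrightarrow> Ck_on k S (\<lambda>x. c)"
proof (induction k arbitrary: c)
  case 0
  then show ?case by simp
next
  case (Suc k)
  then show ?case by (intro Ck_on_SucI[where D = "\<lambda>x y. 0"]) auto
qed

lemma Ck_on_add:
  assumes "open S"
  shows "Ck_on k S f \<Longrightarrow> Ck_on k S g \<Longrightarrow> Ck_on k S (\<lambda>x. f x + g x)"
proof (induction k arbitrary: f g)
  case 0
  then show ?case by (auto intro: continuous_intros)
next
  case (Suc k)
  show ?case
  proof (rule Ck_on_SucI[OF assms])
    show "((\<lambda>x. f x + g x) has_derivative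
            (\<lambda>i. \<partial> f x i + \<partial> g x i)) (at x)" if "x \<in> S" for x
      by (intro has_derivative_add Ck_on_SucE[OF Suc.prems(1) that] Ck_on_SucE[OF Suc.prems(2) that])
  qed (use Suc in auto)
qed

lemma Ck_on_mult:
  assumes "open S"
  shows "Ck_on k S f \<Longrightarrow> Ck_on k S g \<Longrightarrow> Ck_on k S (\<lambda>x. f x * g x)"
proof (induction k arbitrary: f g)
  case 0
  then show ?case by (auto intro: continuous_intros)
next
  case (Suc k)
  show ?case
  proof (rule Ck_on_SucI[OF assms])
    show "((\<lambda>x. f x * g x) has_derivative
            (\<lambda>i. f x * \<partial> g x i + \<partial> f x i * g x)) (at x)"
      if "x \<in> S" for x
      by (intro has_derivative_mult Ck_on_SucE[OF Suc.prems(1) that] Ck_on_SucE[OF Suc.prems(2) that])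
    show "Ck_on k S (\<lambda>x. f x * \<partial> g x i + \<partial> f x i * g x)"
      if "i \<in> Basis" for i
      using Suc.prems that
      by (intro Ck_on_add[OF assms] Suc.IH) (auto intro: Ck_on_SucD[OF Suc.prems(1)] Ck_on_SucD[OF Suc.prems(2)])
  qed
qed

lemma Ck_on_sum:
  assumes "open S" "\<And>i. i \<in> I \<Longrightarrow> Ck_on k S (f i)"
  shows "Ck_on k S (\<lambda>x. \<Sum>i\<in>I. f i x)"
proof (cases "finite I")
  case True
  then show ?thesis using assms(2)
    by (induction I) (auto intro: Ck_on_const Ck_on_add assms(1))
qed (simp add: Ck_on_const assms(1))

lemma Cinf_on_linear:
  assumes "open S" "bounded_linear f"
  shows "Cinf_on S f"
  unfolding Cinf_on_def
proof
  fix k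
  show "Ck_on k S f"
  proof (cases k)
    case 0
    then show ?thesis using assms(2) by (auto simp: linear_continuous_on)
  next
    case (Suc k')
    show ?thesis unfolding Suc
      by (rule Ck_on_SucI[OF assms(1), where D = "\<lambda>x. f"])
         (auto intro: Ck_on_const[OF assms(1)] bounded_linear_imp_has_derivative[OF assms(2)])
  qed
qed

lemma Cinf_on_has_derivative:
  "Cinf_on S f \<Longrightarrow> x \<in> S \<Longrightarrow> (f has_derivative \<partial> f x) (at x)"
  unfolding Cinf_on_def using Ck_on_SucE by blast

lemma Cinf_on_continuous: "Cinf_on S f \<Longrightarrow> continuous_on S f"
  unfolding Cinf_on_def using Ck_on.simps(1) by blast

lemma Cinf_on_partial: "Cinf_on S f \<Longrightarrow> i \<in> Basis \<Longrightarrow> Cinf_on S (\<lambda>x. \<partial> f x i)"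
  unfolding Cinf_on_def using Ck_on.simps(2) by blast

text \<open>The inner map is smooth of every order, so the chain rule lowers the order of
  \<open>g\<close> alone and the induction on \<open>k\<close> can run over
  \<open>g\<close>.\<close>

lemma Ck_on_compose:
  fixes T :: "'a::euclidean_space \<Rightarrow> 'b::euclidean_space"
  assumes "open S" "open Q" "\<And>x. x \<in> S \<Longrightarrow> T x \<in> Q"
    and T: "\<And>j. j \<in> Basis \<Longrightarrow> Cinf_on S (\<lambda>x. T x \<bullet> j)"
  shows "Ck_on k Q g \<Longrightarrow> Ck_on k S (\<lambda>x. g (T x))"
proof (induction k arbitrary: g)
  case 0
  have "continuous_on S T"
    using T Cinf_on_continuous continuous_on_componentwise by blast
  then show ?case using 0 assms(3) by (auto intro!: continuous_on_compose2[of Q g S T])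
next
  case (Suc k)
  define DT where "DT x w = (\<Sum>j\<in>Basis. \<partial> (\<lambda>x. T x \<bullet> j) x w *\<^sub>R j)" for x w
  have DT: "(T has_derivative DT x) (at x)" if "x \<in> S" for x
  proof -
    have "((\<lambda>y. \<Sum>j\<in>Basis. (T y \<bullet> j) *\<^sub>R j) has_derivative DT x) (at x)"
      unfolding DT_def
      by (intro has_derivative_sum has_derivative_scaleR_left Cinf_on_has_derivative[OF T that])
    then show ?thesis by (simp add: euclidean_representation)
  qed
  show ?case
  proof (rule Ck_on_SucI[OF assms(1)])
    fix x assume x: "x \<in> S"
    have dg: "(g has_derivative \<partial> g (T x)) (at (T x))"
      using Ck_on_SucE[OF Suc.prems assms(3)[OF x]] .
    have "\<partial> g (T x) (DT x w) =
        (\<Sum>j\<in>Basis. \<partial> (\<lambda>x. T x \<bullet> j) x w * \<partial> g (T x) j)" for w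
      unfolding DT_def using has_derivative_linear[OF dg] by (simp add: linear_sum linear_scale)
    with has_derivative_compose[OF DT[OF x] dg]
    show "((\<lambda>x. g (T x)) has_derivative
       (\<lambda>w. \<Sum>j\<in>Basis. \<partial> (\<lambda>x. T x \<bullet> j) x w * \<partial> g (T x) j)) (at x)"
      by simp
  next
    fix i :: 'a assume i: "i \<in> Basis"
    show "Ck_on k S (\<lambda>x. \<Sum>j\<in>Basis. \<partial> (\<lambda>x. T x \<bullet> j) x i *
                              \<partial> g (T x) j)"
      using Suc.prems Cinf_on_partial[OF T i]
      by (intro Ck_on_sum[OF assms(1)] Ck_on_mult[OF assms(1)] Suc.IH) (auto simp: Cinf_on_def)
  qed
qed

lemma Cinf_on_compose:
  fixes T :: "'a::euclidean_space \<Rightarrow> 'b::euclidean_space"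
  assumes "open S" "open Q" "\<And>x. x \<in> S \<Longrightarrow> T x \<in> Q"
    and "\<And>j. j \<in> Basis \<Longrightarrow> Cinf_on S (\<lambda>x. T x \<bullet> j)" "Cinf_on Q g"
  shows "Cinf_on S (\<lambda>x. g (T x))"
  using Ck_on_compose[OF assms(1-4)] assms(5) by (auto simp: Cinf_on_def)

lemma Cinf_on_const: "open S \<Longrightarrow> Cinf_on S (\<lambda>x. c)"
  and Cinf_on_add: "open S \<Longrightarrow> Cinf_on S f \<Longrightarrow> Cinf_on S g \<Longrightarrow> Cinf_on S (\<lambda>x. f x + g x)"
  and Cinf_on_mult: "open S \<Longrightarrow> Cinf_on S f \<Longrightarrow> Cinf_on S g \<Longrightarrow> Cinf_on S (\<lambda>x. f x * g x)"
  by (simp_all add: Cinf_on_def Ck_on_const Ck_on_add Ck_on_mult)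

lemma linear_real_expand:
  fixes f :: "'a::euclidean_space \<Rightarrow> real"
  assumes "linear f"
  shows "f w = (\<Sum>i\<in>Basis. (w \<bullet> i) * f i)"
proof -
  have "f w = f (\<Sum>i\<in>Basis. (w \<bullet> i) *\<^sub>R i)" by (simp add: euclidean_representation)
  also have "\<dots> = (\<Sum>i\<in>Basis. (w \<bullet> i) * f i)"
    by (simp only: linear_sum[OF assms] linear_scale[OF assms] real_scaleR_def)
  finally show ?thesis .
qed

lemma ball_segment:
  fixes y0 y :: "'a::real_normed_vector"
  assumes "y \<in> ball y0 \<rho>" "0 \<le> t" "t \<le> 1"
  shows "y0 + t *\<^sub>R (y - y0) \<in> ball y0 \<rho>"
proof -
  have "norm (t *\<^sub>R (y - y0)) \<le> norm (y - y0)"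
    using assms(2,3) by (simp add: mult_left_le_one_le)
  then show ?thesis using assms(1) by (simp add: dist_norm norm_minus_commute)
qed

text \<open>Each differentiation in y under the integral sign produces one more factor t; the weight
  \<open>t ^ n\<close> with arbitrary \<open>n\<close> makes the induction close.\<close>

lemma Ck_on_integral:
  fixes y0 :: "'a::euclidean_space"
  shows "Ck_on k (ball y0 \<rho>) G \<Longrightarrow>
    Ck_on k (ball y0 \<rho>) (\<lambda>y. integral {0..1} (\<lambda>t. t ^ n * G (y0 + t *\<^sub>R (y - y0))))"
proof (induction k arbitrary: G n)
  let ?B = "ball y0 \<rho>"
  have cont: "continuous_on (?B \<times> cbox 0 (1::real)) (\<lambda>(y, t). t ^ m * H (y0 + t *\<^sub>R (y - y0)))"
    if "continuous_on ?B H" for H :: "'a \<Rightarrow> real" and m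
    unfolding split_beta
    by (intro continuous_intros continuous_on_compose2[OF that]) (use ball_segment in auto)
  {
    case 0
    from cont[of G n] 0 show ?case
      using integral_continuous_on_param[of ?B 0 "1::real" "\<lambda>y t. t ^ n * G (y0 + t *\<^sub>R (y - y0))"]
      by simp
  next
    case (Suc k)
    define f where "f y t = t ^ n * G (y0 + t *\<^sub>R (y - y0))" for y and t :: real
    define g where "g i y t = t ^ Suc n * \<partial> G (y0 + t *\<^sub>R (y - y0)) i" for i y and t :: real
    \<comment> \<open>\<open>leibniz_rule\<close> takes the derivative as a continuous family of
      bounded linear maps. Expanding it in the inner products with basis vectors reduces its
      continuity to that of the partial derivatives.\<close>
    define fx where "fx y t = (\<Sum>i\<in>Basis. g i y t *\<^sub>R blinfun_inner_left i)" for y and t :: real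
    have contG: "continuous_on ?B G"
      using Suc.prems by (auto intro: continuous_at_imp_continuous_on differentiable_imp_continuous_within)
    have contg: "continuous_on (?B \<times> cbox 0 1) (\<lambda>(y, t). g i y t)" if "i \<in> Basis" for i
    proof -
      have "Ck_on k ?B (\<lambda>x. \<partial> G x i)" using Suc.prems that by simp
      then have "continuous_on ?B (\<lambda>x. \<partial> G x i)"
        by (rule Ck_on_imp_continuous)
      from cont[OF this, of "Suc n"] show ?thesis by (simp add: g_def)
    qed
    have slice: "continuous_on (cbox 0 1) (\<lambda>t. H y t)"
      if "continuous_on (?B \<times> cbox 0 1) (\<lambda>(y, t). H y t)" "y \<in> ?B" for H :: "'a \<Rightarrow> real \<Rightarrow> real" and y
    proof -
      have "continuous_on (cbox 0 1) (\<lambda>t::real. (y, t))" by (intro continuous_intros)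
      moreover have "Pair y ` cbox 0 1 \<subseteq> ?B \<times> cbox 0 1" using that(2) by auto
      ultimately show ?thesis using continuous_on_compose2[OF that(1)] by fastforce
    qed
    have der: "((\<lambda>y. f y t) has_derivative blinfun_apply (fx y t)) (at y within ?B)"
      if y: "y \<in> ?B" and t: "t \<in> cbox 0 1" for y t
    proof -
      let ?p = "y0 + t *\<^sub>R (y - y0)"
      have dG: "(G has_derivative \<partial> G ?p) (at ?p)"
        by (rule Ck_on_SucE[OF Suc.prems]) (use ball_segment y t in auto)
      have "((\<lambda>y. y0 + t *\<^sub>R (y - y0)) has_derivative (\<lambda>w. t *\<^sub>R w)) (at y)"
        by (auto intro!: derivative_eq_intros)
      from has_derivative_compose[OF this dG]
      have 1: "((\<lambda>y. f y t) has_derivative (\<lambda>w. t ^ n * \<partial> G ?p (t *\<^sub>R w))) (at y)"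
        unfolding f_def by (intro has_derivative_mult_right)
      have lin: "linear (\<partial> G ?p)" using has_derivative_linear[OF dG] .
      have "t ^ n * \<partial> G ?p (t *\<^sub>R w) = blinfun_apply (fx y t) w" for w
      proof -
        have "t ^ n * \<partial> G ?p (t *\<^sub>R w) = t ^ Suc n * \<partial> G ?p w"
          by (simp only: linear_scale[OF lin] power_Suc real_scaleR_def mult_ac)
        also have "\<dots> = (\<Sum>i\<in>Basis. g i y t * (w \<bullet> i))"
          unfolding g_def linear_real_expand[OF lin, of w] sum_distrib_left by (simp only: mult_ac)
        also have "\<dots> = blinfun_apply (fx y t) w"
          unfolding fx_def by (simp add: blinfun.sum_left blinfun.scaleR_left)
        finally show ?thesis .
      qed
      with 1 show ?thesis by (simp add: has_derivative_at_withinI)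
    qed
    define D where "D y w = (\<Sum>i\<in>Basis. integral {0..1} (g i y) * (w \<bullet> i))" for y w
    have "((\<lambda>y. integral (cbox 0 1) (f y)) has_derivative integral (cbox 0 1) (fx y)) (at y within ?B)"
      if y: "y \<in> ?B" for y
    proof (rule leibniz_rule[OF der _ _ y])
      show "f z integrable_on cbox 0 1" if "z \<in> ?B" for z
        using slice[of f, OF _ that] cont[OF contG, of n] unfolding f_def
        by (intro integrable_continuous) auto
      show "continuous_on (?B \<times> cbox 0 1) (\<lambda>(y, t). fx y t)"
        using contg unfolding fx_def split_beta by (intro continuous_intros) auto
    qed auto
    moreover have "blinfun_apply (integral (cbox 0 1) (fx y)) = D y" if y: "y \<in> ?B" for y
    proof -
      have "((\<lambda>t. fx y t) has_integral (\<Sum>i\<in>Basis. integral {0..1} (g i y) *\<^sub>R blinfun_inner_left i)) (cbox 0 1)"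
        unfolding fx_def
      proof (intro has_integral_sum has_integral_scaleR_left)
        fix i :: 'a assume "i \<in> Basis"
        then have "g i y integrable_on cbox 0 1"
          using slice[OF contg[of i] y] by (intro integrable_continuous) auto
        then show "(g i y has_integral integral {0..1} (g i y)) (cbox 0 1)"
          by (simp add: integrable_integral)
      qed auto
      then show ?thesis
        by (auto simp: integral_unique blinfun.sum_left blinfun.scaleR_left D_def)
    qed
    ultimately have "((\<lambda>y. integral (cbox 0 1) (f y)) has_derivative D y) (at y)" if "y \<in> ?B" for y
      using that by (metis at_within_open[OF that open_ball])
    then have "Ck_on (Suc k) ?B (\<lambda>y. integral (cbox 0 1) (f y))"
    proof (rule Ck_on_SucI[OF open_ball])
      fix i :: 'a assume i: "i \<in> Basis"
      have "D y i = integral {0..1} (g i y)" for y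
        using i by (simp add: D_def inner_Basis if_distrib cong: if_cong)
      moreover have "Ck_on k ?B (\<lambda>y. integral {0..1} (g i y))"
        unfolding g_def using Suc.prems i by (intro Suc.IH) auto
      ultimately show "Ck_on k ?B (\<lambda>y. D y i)" by simp
    qed auto
    then show ?case by (simp add: f_def[abs_def] del: Ck_on.simps)
  }
qed

text \<open>Integrate the derivative of \<open>g\<close> along the segment from \<open>y0\<close> to
  \<open>y\<close>. This is the source of the coordinate formula for derivations in
  \<open>tangent_chart\<close>.\<close>

lemma Hadamard_lemma:
  fixes y0 :: "'a::euclidean_space"
  assumes g: "Cinf_on (ball y0 \<rho>) g" and "0 < \<rho>"
  obtains h where "\<And>i. i \<in> Basis \<Longrightarrow> Cinf_on (ball y0 \<rho>) (h i)"
    and "\<And>y. y \<in> ball y0 \<rho> \<Longrightarrow> g y = g y0 + (\<Sum>i\<in>Basis. ((y - y0) \<bullet> i) * h i y)"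
    and "\<And>i. h i y0 = \<partial> g y0 i"
proof
  let ?B = "ball y0 \<rho>"
  \<comment> \<open>The factor \<open>t ^ 0\<close> only gives the integral the shape of
    \<open>Ck_on_integral\<close> with \<open>n = 0\<close>.\<close>
  define h where "h i y = integral {0..1} (\<lambda>t. t ^ 0 * \<partial> g (y0 + t *\<^sub>R (y - y0)) i)" for i y
  show "Cinf_on ?B (h i)" if "i \<in> Basis" for i
    using Ck_on_integral[of _ y0 \<rho> _ 0] Cinf_on_partial[OF g that]
    unfolding Cinf_on_def h_def by auto
  show "h i y0 = \<partial> g y0 i" for i by (simp add: h_def)
  fix y assume y: "y \<in> ?B"
  have seg: "y0 + t *\<^sub>R (y - y0) \<in> ?B" if "t \<in> {0..1}" for t using ball_segment[OF y] that by auto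
  have rep: "\<partial> g p w = (\<Sum>i\<in>Basis. (w \<bullet> i) * \<partial> g p i)"
    if "p \<in> ?B" for p w
  proof -
    have lin: "linear (\<partial> g p)"
      using has_derivative_linear[OF Cinf_on_has_derivative[OF g that]] .
    show ?thesis by (rule linear_real_expand[OF lin])
  qed
  have 1: "((\<lambda>t. \<partial> g (y0 + t *\<^sub>R (y - y0)) (y - y0)) has_integral
      (g (y0 + 1 *\<^sub>R (y - y0)) - g (y0 + 0 *\<^sub>R (y - y0)))) {0..1}"
  proof (rule fundamental_theorem_of_calculus)
    fix t :: real assume t: "t \<in> {0..1}"
    have d: "((\<lambda>t. y0 + t *\<^sub>R (y - y0)) has_derivative (\<lambda>s. s *\<^sub>R (y - y0))) (at t)"
      by (auto intro!: derivative_eq_intros)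
    have dg: "(g has_derivative \<partial> g (y0 + t *\<^sub>R (y - y0))) (at (y0 + t *\<^sub>R (y - y0)))"
      using Cinf_on_has_derivative[OF g seg[OF t]] .
    from has_derivative_compose[OF d dg]
    show "((\<lambda>t. g (y0 + t *\<^sub>R (y - y0))) has_vector_derivative
        \<partial> g (y0 + t *\<^sub>R (y - y0)) (y - y0)) (at t within {0..1})"
      unfolding has_vector_derivative_def using has_derivative_linear[OF dg]
      by (auto simp: linear_scale intro: has_derivative_at_withinI)
  qed simp
  have 2: "((\<lambda>t. \<Sum>i\<in>Basis. ((y - y0) \<bullet> i) * \<partial> g (y0 + t *\<^sub>R (y - y0)) i) has_integral
      (\<Sum>i\<in>Basis. ((y - y0) \<bullet> i) * h i y)) {0..1}"
  proof (intro has_integral_sum has_integral_mult_right)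
    fix i :: 'a assume i: "i \<in> Basis"
    have "continuous_on {0..1} (\<lambda>t. \<partial> g (y0 + t *\<^sub>R (y - y0)) i)"
      by (intro continuous_on_compose2[OF Cinf_on_continuous[OF Cinf_on_partial[OF g i]]] continuous_intros)
         (use seg in auto)
    then show "((\<lambda>t. \<partial> g (y0 + t *\<^sub>R (y - y0)) i) has_integral h i y) {0..1}"
      unfolding h_def by (simp add: integrable_integral integrable_continuous_real)
  qed auto
  have "((\<lambda>t. \<partial> g (y0 + t *\<^sub>R (y - y0)) (y - y0)) has_integral
      (\<Sum>i\<in>Basis. ((y - y0) \<bullet> i) * h i y)) {0..1}"
    by (rule has_integral_eq[OF _ 2]) (rule rep[OF seg, symmetric])
  from has_integral_unique[OF 1 this]
  show "g y = g y0 + (\<Sum>i\<in>Basis. ((y - y0) \<bullet> i) * h i y)" by simp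
qed

subsection \<open>Smooth functions on manifolds\<close>

lemma smooth_in_chart_cong_subset:
  assumes "smooth_in_chart c S f" "T \<subseteq> S" "\<And>m. m \<in> T \<Longrightarrow> f m = g m"
  shows "smooth_in_chart c T g"
  unfolding smooth_in_chart_def
proof
  fix m assume "m \<in> T \<inter> fst c"
  then obtain Q h where Q: "open Q" "snd c m \<in> Q" "Cinf_on Q h"
    and h: "\<forall>m' \<in> S \<inter> fst c. snd c m' \<in> Q \<longrightarrow> f m' = h (snd c m')"
    using assms(1,2) unfolding smooth_in_chart_def by blast
  have "\<forall>m' \<in> T \<inter> fst c. snd c m' \<in> Q \<longrightarrow> g m' = h (snd c m')"
    using h assms(2,3) by auto
  with Q show "\<exists>Q h. open Q \<and> snd c m \<in> Q \<and> Cinf_on Q h \<and>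
        (\<forall>m' \<in> T \<inter> fst c. snd c m' \<in> Q \<longrightarrow> g m' = h (snd c m'))" by blast
qed

lemma smooth_fun_subset: "smooth_fun A S f \<Longrightarrow> T \<subseteq> S \<Longrightarrow> smooth_fun A T f"
  unfolding smooth_fun_def by (auto intro: smooth_in_chart_cong_subset)

lemma smooth_fun_cong: "smooth_fun A S f \<Longrightarrow> (\<And>m. m \<in> S \<Longrightarrow> f m = g m) \<Longrightarrow> smooth_fun A S g"
  unfolding smooth_fun_def by (blast intro: smooth_in_chart_cong_subset)

text \<open>In a chart the components of \<open>F\<close> have smooth representatives, which combine
  to a map \<open>T\<close>; on the open set where \<open>T\<close> takes values in
  \<open>Q\<close>, the function \<open>g\<close> after \<open>T\<close> represents the composite.
  Sums and products of smooth functions are the case of a pair of functions.\<close>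

lemma smooth_fun_compose:
  fixes F :: "'m::topological_space \<Rightarrow> 'c::euclidean_space"
  assumes F: "\<And>j. j \<in> Basis \<Longrightarrow> smooth_fun A S (\<lambda>m. F m \<bullet> j)"
    and "open Q" "F ` S \<subseteq> Q" "Cinf_on Q g"
  shows "smooth_fun A S (\<lambda>m. g (F m))"
  unfolding smooth_fun_def smooth_in_chart_def
proof (intro ballI)
  fix c m assume c: "c \<in> A" and m: "m \<in> S \<inter> fst c"
  have "\<forall>j\<in>Basis. \<exists>Q h. open Q \<and> snd c m \<in> Q \<and> Cinf_on Q h \<and>
        (\<forall>m' \<in> S \<inter> fst c. snd c m' \<in> Q \<longrightarrow> F m' \<bullet> j = h (snd c m'))"
    using F c m unfolding smooth_fun_def smooth_in_chart_def by blast
  then obtain P h where P: "\<And>j. j \<in> Basis \<Longrightarrow> open (P j) \<and> snd c m \<in> P j \<and> Cinf_on (P j) (h j) \<and>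
        (\<forall>m' \<in> S \<inter> fst c. snd c m' \<in> P j \<longrightarrow> F m' \<bullet> j = h j (snd c m'))"
    by metis
  define P0 where "P0 = (\<Inter>j\<in>Basis. P j)"
  define T where "T y = (\<Sum>j\<in>Basis. h j y *\<^sub>R j)" for y
  have P0: "open P0" "snd c m \<in> P0" unfolding P0_def using P by auto
  have hC: "Cinf_on P0 (h j)" if "j \<in> Basis" for j
    using P[OF that] Cinf_on_subset unfolding P0_def using that by blast
  have Tj: "T y \<bullet> j = h j y" if "j \<in> Basis" for y j
    using that by (simp add: T_def)
  have contT: "continuous_on P0 T"
    unfolding T_def using hC by (intro continuous_intros Cinf_on_continuous) auto
  have FT: "F m' = T (snd c m')" if "m' \<in> S \<inter> fst c" "snd c m' \<in> P0" for m'
    by (rule euclidean_eqI) (use P that in \<open>auto simp: Tj P0_def\<close>)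
  let ?Q = "P0 \<inter> T -` Q"
  have oQ: "open ?Q" using continuous_open_preimage[OF contT P0(1) assms(2)] .
  have "Cinf_on ?Q (\<lambda>y. g (T y))"
  proof (rule Cinf_on_compose[OF oQ assms(2) _ _ assms(4)])
    fix j :: 'c assume j: "j \<in> Basis"
    have "(\<lambda>y. T y \<bullet> j) = h j" using Tj[OF j] by auto
    then show "Cinf_on ?Q (\<lambda>y. T y \<bullet> j)" using Cinf_on_subset[OF hC[OF j]] by auto
  qed auto
  then show "\<exists>Q h. open Q \<and> snd c m \<in> Q \<and> Cinf_on Q h \<and>
        (\<forall>m' \<in> S \<inter> fst c. snd c m' \<in> Q \<longrightarrow> g (F m') = h (snd c m'))"
    using oQ P0(2) FT m assms(3) by (intro exI[of _ ?Q] exI[of _ "\<lambda>y. g (T y)"]) auto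
qed

lemma smooth_fun_const: "smooth_fun A S (\<lambda>m. c)"
  unfolding smooth_fun_def smooth_in_chart_def
  by (auto intro!: exI[of _ UNIV] exI[of _ "\<lambda>_. c"] Cinf_on_const)

lemma smooth_fun_add:
  assumes "smooth_fun A S f" "smooth_fun A S g"
  shows "smooth_fun A S (\<lambda>m. f m + g m)"
proof -
  have 1: "Cinf_on UNIV (\<lambda>y::real \<times> real. fst y + snd y)"
    by (intro Cinf_on_add Cinf_on_linear) (auto intro: bounded_linear_fst bounded_linear_snd)
  have 2: "smooth_fun A S (\<lambda>m. (f m, g m) \<bullet> j)" if "j \<in> Basis" for j
    using that assms by (auto simp: Basis_prod_def)
  from smooth_fun_compose[where F = "\<lambda>m. (f m, g m)", OF 2 open_UNIV _ 1]
  show ?thesis by simp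
qed

lemma smooth_fun_mult:
  assumes "smooth_fun A S f" "smooth_fun A S g"
  shows "smooth_fun A S (\<lambda>m. f m * g m)"
proof -
  have 1: "Cinf_on UNIV (\<lambda>y::real \<times> real. fst y * snd y)"
    by (intro Cinf_on_mult Cinf_on_linear) (auto intro: bounded_linear_fst bounded_linear_snd)
  have 2: "smooth_fun A S (\<lambda>m. (f m, g m) \<bullet> j)" if "j \<in> Basis" for j
    using that assms by (auto simp: Basis_prod_def)
  from smooth_fun_compose[where F = "\<lambda>m. (f m, g m)", OF 2 open_UNIV _ 1]
  show ?thesis by simp
qed

lemma smooth_fun_sum:
  assumes "\<And>i. i \<in> I \<Longrightarrow> smooth_fun A S (f i)"
  shows "smooth_fun A S (\<lambda>m. \<Sum>i\<in>I. f i m)"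
proof (cases "finite I")
  case True
  then show ?thesis using assms
    by (induction I) (auto intro: smooth_fun_const smooth_fun_add)
qed (simp add: smooth_fun_const)

lemma smooth_fun_diff:
  assumes "smooth_fun A S f" "smooth_fun A S g"
  shows "smooth_fun A S (\<lambda>m. f m - g m)"
  using smooth_fun_add[OF assms(1) smooth_fun_mult[OF smooth_fun_const[of A S "-1"] assms(2)]] by simp

lemma smooth_atI: "smooth_fun A U f \<Longrightarrow> open U \<Longrightarrow> m \<in> U \<Longrightarrow> smooth_at A m f"
  unfolding smooth_at_def by blast

lemma smooth_at_cong:
  assumes "smooth_at A m f" "\<forall>\<^sub>F x in nhds m. f x = g x"
  shows "smooth_at A m g"
proof -
  obtain U where U: "open U" "m \<in> U" "smooth_fun A U f" using assms(1) unfolding smooth_at_def by blast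
  obtain N where N: "open N" "m \<in> N" "\<And>x. x \<in> N \<Longrightarrow> f x = g x"
    using assms(2) unfolding eventually_nhds by blast
  have "smooth_fun A (U \<inter> N) g"
    by (rule smooth_fun_cong[OF smooth_fun_subset[OF U(3)]]) (use N in auto)
  then show ?thesis using U N by (intro smooth_atI[of A "U \<inter> N"]) auto
qed

lemma smooth_at_binary:
  assumes "\<And>U. smooth_fun A U f \<Longrightarrow> smooth_fun A U g \<Longrightarrow> smooth_fun A U h"
    and "smooth_at A m f" "smooth_at A m g"
  shows "smooth_at A m h"
proof -
  obtain U W where "open U" "m \<in> U" "smooth_fun A U f" "open W" "m \<in> W" "smooth_fun A W g"
    using assms(2,3) unfolding smooth_at_def by blast
  then show ?thesis
    by (intro smooth_atI[of A "U \<inter> W"] assms(1)) (auto intro: smooth_fun_subset)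
qed

lemma smooth_at_const: "smooth_at A m (\<lambda>x. c)"
  by (rule smooth_atI[OF smooth_fun_const open_UNIV UNIV_I])

lemma smooth_at_add: "smooth_at A m f \<Longrightarrow> smooth_at A m g \<Longrightarrow> smooth_at A m (\<lambda>x. f x + g x)"
  by (rule smooth_at_binary[OF smooth_fun_add])

lemma smooth_at_mult: "smooth_at A m f \<Longrightarrow> smooth_at A m g \<Longrightarrow> smooth_at A m (\<lambda>x. f x * g x)"
  by (rule smooth_at_binary[OF smooth_fun_mult])

lemma smooth_at_diff: "smooth_at A m f \<Longrightarrow> smooth_at A m g \<Longrightarrow> smooth_at A m (\<lambda>x. f x - g x)"
  by (rule smooth_at_binary[OF smooth_fun_diff])

lemma smooth_at_sum:
  assumes "\<And>i. i \<in> I \<Longrightarrow> smooth_at A m (f i)"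
  shows "smooth_at A m (\<lambda>x. \<Sum>i\<in>I. f i x)"
proof (cases "finite I")
  case True
  then show ?thesis using assms
    by (induction I) (auto intro: smooth_at_const smooth_at_add)
qed (simp add: smooth_at_const)

subsection \<open>Derivations and covectors\<close>

lemma tangent_nonsmooth: "v \<in> tangent_space A m \<Longrightarrow> \<not> smooth_at A m f \<Longrightarrow> v f = 0"
  unfolding tangent_space_def by blast

lemma tangent_cong:
  "v \<in> tangent_space A m \<Longrightarrow> smooth_at A m f \<Longrightarrow> \<forall>\<^sub>F x in nhds m. f x = g x \<Longrightarrow> v f = v g"
  using smooth_at_cong unfolding tangent_space_def by blast

lemma tangent_linear:
  "v \<in> tangent_space A m \<Longrightarrow> smooth_at A m f \<Longrightarrow> smooth_at A m g \<Longrightarrow>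
    v (\<lambda>x. a * f x + b * g x) = a * v f + b * v g"
  unfolding tangent_space_def by blast

lemma tangent_mult:
  "v \<in> tangent_space A m \<Longrightarrow> smooth_at A m f \<Longrightarrow> smooth_at A m g \<Longrightarrow>
    v (\<lambda>x. f x * g x) = f m * v g + g m * v f"
  unfolding tangent_space_def by blast

lemma tangent_add:
  "v \<in> tangent_space A m \<Longrightarrow> smooth_at A m f \<Longrightarrow> smooth_at A m g \<Longrightarrow> v (\<lambda>x. f x + g x) = v f + v g"
  using tangent_linear[of v A m f g 1 1] by simp

lemma tangent_diff:
  "v \<in> tangent_space A m \<Longrightarrow> smooth_at A m f \<Longrightarrow> smooth_at A m g \<Longrightarrow> v (\<lambda>x. f x - g x) = v f - v g"
  using tangent_linear[of v A m f g 1 "-1"] by simp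

lemma tangent_const:
  assumes v: "v \<in> tangent_space A m" shows "v (\<lambda>x. c) = 0"
proof -
  have "v (\<lambda>x. 1) = 0"
    using tangent_mult[OF v smooth_at_const smooth_at_const, of 1 1] by simp
  then show ?thesis
    using tangent_linear[OF v smooth_at_const smooth_at_const, of c 1 0 1] by simp
qed

lemma tangent_sum:
  assumes v: "v \<in> tangent_space A m" and "\<And>i. i \<in> I \<Longrightarrow> smooth_at A m (f i)"
  shows "v (\<lambda>x. \<Sum>i\<in>I. f i x) = (\<Sum>i\<in>I. v (f i))"
proof (cases "finite I")
  case True
  then show ?thesis using assms(2)
    by (induction I) (simp_all add: tangent_const[OF v] tangent_add[OF v] smooth_at_sum)
qed (simp add: tangent_const[OF v])

lemma tangent_lincomb:
  assumes "v \<in> tangent_space A m" "w \<in> tangent_space A m"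
  shows "(\<lambda>f. a * v f + b * w f) \<in> tangent_space A m"
  unfolding tangent_space_def
proof (intro CollectI conjI allI impI)
  show "a * v f + b * w f = 0" if "\<not> smooth_at A m f" for f
    using that assms by (simp add: tangent_nonsmooth)
  show "a * v f + b * w f = a * v g + b * w g"
    if "smooth_at A m f \<and> smooth_at A m g \<and> (\<forall>\<^sub>F x in nhds m. f x = g x)" for f g
    using that assms tangent_cong by metis
  show "a * v (\<lambda>x. c * f x + d * g x) + b * w (\<lambda>x. c * f x + d * g x) =
      c * (a * v f + b * w f) + d * (a * v g + b * w g)"
    if "smooth_at A m f \<and> smooth_at A m g" for f g c d
    using that assms by (simp add: tangent_linear algebra_simps)
  show "a * v (\<lambda>x. f x * g x) + b * w (\<lambda>x. f x * g x) = f m * (a * v g + b * w g) + g m * (a * v f + b * w f)"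
    if "smooth_at A m f \<and> smooth_at A m g" for f g
    using that assms by (simp add: tangent_mult algebra_simps)
qed

lemma covec_linear:
  "\<xi> \<in> cotangent_space A m \<Longrightarrow> v \<in> tangent_space A m \<Longrightarrow> w \<in> tangent_space A m \<Longrightarrow>
    \<xi> (\<lambda>f. a * v f + b * w f) = a * \<xi> v + b * \<xi> w"
  unfolding cotangent_space_def by blast

lemma differential_cotangent: "differential A f m \<in> cotangent_space A m"
  unfolding cotangent_space_def differential_def by (auto simp: tangent_lincomb)

lemma cotangent_zero: "(\<lambda>v. 0) \<in> cotangent_space A m"
  unfolding cotangent_space_def by simp

lemma cotangent_lincomb:
  "\<xi> \<in> cotangent_space A m \<Longrightarrow> \<eta> \<in> cotangent_space A m \<Longrightarrow> (\<lambda>v. a * \<xi> v + b * \<eta> v) \<in> cotangent_space A m"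
  unfolding cotangent_space_def by (simp add: algebra_simps)

lemma cotangent_sum:
  assumes "\<And>i. i \<in> I \<Longrightarrow> \<xi> i \<in> cotangent_space A m"
  shows "(\<lambda>v. \<Sum>i\<in>I. a i * \<xi> i v) \<in> cotangent_space A m"
proof (cases "finite I")
  case True
  then show ?thesis using assms
  proof (induction I)
    case (insert i I)
    then show ?case
      using cotangent_lincomb[of "\<xi> i" A m "\<lambda>v. \<Sum>i\<in>I. a i * \<xi> i v" "a i" 1] by simp
  qed (simp add: cotangent_zero)
qed (simp add: cotangent_zero)

lemma differential_cong:
  "smooth_at A m f \<Longrightarrow> \<forall>\<^sub>F x in nhds m. f x = g x \<Longrightarrow> differential A f m = differential A g m"
  unfolding differential_def using tangent_cong by fastforce

lemma differential_diff:
  "smooth_at A m f \<Longrightarrow> smooth_at A m g \<Longrightarrow>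
    differential A (\<lambda>x. f x - g x) m = (\<lambda>v. differential A f m v - differential A g m v)"
  unfolding differential_def using tangent_diff by fastforce

lemma differential_sum:
  assumes "\<And>i. i \<in> I \<Longrightarrow> smooth_at A m (f i)"
  shows "differential A (\<lambda>x. \<Sum>i\<in>I. c i * f i x) m = (\<lambda>v. \<Sum>i\<in>I. c i * differential A (f i) m v)"
proof
  fix v
  have "v (\<lambda>x. \<Sum>i\<in>I. c i * f i x) = (\<Sum>i\<in>I. c i * v (f i))" if v: "v \<in> tangent_space A m"
  proof -
    have "v (\<lambda>x. \<Sum>i\<in>I. c i * f i x) = (\<Sum>i\<in>I. v (\<lambda>x. c i * f i x))"
      by (intro tangent_sum[OF v] smooth_at_mult smooth_at_const assms)
    also have "\<dots> = (\<Sum>i\<in>I. c i * v (f i))"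
      using assms by (intro sum.cong) (auto simp: tangent_mult[OF v smooth_at_const] tangent_const[OF v])
    finally show ?thesis .
  qed
  then show "differential A (\<lambda>x. \<Sum>i\<in>I. c i * f i x) m v = (\<Sum>i\<in>I. c i * differential A (f i) m v)"
    by (simp add: differential_def)
qed

text \<open>Nothing is required away from time 0, because the curve to which this is applied, a line
  carried back by a chart, is meaningful only near 0.\<close>

lemma curve_derivation_tangent:
  assumes "\<And>f. smooth_at A (k 0) f \<Longrightarrow> (\<lambda>t. f (k t)) differentiable (at (0::real))"
    and cont: "isCont k 0"
  shows "(\<lambda>f. if smooth_at A (k 0) f then deriv (\<lambda>t. f (k t)) 0 else 0) \<in> tangent_space A (k 0)"
proof -
  let ?m = "k 0"
  have D: "((\<lambda>t. f (k t)) has_real_derivative deriv (\<lambda>t. f (k t)) 0) (at 0)" if "smooth_at A ?m f" for f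
    using assms(1)[OF that] by (metis DERIV_imp_deriv real_differentiable_def)
  show ?thesis
    unfolding tangent_space_def
  proof (intro CollectI conjI allI impI, goal_cases)
    case (1 f)
    then show ?case by simp
  next
    case (2 f g)
    have "\<forall>\<^sub>F t in nhds 0. f (k t) = g (k t)"
      using cont 2 eventually_compose_filterlim[of _ "nhds (k 0)" k "nhds 0"]
      by (auto simp: isCont_def tendsto_at_iff_tendsto_nhds)
    then show ?case using 2 by (simp add: deriv_cong_ev)
  next
    case (3 f g a b)
    have "smooth_at A ?m (\<lambda>x. a * f x + b * g x)"
      using 3 by (intro smooth_at_add smooth_at_mult smooth_at_const) auto
    moreover have "((\<lambda>t. a * f (k t) + b * g (k t)) has_real_derivative
        a * deriv (\<lambda>t. f (k t)) 0 + b * deriv (\<lambda>t. g (k t)) 0) (at 0)"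
      using 3 by (intro DERIV_add DERIV_cmult D) auto
    ultimately show ?case using 3 by (auto simp: DERIV_imp_deriv)
  next
    case (4 f g)
    have "smooth_at A ?m (\<lambda>x. f x * g x)" using 4 by (intro smooth_at_mult) auto
    moreover have "((\<lambda>t. f (k t) * g (k t)) has_real_derivative
        deriv (\<lambda>t. f (k t)) 0 * g (k 0) + deriv (\<lambda>t. g (k t)) 0 * f (k 0)) (at 0)"
      using 4 by (intro DERIV_mult D) auto
    ultimately show ?case using 4 by (auto simp: DERIV_imp_deriv)
  qed
qed

section \<open>Charts, coordinates of tangent vectors, and functions with zero differential\<close>

locale mfd =
  fixes n :: nat and A :: "('m::{t2_space, second_countable_topology}, 'e::euclidean_space) atlas"
  assumes smooth_mfd: "smooth_manifold n A"
begin

lemma chart_exists: obtains U x where "(U, x) \<in> A" "m \<in> U"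
proof -
  have "m \<in> (\<Union>c\<in>A. fst c)" using smooth_mfd unfolding smooth_manifold_def by auto
  then show ?thesis using that by fastforce
qed

lemma chart_open: "(U, x) \<in> A \<Longrightarrow> open U"
  using smooth_mfd unfolding smooth_manifold_def by blast

lemma chartE:
  assumes "(U, x) \<in> A"
  obtains y V where "homeomorphism U (x ` U) x y" "subspace V" "dim V = n"
    "openin (top_of_set V) (x ` U)"
  using assms smooth_mfd unfolding smooth_manifold_def by blast

lemma chart_inj: "(U, x) \<in> A \<Longrightarrow> inj_on x U"
  by (elim chartE) (auto simp: homeomorphism_def intro: inj_on_inverseI)

lemma chart_continuous: "(U, x) \<in> A \<Longrightarrow> continuous_on U x"
  by (elim chartE) (rule homeomorphism_cont1)

lemma chart_coord_smooth:
  assumes "(U, x) \<in> A" "i \<in> Basis"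
  shows "smooth_fun A U (\<lambda>m. x m \<bullet> i)"
  unfolding smooth_fun_def
proof
  fix c assume c: "c \<in> A"
  obtain W y where [simp]: "c = (W, y)" by (cases c)
  have "smooth_in_chart (W, y) (W \<inter> U) (\<lambda>m. x m \<bullet> i)"
  proof -
    have "\<forall>(U, x) \<in> A. \<forall>(W, y) \<in> A. \<forall>i\<in>Basis. smooth_in_chart (U, x) (U \<inter> W) (\<lambda>m. y m \<bullet> i)"
      using smooth_mfd unfolding smooth_manifold_def by (elim conjE)
    from bspec[OF this, of "(W, y)"] c have
      "\<forall>(U, x) \<in> A. \<forall>i\<in>Basis. smooth_in_chart (W, y) (W \<inter> U) (\<lambda>m. x m \<bullet> i)" by simp
    from bspec[OF this assms(1)] assms(2) show ?thesis by simp
  qed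
  then show "smooth_in_chart c U (\<lambda>m. x m \<bullet> i)"
    unfolding smooth_in_chart_def by (simp add: Int_ac)
qed

lemma chart_preimage_open:
  assumes "(U, x) \<in> A" "open Q" shows "open (U \<inter> x -` Q)"
  using continuous_open_preimage[OF chart_continuous[OF assms(1)] chart_open[OF assms(1)] assms(2)] .

text \<open>The chart is a homeomorphism onto its image, so it sends \<open>U \<inter> N\<close> to
  a relatively open set. Neighborhoods are described by distances of chart values because the image
  itself is in general not open in the ambient space.\<close>

lemma chart_nbhd:
  assumes c: "(U, x) \<in> A" and N: "open N" "m \<in> U" "m \<in> N"
  obtains \<rho> where "\<rho> > 0" "\<And>m'. m' \<in> U \<Longrightarrow> dist (x m') (x m) < \<rho> \<Longrightarrow> m' \<in> N"
proof -
  obtain y where y: "homeomorphism U (x ` U) x y" by (rule chartE[OF c])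
  have "openin (top_of_set U) (U \<inter> N)" using N(1) by (simp add: openin_open_Int)
  then have "openin (top_of_set (x ` U)) (x ` (U \<inter> N))"
    using homeomorphism_imp_open_map[OF y] by blast
  then obtain T where T: "open T" "x ` (U \<inter> N) = x ` U \<inter> T" by (auto simp: openin_open)
  then have "x m \<in> T" using N by blast
  then obtain \<rho> where \<rho>: "\<rho> > 0" "ball (x m) \<rho> \<subseteq> T" using T(1) open_contains_ball by blast
  have "m' \<in> N" if "m' \<in> U" "dist (x m') (x m) < \<rho>" for m'
  proof -
    have "x m' \<in> x ` U \<inter> T" using that \<rho>(2) by (auto simp: dist_commute)
    then obtain m'' where "m'' \<in> U \<inter> N" "x m'' = x m'" using T(2) by (metis imageE)
    then show ?thesis using chart_inj[OF c] that(1) by (metis IntE inj_onD)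
  qed
  with \<rho>(1) show ?thesis using that by blast
qed

lemma smooth_fun_local_rep:
  assumes "smooth_fun A S f" "(U, x) \<in> A" "m \<in> S" "m \<in> U"
  obtains \<rho> g where "\<rho> > 0" "Cinf_on (ball (x m) \<rho>) g"
    "\<And>m'. m' \<in> S \<Longrightarrow> m' \<in> U \<Longrightarrow> x m' \<in> ball (x m) \<rho> \<Longrightarrow> f m' = g (x m')"
proof -
  have "smooth_in_chart (U, x) S f" using assms unfolding smooth_fun_def by blast
  moreover have "m \<in> S \<inter> fst (U, x)" using assms(3,4) by simp
  ultimately obtain Q g where Q: "open Q" "snd (U, x) m \<in> Q" "Cinf_on Q g"
      "\<forall>m' \<in> S \<inter> fst (U, x). snd (U, x) m' \<in> Q \<longrightarrow> f m' = g (snd (U, x) m')"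
    unfolding smooth_in_chart_def by blast
  from Q(1,2) obtain \<rho> where \<rho>: "\<rho> > 0" "ball (x m) \<rho> \<subseteq> Q" unfolding open_contains_ball by auto
  show ?thesis
  proof (rule that[OF \<rho>(1)])
    show "Cinf_on (ball (x m) \<rho>) g" by (rule Cinf_on_subset[OF Q(3) \<rho>(2)])
    show "f m' = g (x m')" if "m' \<in> S" "m' \<in> U" "x m' \<in> ball (x m) \<rho>" for m'
      using Q(4) that \<rho>(2) by (metis IntI fst_conv snd_conv subsetD)
  qed
qed

lemma smooth_at_local_rep:
  assumes "smooth_at A m f" "(U, x) \<in> A" "m \<in> U"
  obtains \<rho> g where "\<rho> > 0" "Cinf_on (ball (x m) \<rho>) g"
    "\<And>m'. m' \<in> U \<Longrightarrow> x m' \<in> ball (x m) \<rho> \<Longrightarrow> f m' = g (x m')"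
proof -
  obtain S where S: "open S" "m \<in> S" "smooth_fun A S f" using assms(1) unfolding smooth_at_def by blast
  obtain \<rho>1 g where g: "\<rho>1 > 0" "Cinf_on (ball (x m) \<rho>1) g"
    "\<And>m'. m' \<in> S \<Longrightarrow> m' \<in> U \<Longrightarrow> x m' \<in> ball (x m) \<rho>1 \<Longrightarrow> f m' = g (x m')"
    using smooth_fun_local_rep[OF S(3) assms(2) S(2) assms(3)] by blast
  obtain \<rho>2 where \<rho>2: "\<rho>2 > 0" "\<And>m'. m' \<in> U \<Longrightarrow> dist (x m') (x m) < \<rho>2 \<Longrightarrow> m' \<in> S"
    using chart_nbhd[OF assms(2) S(1) assms(3) S(2)] by blast
  show ?thesis
  proof (rule that[of "min \<rho>1 \<rho>2" g])
    show "Cinf_on (ball (x m) (min \<rho>1 \<rho>2)) g" by (rule Cinf_on_subset[OF g(2)]) auto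
    show "f m' = g (x m')" if "m' \<in> U" "x m' \<in> ball (x m) (min \<rho>1 \<rho>2)" for m'
      using that by (intro g(3) \<rho>2(2)) (auto simp: dist_commute)
  qed (use g(1) \<rho>2(1) in auto)
qed

lemma chart_compose_smooth:
  assumes "(U, x) \<in> A" "open Q" "Cinf_on Q g"
  shows "smooth_fun A (U \<inter> x -` Q) (\<lambda>m. g (x m))"
proof (rule smooth_fun_compose[OF _ assms(2) _ assms(3)])
  show "smooth_fun A (U \<inter> x -` Q) (\<lambda>m. x m \<bullet> j)" if "j \<in> Basis" for j
    by (rule smooth_fun_subset[OF chart_coord_smooth[OF assms(1) that]]) simp
qed auto

lemma smooth_fun_continuous:
  assumes "smooth_fun A S f" "open S" shows "continuous_on S f"
proof (rule continuous_at_imp_continuous_on, rule ballI)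
  fix m assume m: "m \<in> S"
  obtain U x where c: "(U, x) \<in> A" "m \<in> U" using chart_exists .
  obtain \<rho> g where g: "\<rho> > 0" "Cinf_on (ball (x m) \<rho>) g"
    "\<And>m'. m' \<in> S \<Longrightarrow> m' \<in> U \<Longrightarrow> x m' \<in> ball (x m) \<rho> \<Longrightarrow> f m' = g (x m')"
    using smooth_fun_local_rep[OF assms(1) c(1) m c(2)] by blast
  let ?N = "S \<inter> (U \<inter> x -` ball (x m) \<rho>)"
  have N: "open ?N" "m \<in> ?N" using chart_preimage_open[OF c(1)] assms(2) c(2) m g(1) by auto
  have "continuous_on ?N (\<lambda>m. g (x m))"
    by (rule continuous_on_compose2[OF Cinf_on_continuous[OF g(2)]])
       (auto intro: continuous_on_subset[OF chart_continuous[OF c(1)]])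
  then have "continuous_on ?N f"
    by (rule continuous_on_cong[THEN iffD1, rotated -1]) (use g(3) in auto)
  then show "isCont f m" using N continuous_on_eq_continuous_at by blast
qed

lemma smooth_at_isCont: "smooth_at A m f \<Longrightarrow> isCont f m"
  unfolding smooth_at_def using smooth_fun_continuous continuous_on_eq_continuous_at by blast

text \<open>The image of \<open>v\<close> under the differential of the chart.\<close>

definition chart_vec :: "('m \<Rightarrow> 'e) \<Rightarrow> 'm vec \<Rightarrow> 'e" where
  "chart_vec x v = (\<Sum>i\<in>Basis. v (\<lambda>m. x m \<bullet> i) *\<^sub>R i)"

lemma chart_coord_smooth_at: "(U, x) \<in> A \<Longrightarrow> m \<in> U \<Longrightarrow> i \<in> Basis \<Longrightarrow> smooth_at A m (\<lambda>m. x m \<bullet> i)"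
  using smooth_atI[OF chart_coord_smooth chart_open] by blast

text \<open>Hadamard's lemma writes \<open>f\<close> near \<open>m\<close> as a constant plus
  products of coordinate increments with smooth functions. The increments vanish at
  \<open>m\<close>, so the product rule leaves only the terms in which \<open>v\<close>
  differentiates them.\<close>

lemma tangent_chart:
  assumes c: "(U, x) \<in> A" "m \<in> U" and v: "v \<in> tangent_space A m"
    and \<rho>: "\<rho> > 0" and g: "Cinf_on (ball (x m) \<rho>) g"
    and f: "\<And>m'. m' \<in> U \<Longrightarrow> x m' \<in> ball (x m) \<rho> \<Longrightarrow> f m' = g (x m')"
  shows "v f = \<partial> g (x m) (chart_vec x v)"
proof -
  let ?B = "ball (x m) \<rho>"
  obtain h where h: "\<And>i. i \<in> Basis \<Longrightarrow> Cinf_on ?B (h i)"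
    and gh: "\<And>y. y \<in> ?B \<Longrightarrow> g y = g (x m) + (\<Sum>i\<in>Basis. ((y - x m) \<bullet> i) * h i y)"
    and h0: "\<And>i. h i (x m) = \<partial> g (x m) i"
    using Hadamard_lemma[OF g \<rho>] by blast
  let ?N = "U \<inter> x -` ?B"
  have N: "open ?N" "m \<in> ?N" using chart_preimage_open[OF c(1) open_ball] c \<rho> by auto
  have sh: "smooth_at A m (\<lambda>m. h i (x m))" if "i \<in> Basis" for i
    using chart_compose_smooth[OF c(1) open_ball h[OF that]] N by (auto intro: smooth_atI)
  have sx: "smooth_at A m (\<lambda>z. x z \<bullet> i - x m \<bullet> i)" if "i \<in> Basis" for i
    using chart_coord_smooth_at[OF c that] smooth_at_diff smooth_at_const by blast
  have sp: "smooth_at A m (\<lambda>z. (x z \<bullet> i - x m \<bullet> i) * h i (x z))" if "i \<in> Basis" for i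
    using smooth_at_mult[OF sx sh] that by blast
  define F where "F z = g (x m) + (\<Sum>i\<in>Basis. (x z \<bullet> i - x m \<bullet> i) * h i (x z))" for z
  have sF: "smooth_at A m F"
    unfolding F_def[abs_def] using sp by (intro smooth_at_add smooth_at_sum smooth_at_const)
  have "\<forall>\<^sub>F z in nhds m. F z = f z"
    unfolding eventually_nhds
  proof (intro exI conjI ballI)
    fix z assume "z \<in> ?N"
    then have "z \<in> U" "x z \<in> ?B" by auto
    then show "F z = f z" using f gh by (simp add: F_def inner_diff_left)
  qed (use N in auto)
  then have "v f = v F" using tangent_cong[OF v sF] by simp
  also have "\<dots> = (\<Sum>i\<in>Basis. v (\<lambda>z. (x z \<bullet> i - x m \<bullet> i) * h i (x z)))"
    unfolding F_def[abs_def]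
    using sp by (simp add: tangent_add[OF v smooth_at_const smooth_at_sum] tangent_const[OF v] tangent_sum[OF v])
  also have "\<dots> = (\<Sum>i\<in>Basis. \<partial> g (x m) i * v (\<lambda>z. x z \<bullet> i))"
  proof (rule sum.cong[OF refl])
    fix i :: 'e assume i: "i \<in> Basis"
    show "v (\<lambda>z. (x z \<bullet> i - x m \<bullet> i) * h i (x z)) = \<partial> g (x m) i * v (\<lambda>z. x z \<bullet> i)"
      using tangent_mult[OF v sx[OF i] sh[OF i]]
        tangent_diff[OF v chart_coord_smooth_at[OF c i] smooth_at_const, of "x m \<bullet> i"]
      by (simp add: h0 tangent_const[OF v])
  qed
  also have "\<dots> = \<partial> g (x m) (chart_vec x v)"
  proof -
    have "linear (\<partial> g (x m))"
      using has_derivative_linear[OF Cinf_on_has_derivative[OF g, of "x m"]] \<rho> by simp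
    then show ?thesis unfolding chart_vec_def by (simp add: linear_sum linear_scale mult.commute)
  qed
  finally show ?thesis .
qed

text \<open>Chart values lie in \<open>V\<close>, so a coordinate of \<open>x\<close> is unchanged
  when a linear projection \<open>P\<close> onto \<open>V\<close> is inserted. By
  \<open>tangent_chart\<close> the coordinates of \<open>v\<close> are then those of the projection
  of \<open>chart_vec x v\<close>.\<close>

lemma chart_vec_in_subspace:
  assumes c: "(U, x) \<in> A" "m \<in> U" and v: "v \<in> tangent_space A m"
    and V: "subspace V" "openin (top_of_set V) (x ` U)"
  shows "chart_vec x v \<in> V"
proof -
  obtain P where P: "P ` UNIV \<subseteq> V" "linear P" "\<And>w. w \<in> V \<Longrightarrow> P w = w"
    using linear_exists_left_inverse_on[OF linear_id V(1)] by auto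
  have "v (\<lambda>m. x m \<bullet> i) = P (chart_vec x v) \<bullet> i" if i: "i \<in> Basis" for i
  proof -
    have bl: "bounded_linear (\<lambda>w. P w \<bullet> i)"
      using P(2) linear_conv_bounded_linear bounded_linear_inner_left bounded_linear_compose by blast
    have xU: "x ` U \<subseteq> V" using V(2) openin_imp_subset by blast
    have "v (\<lambda>m. x m \<bullet> i) = \<partial> (\<lambda>w. P w \<bullet> i) (x m) (chart_vec x v)"
    proof (rule tangent_chart[OF c v zero_less_one])
      show "Cinf_on (ball (x m) 1) (\<lambda>w. P w \<bullet> i)" by (rule Cinf_on_linear[OF open_ball bl])
    qed (use xU P(3) in auto)
    then show ?thesis
      using frechet_derivative_at[OF bounded_linear_imp_has_derivative[OF bl]] by (metis (no_types))
  qed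
  then have "chart_vec x v = P (chart_vec x v)"
    by (subst chart_vec_def) (simp add: euclidean_representation cong: sum.cong)
  then show ?thesis using P(1) by (metis UNIV_I image_subset_iff)
qed

text \<open>The vector is the velocity at time 0 of the straight line through \<open>x m\<close> in
  direction \<open>w\<close>, carried back by the inverse of the chart.\<close>

lemma directional_tangent:
  assumes c: "(U, x) \<in> A" "m \<in> U" and V: "subspace V" "openin (top_of_set V) (x ` U)" and w: "w \<in> V"
  obtains v where "v \<in> tangent_space A m" "chart_vec x v = w"
proof -
  obtain y where y: "homeomorphism U (x ` U) x y" by (rule chartE[OF c(1)])
  have xmV: "x m \<in> V" using c(2) V(2) openin_imp_subset by blast
  obtain T where T: "open T" "x ` U = V \<inter> T" using V(2) by (auto simp: openin_open)
  define L where "L t = x m + t *\<^sub>R w" for t :: real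
  define k where "k t = y (L t)" for t
  let ?I = "L -` T"
  have contL: "continuous_on UNIV L" unfolding L_def by (intro continuous_intros)
  have I: "open ?I" "0 \<in> ?I"
    using T c(2) open_vimage[OF T(1) contL] by (auto simp: L_def)
  have LxU: "L t \<in> x ` U" if "t \<in> ?I" for t
    using that T(2) V(1) w xmV by (auto simp: L_def subspace_add subspace_scale)
  have kU: "k t \<in> U" "x (k t) = L t" if "t \<in> ?I" for t
    using LxU[OF that] y unfolding k_def homeomorphism_def by auto
  have k0: "k 0 = m" using y c(2) by (simp add: k_def L_def homeomorphism_apply1)
  have "continuous_on ?I k"
    unfolding k_def using LxU
    by (intro continuous_on_compose2[OF homeomorphism_cont2[OF y]] continuous_on_subset[OF contL]) auto
  then have cont: "isCont k 0" using I continuous_on_eq_continuous_at by blast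
  have der: "((\<lambda>t. f (k t)) has_real_derivative \<partial> g (x m) w) (at 0)"
    if \<rho>: "\<rho> > 0" and g: "Cinf_on (ball (x m) \<rho>) g"
    and f: "\<And>m'. m' \<in> U \<Longrightarrow> x m' \<in> ball (x m) \<rho> \<Longrightarrow> f m' = g (x m')" for f \<rho> g
  proof -
    have dg: "(g has_derivative \<partial> g (L 0)) (at (L 0))"
      using Cinf_on_has_derivative[OF g, of "x m"] \<rho> by (simp add: L_def)
    have "(L has_derivative (\<lambda>s. s *\<^sub>R w)) (at 0)"
      unfolding L_def by (auto intro!: derivative_eq_intros)
    from has_derivative_compose[OF this dg]
    have 1: "((\<lambda>t. g (L t)) has_real_derivative \<partial> g (x m) w) (at 0)"
      using has_derivative_linear[OF dg] unfolding has_field_derivative_def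
      by (simp add: linear_scale L_def mult.commute[of _ "\<partial> g (x m) w"])
    let ?J = "?I \<inter> L -` ball (x m) \<rho>"
    have "open ?J" using I open_vimage[OF open_ball contL] by auto
    moreover have "0 \<in> ?J" using I \<rho> by (simp add: L_def)
    moreover have "g (L t) = f (k t)" if "t \<in> ?J" for t using f kU that by auto
    ultimately show ?thesis
      by (rule has_field_derivative_transform_within_open[OF 1])
  qed
  define v where "v = (\<lambda>f. if smooth_at A (k 0) f then deriv (\<lambda>t. f (k t)) 0 else 0)"
  have "(\<lambda>t. f (k t)) differentiable (at 0)" if "smooth_at A (k 0) f" for f
  proof -
    have "smooth_at A m f" using that k0 by simp
    then obtain \<rho> g where "\<rho> > 0" "Cinf_on (ball (x m) \<rho>) g"
      "\<And>m'. m' \<in> U \<Longrightarrow> x m' \<in> ball (x m) \<rho> \<Longrightarrow> f m' = g (x m')"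
      using smooth_at_local_rep[OF _ c] by blast
    then show ?thesis using der real_differentiable_def by blast
  qed
  then have v: "v \<in> tangent_space A m"
    using curve_derivation_tangent[OF _ cont] unfolding v_def k0 by blast
  have "v (\<lambda>m. x m \<bullet> i) = w \<bullet> i" if i: "i \<in> Basis" for i
  proof -
    have bl: "bounded_linear (\<lambda>y. y \<bullet> i)" by (rule bounded_linear_inner_left)
    have "((\<lambda>t. x (k t) \<bullet> i) has_real_derivative \<partial> (\<lambda>y. y \<bullet> i) (x m) w) (at 0)"
      by (rule der[OF zero_less_one Cinf_on_linear[OF open_ball bl]]) simp
    moreover have "\<partial> (\<lambda>y. y \<bullet> i) (x m) = (\<lambda>y. y \<bullet> i)"
      using frechet_derivative_at[OF bounded_linear_imp_has_derivative[OF bl]] by simp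
    ultimately show ?thesis
      using chart_coord_smooth_at[OF c i] unfolding v_def k0 by (simp add: DERIV_imp_deriv)
  qed
  then have "chart_vec x v = w"
    unfolding chart_vec_def by (simp add: euclidean_representation cong: sum.cong)
  with v show ?thesis using that by blast
qed

text \<open>The representative \<open>g\<close> of \<open>f\<close> lives on a ball of the ambient
  space, but its derivative is known to vanish only at points of \<open>V\<close> and in directions
  of \<open>V\<close>. Constancy is therefore obtained along segments in the convex set
  \<open>V \<inter> ball (x m) \<rho>\<close>.\<close>

lemma differential_zero_locally_constant:
  assumes f: "smooth_fun A S f" "open S" and d: "\<And>m. m \<in> S \<Longrightarrow> differential A f m = (\<lambda>v. 0)"
    and m: "m \<in> S"
  obtains W where "open W" "m \<in> W" "W \<subseteq> S" "\<And>m'. m' \<in> W \<Longrightarrow> f m' = f m"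
proof -
  obtain U x where c: "(U, x) \<in> A" "m \<in> U" using chart_exists .
  obtain V y where V: "subspace V" "openin (top_of_set V) (x ` U)"
    and y: "homeomorphism U (x ` U) x y" by (rule chartE[OF c(1)])
  obtain \<rho>1 g where g: "\<rho>1 > 0" "Cinf_on (ball (x m) \<rho>1) g"
    "\<And>m'. m' \<in> S \<Longrightarrow> m' \<in> U \<Longrightarrow> x m' \<in> ball (x m) \<rho>1 \<Longrightarrow> f m' = g (x m')"
    using smooth_fun_local_rep[OF f(1) c(1) m c(2)] by blast
  obtain \<rho>2 where \<rho>2: "\<rho>2 > 0" "\<And>m'. m' \<in> U \<Longrightarrow> dist (x m') (x m) < \<rho>2 \<Longrightarrow> m' \<in> S"
    using chart_nbhd[OF c(1) f(2) c(2) m] by blast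
  obtain T where T: "open T" "x ` U = V \<inter> T" using V(2) by (auto simp: openin_open)
  then have "x m \<in> T" using c(2) by blast
  then obtain \<rho>3 where \<rho>3: "\<rho>3 > 0" "ball (x m) \<rho>3 \<subseteq> T" using T(1) open_contains_ball by blast
  \<comment> \<open>\<open>\<rho>1\<close> is the radius on which \<open>g\<close> represents
    \<open>f\<close>, \<open>\<rho>2\<close> keeps points in \<open>S\<close>, and
    \<open>\<rho>3\<close> makes every point of \<open>V\<close> in the ball a chart value.\<close>
  define \<rho> where "\<rho> = min \<rho>1 (min \<rho>2 \<rho>3)"
  have \<rho>: "\<rho> > 0" "\<rho> \<le> \<rho>1" "\<rho> \<le> \<rho>2" "\<rho> \<le> \<rho>3" unfolding \<rho>_def using g(1) \<rho>2(1) \<rho>3(1) by auto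
  have xV: "x m' \<in> V" if "m' \<in> U" for m' using that T(2) by blast
  have Dg0: "\<partial> g p w = 0" if p: "p \<in> V \<inter> ball (x m) \<rho>" and w: "w \<in> V" for p w
  proof -
    have "p \<in> x ` U" using p T(2) \<rho>3(2) \<rho>(4) by (auto simp: subset_iff)
    then obtain z where z: "z \<in> U" "p = x z" by blast
    have zS: "z \<in> S" using \<rho>2(2)[OF z(1)] p z \<rho>(3) by (auto simp: dist_commute)
    obtain v where v: "v \<in> tangent_space A z" "chart_vec x v = w"
      using directional_tangent[OF c(1) z(1) V w] .
    obtain \<rho>4 where \<rho>4: "\<rho>4 > 0" "ball p \<rho>4 \<subseteq> ball (x m) \<rho>" using p open_contains_ball open_ball by blast
    have "ball p \<rho>4 \<subseteq> ball (x m) \<rho>1" using \<rho>4(2) \<rho>(2) by (meson subset_ball subset_trans)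
    then have "Cinf_on (ball (x z) \<rho>4) g" using Cinf_on_subset[OF g(2)] z by blast
    moreover have "f m' = g (x m')" if "m' \<in> U" "x m' \<in> ball (x z) \<rho>4" for m'
    proof -
      have "x m' \<in> ball (x m) \<rho>" using \<rho>4(2) that z by blast
      then show ?thesis using that \<rho> by (intro g(3) \<rho>2(2)) (auto simp: dist_commute)
    qed
    ultimately have "v f = \<partial> g (x z) w"
      using tangent_chart[OF c(1) z(1) v(1) \<rho>4(1)] v(2) by blast
    moreover have "v f = 0" using d[OF zS] v(1) unfolding differential_def by (metis)
    ultimately show ?thesis using z by simp
  qed
  let ?W = "U \<inter> x -` ball (x m) \<rho>"
  have const: "f m' = f m" if m': "m' \<in> ?W" for m'
  proof -
    have inB: "x m' \<in> V \<inter> ball (x m) \<rho>" "x m \<in> V \<inter> ball (x m) \<rho>"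
      using m' c(2) xV \<rho>(1) by auto
    have cvx: "convex (V \<inter> ball (x m) \<rho>)"
      using V(1) by (intro convex_Int subspace_imp_convex convex_ball)
    have "g (x m') = g (x m)"
    proof -
      have seg: "x m + t *\<^sub>R (x m' - x m) \<in> V \<inter> ball (x m) \<rho>" if "t \<in> {0..1}" for t
        using convexD_alt[OF cvx inB(2,1), of t] that by (simp add: algebra_simps)
      have "((\<lambda>t. g (x m + t *\<^sub>R (x m' - x m))) has_derivative (\<lambda>s. 0)) (at t within {0..1})"
        if t: "t \<in> {0..1}" for t
      proof -
        let ?p = "x m + t *\<^sub>R (x m' - x m)"
        have "?p \<in> ball (x m) \<rho>1" using seg[OF t] \<rho>(2) by auto
        then have dg: "(g has_derivative \<partial> g ?p) (at ?p)"
          using Cinf_on_has_derivative[OF g(2)] by blast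
        have dL: "((\<lambda>t. x m + t *\<^sub>R (x m' - x m)) has_derivative (\<lambda>s. s *\<^sub>R (x m' - x m))) (at t)"
          by (auto intro!: derivative_eq_intros)
        have "\<partial> g ?p (s *\<^sub>R (x m' - x m)) = 0" for s
          using Dg0[OF seg[OF t]] inB V(1) by (simp add: subspace_diff subspace_scale)
        then show ?thesis using has_derivative_compose[OF dL dg] by (simp add: has_derivative_at_withinI)
      qed
      from has_derivative_zero_constant[OF _ this]
      obtain k where "\<And>t. t \<in> {0..1::real} \<Longrightarrow> g (x m + t *\<^sub>R (x m' - x m)) = k" by auto
      from this[of 0] this[of 1] show ?thesis by simp
    qed
    moreover have "f m' = g (x m')" using m' \<rho> by (intro g(3) \<rho>2(2)) (auto simp: dist_commute)
    moreover have "f m = g (x m)" using g m c(2) by auto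
    ultimately show ?thesis by simp
  qed
  have "?W \<subseteq> S"
  proof
    fix z assume "z \<in> ?W"
    then have "z \<in> U" "dist (x z) (x m) < \<rho>2" using \<rho>(3) by (auto simp: dist_commute)
    then show "z \<in> S" by (rule \<rho>2(2))
  qed
  moreover have "open ?W" "m \<in> ?W" using chart_preimage_open[OF c(1) open_ball] c(2) \<rho>(1) by auto
  ultimately show ?thesis using that[of ?W] const by metis
qed

lemma differential_locally_constant:
  assumes "open W" "m \<in> W" "\<And>m'. m' \<in> W \<Longrightarrow> f m' = c"
  shows "differential A f m = (\<lambda>v. 0)"
proof -
  have "\<forall>\<^sub>F x in nhds m. c = f x"
    unfolding eventually_nhds using assms by metis
  from differential_cong[OF smooth_at_const this, of A]
  show ?thesis by (auto simp: differential_def tangent_const fun_eq_iff split: if_splits)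
qed

end

subsection \<open>Submersions and slow curves\<close>

text \<open>\<open>sussmann_open_mapping\<close> asks for continuity and for a surjective derivative
  at one point only. It speaks of maps between Euclidean spaces, while the charts take values in
  open subsets of subspaces; so the chart expression of \<open>\<phi>\<close> is first extended to
  an open subset of a full product space.\<close>

lemma submersion_open_map:
  fixes A :: "('m::{t2_space, second_countable_topology}, 'e::euclidean_space) atlas"
    and B :: "('b::{t2_space, second_countable_topology}, 'f::euclidean_space) atlas"
  assumes "smooth_manifold n A" "smooth_manifold k B" and sub: "submersion A B \<phi>"
    and N: "open N" "m \<in> N"
  obtains W where "open W" "\<phi> m \<in> W" "W \<subseteq> \<phi> ` N"
proof -
  interpret M: mfd n A by standard fact
  interpret B: mfd k B by standard fact
  have sm: "smooth_map A B \<phi>" using sub unfolding submersion_def by blast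
  obtain U x where c: "(U, x) \<in> A" "m \<in> U" using M.chart_exists .
  obtain W y where d: "(W, y) \<in> B" "\<phi> m \<in> W" using B.chart_exists .
  obtain V where V: "subspace V" "openin (top_of_set V) (x ` U)" by (rule M.chartE[OF c(1)])
  obtain V' where V': "subspace V'" "openin (top_of_set V') (y ` W)" by (rule B.chartE[OF d(1)])
  have yV': "y b \<in> V'" if "b \<in> W" for b using that V'(2) openin_imp_subset by blast
  obtain T where T: "open T" "x ` U = V \<inter> T" using V(2) by (auto simp: openin_open)
  have xmT: "x m \<in> T" "x m \<in> V" using c(2) T(2) by auto
  have oW: "open (\<phi> -` W)"
    using sm B.chart_open[OF d(1)] open_vimage unfolding smooth_map_def by blast
  obtain \<rho>0 where \<rho>0: "\<rho>0 > 0" "\<And>m'. m' \<in> U \<Longrightarrow> dist (x m') (x m) < \<rho>0 \<Longrightarrow> m' \<in> N \<inter> \<phi> -` W"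
    using M.chart_nbhd[OF c(1) open_Int[OF N(1) oW] c(2)] N(2) d(2) by auto
  have "\<exists>\<rho> g. \<rho> > 0 \<and> Cinf_on (ball (x m) \<rho>) g \<and>
      (\<forall>m'. m' \<in> \<phi> -` W \<longrightarrow> m' \<in> U \<longrightarrow> x m' \<in> ball (x m) \<rho> \<longrightarrow> y (\<phi> m') \<bullet> i = g (x m'))"
    if i: "i \<in> Basis" for i
  proof -
    have "smooth_fun A (\<phi> -` W) ((\<lambda>b. y b \<bullet> i) \<circ> \<phi>)"
      using sm B.chart_open[OF d(1)] B.chart_coord_smooth[OF d(1) i] unfolding smooth_map_def by blast
    from M.smooth_fun_local_rep[OF this c(1) _ c(2)] d(2) obtain \<rho> g where
      "\<rho> > 0" "Cinf_on (ball (x m) \<rho>) g"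
      "\<And>m'. m' \<in> \<phi> -` W \<Longrightarrow> m' \<in> U \<Longrightarrow> x m' \<in> ball (x m) \<rho> \<Longrightarrow> ((\<lambda>b. y b \<bullet> i) \<circ> \<phi>) m' = g (x m')"
      by (metis vimageI)
    then show ?thesis by (intro exI[of _ \<rho>] exI[of _ g]) auto
  qed
  then obtain \<rho>1 G where G: "\<And>i. i \<in> Basis \<Longrightarrow> \<rho>1 i > 0 \<and> Cinf_on (ball (x m) (\<rho>1 i)) (G i) \<and>
      (\<forall>m'. m' \<in> \<phi> -` W \<longrightarrow> m' \<in> U \<longrightarrow> x m' \<in> ball (x m) (\<rho>1 i) \<longrightarrow> y (\<phi> m') \<bullet> i = G i (x m'))"
    by metis
  have "open (T \<inter> ball (x m) \<rho>0 \<inter> (\<Inter>i\<in>Basis. ball (x m) (\<rho>1 i)))"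
    using T(1) by (intro open_Int open_INT) auto
  moreover have "x m \<in> T \<inter> ball (x m) \<rho>0 \<inter> (\<Inter>i\<in>Basis. ball (x m) (\<rho>1 i))"
    using xmT(1) \<rho>0(1) G by auto
  ultimately obtain \<rho> where \<rho>: "\<rho> > 0"
    "ball (x m) \<rho> \<subseteq> T \<inter> ball (x m) \<rho>0 \<inter> (\<Inter>i\<in>Basis. ball (x m) (\<rho>1 i))"
    unfolding open_contains_ball by blast
  let ?R = "ball (x m) \<rho>"
  have RN: "m' \<in> N" "\<phi> m' \<in> W" if "m' \<in> U" "x m' \<in> ?R" for m'
  proof -
    have "x m' \<in> ball (x m) \<rho>0" using \<rho>(2) that(2) by blast
    then show "m' \<in> N" "\<phi> m' \<in> W" using \<rho>0(2)[OF that(1)] by (auto simp: dist_commute)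
  qed
  have GC: "Cinf_on ?R (G i)" if "i \<in> Basis" for i
    using G[OF that] Cinf_on_subset[of "ball (x m) (\<rho>1 i)" "G i" ?R] \<rho>(2) that by blast
  have yG: "y (\<phi> m') \<bullet> i = G i (x m')" if "m' \<in> U" "x m' \<in> ?R" "i \<in> Basis" for m' i
    using G[OF that(3)] RN[OF that(1,2)] that \<rho>(2) by blast
  obtain P where P: "P ` UNIV \<subseteq> V" "linear P" "\<And>w. w \<in> V \<Longrightarrow> P w = w"
    using linear_exists_left_inverse_on[OF linear_id V(1)] by auto
  obtain P' where P': "P' ` UNIV \<subseteq> V'" "linear P'" "\<And>w. w \<in> V' \<Longrightarrow> P' w = w"
    using linear_exists_left_inverse_on[OF linear_id V'(1)] by auto
  have PV: "P w \<in> V" "P' w' \<in> V'" for w w' using P(1) P'(1) by auto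
  have bP: "bounded_linear (\<lambda>p::'e \<times> 'f. P (fst p))" "bounded_linear P'"
    using P(2) P'(2) linear_conv_bounded_linear bounded_linear_fst bounded_linear_compose by blast+
  define Gv where "Gv s = (\<Sum>i\<in>Basis. G i s *\<^sub>R i)" for s
  define DG where "DG w = (\<Sum>i\<in>Basis. \<partial> (G i) (x m) w *\<^sub>R i)" for w
  (* The second summand fills up the directions normal to the subspace containing the chart. *)
  define Z where "Z p = Gv (P (fst p)) + (snd p - P' (snd p))" for p :: "'e \<times> 'f"
  define DZ where "DZ p = DG (P (fst p)) + (snd p - P' (snd p))" for p :: "'e \<times> 'f"
  have yGv: "y (\<phi> m') = Gv (x m')" if "m' \<in> U" "x m' \<in> ?R" for m'
    by (rule euclidean_eqI) (simp add: Gv_def yG[OF that])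
  let ?O = "(\<lambda>p::'e \<times> 'f. P (fst p)) -` ?R"
  have cP: "continuous_on UNIV (\<lambda>p::'e \<times> 'f. P (fst p))"
    using bP(1) by (rule linear_continuous_on)
  have oO: "open ?O" using open_vimage[OF open_ball cP] .
  have contG: "continuous_on ?R Gv"
    unfolding Gv_def using GC by (intro continuous_intros Cinf_on_continuous) auto
  have contZ: "continuous_on ?O Z"
    unfolding Z_def
    by (intro continuous_intros continuous_on_compose2[OF contG] continuous_on_subset[OF cP]
        continuous_on_compose2[OF linear_continuous_on[OF bP(2), of UNIV]]) auto
  have dG: "(Gv has_derivative DG) (at (x m))"
    unfolding Gv_def DG_def using Cinf_on_has_derivative[OF GC] \<rho>(1)
    by (intro has_derivative_sum has_derivative_scaleR_left) auto
  have "((\<lambda>p::'e \<times> 'f. P (fst p)) has_derivative (\<lambda>p. P (fst p))) (at (x m, 0))"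
    by (rule bounded_linear_imp_has_derivative[OF bP(1)])
  from has_derivative_compose[OF this, of Gv DG] dG
  have d1: "((\<lambda>p::'e \<times> 'f. Gv (P (fst p))) has_derivative (\<lambda>p. DG (P (fst p)))) (at (x m, 0))"
    using P(3)[OF xmT(2)] by simp
  have d2: "((\<lambda>p::'e \<times> 'f. P' (snd p)) has_derivative (\<lambda>p. P' (snd p))) (at (x m, 0))"
    by (intro bounded_linear_imp_has_derivative bounded_linear_compose[OF bP(2)] bounded_linear_snd)
  have dZ: "(Z has_derivative DZ) (at (x m, 0))"
    unfolding Z_def DZ_def by (intro has_derivative_add d1 has_derivative_diff d2 derivative_intros)
  \<comment> \<open>The tangential part \<open>P' z\<close> is reached because \<open>\<phi>\<close>
    is a submersion, the remaining part \<open>z - P' z\<close> by the second component.\<close>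
  have "\<exists>p. DZ p = z" for z
  proof -
    obtain w where w: "w \<in> tangent_space B (\<phi> m)" "B.chart_vec y w = P' z"
      using B.directional_tangent[OF d V' PV(2)] by blast
    obtain v where v: "v \<in> tangent_space A m" "w = pushforward B \<phi> m v"
      using sub w(1) unfolding submersion_def by blast
    have "w (\<lambda>b. y b \<bullet> i) = \<partial> (G i) (x m) (M.chart_vec x v)" if i: "i \<in> Basis" for i
    proof -
      have "w (\<lambda>b. y b \<bullet> i) = v ((\<lambda>b. y b \<bullet> i) \<circ> \<phi>)"
        using B.chart_coord_smooth_at[OF d i] v(2) by (simp add: pushforward_def)
      also have "\<dots> = \<partial> (G i) (x m) (M.chart_vec x v)"
        by (rule M.tangent_chart[OF c v(1) \<rho>(1) GC[OF i]]) (simp add: yG i)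
      finally show ?thesis .
    qed
    then have "DG (M.chart_vec x v) = P' z"
      unfolding DG_def w(2)[symmetric] B.chart_vec_def by simp
    then have "DZ (M.chart_vec x v, z) = z"
      using P(3)[OF M.chart_vec_in_subspace[OF c v(1) V]] by (simp add: DZ_def)
    then show ?thesis by blast
  qed
  then have surj: "surj DZ" by (metis surjI)
  obtain g' where g': "linear g'" "DZ \<circ> g' = id"
    using linear_surjective_right_inverse[OF has_derivative_linear[OF dZ] surj] by blast
  have p0: "(x m, 0) \<in> ?O" using P(3)[OF xmT(2)] \<rho>(1) by simp
  have "Z (x m, 0) \<in> interior (Z ` ?O)"
    using sussmann_open_mapping[OF oO contZ p0 dZ _ g'(2) subset_refl] g'(1) p0
    by (simp add: linear_conv_bounded_linear interior_open[OF oO])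
  moreover have "Z (x m, 0) = y (\<phi> m)"
    using yGv[OF c(2)] \<rho>(1) P(3)[OF xmT(2)] linear_0[OF P'(2)] by (simp add: Z_def)
  ultimately obtain \<epsilon> where \<epsilon>: "\<epsilon> > 0" "ball (y (\<phi> m)) \<epsilon> \<subseteq> Z ` ?O"
    unfolding mem_interior by auto
  let ?W = "W \<inter> y -` ball (y (\<phi> m)) \<epsilon>"
  have "?W \<subseteq> \<phi> ` N"
  proof
    fix b assume b: "b \<in> ?W"
    then obtain p where p: "p \<in> ?O" "y b = Z p" using \<epsilon>(2) by blast
    have "P (fst p) \<in> V \<inter> T" using p(1) \<rho>(2) PV by auto
    then obtain m' where m': "m' \<in> U" "x m' = P (fst p)" using T(2) by (metis imageE)
    have m'R: "x m' \<in> ?R" using p(1) m'(2) by simp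
    let ?u = "snd p - P' (snd p)"
    have "?u = y b - y (\<phi> m')" using p(2) yGv[OF m'(1) m'R] m'(2) by (simp add: Z_def)
    moreover have "y b - y (\<phi> m') \<in> V'"
      using b RN[OF m'(1) m'R] yV' V'(1) by (simp add: subspace_diff)
    ultimately have "P' ?u = ?u" using P'(3) by metis
    moreover have "P' ?u = 0" using P'(2,3) PV(2) by (simp add: linear_diff)
    ultimately have "y b = y (\<phi> m')" using \<open>?u = y b - y (\<phi> m')\<close> by simp
    then have "b = \<phi> m'" using B.chart_inj[OF d(1)] b RN[OF m'(1) m'R] by (metis IntE inj_onD)
    then show "b \<in> \<phi> ` N" using RN[OF m'(1) m'R] by blast
  qed
  moreover have "open ?W" "\<phi> m \<in> ?W" using B.chart_preimage_open[OF d(1)] d(2) \<epsilon>(1) by auto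
  ultimately show ?thesis using that by blast
qed

lemma smooth_curve_has_derivative:
  assumes c: "smooth_curve A c" and f: "smooth_at A (c t) f"
  shows "((\<lambda>s. f (c s)) has_real_derivative velocity A c t f) (at t)"
proof -
  obtain U where U: "open U" "c t \<in> U" "smooth_fun A U f" using f unfolding smooth_at_def by blast
  have "Cinf_on (c -` U) (f \<circ> c)" using c U unfolding smooth_curve_def by blast
  then have "((f \<circ> c) has_derivative \<partial> (f \<circ> c) t) (at t)"
    by (rule Cinf_on_has_derivative) (use U in auto)
  then have "(f \<circ> c) differentiable (at t)" unfolding differentiable_def by blast
  then have "((f \<circ> c) has_real_derivative deriv (f \<circ> c) t) (at t)"
    by (metis DERIV_imp_deriv real_differentiable_def)
  then show ?thesis using f by (simp add: velocity_def comp_def)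
qed

context mfd
begin

text \<open>The threshold depends on the chart and on \<open>N\<close> but not on the curve, and the
  speed is bounded only while the curve is in \<open>N\<close>. Until the first exit time the mean
  value theorem confines the curve to a compact set \<open>K\<close> inside \<open>N\<close>; as
  \<open>K\<close> is closed, the exit point would lie in it too.\<close>

lemma slow_curve_stays:
  assumes c: "(U, x) \<in> A" "m \<in> U" and N: "open N" "m \<in> N" "N \<subseteq> U"
  obtains \<delta> where "\<delta> > 0"
    "\<And>c t. smooth_curve A c \<Longrightarrow> c 0 = m \<Longrightarrow>
      (\<And>t i. i \<in> Basis \<Longrightarrow> c t \<in> N \<Longrightarrow> \<bar>velocity A c t (\<lambda>m. x m \<bullet> i)\<bar> \<le> \<delta>) \<Longrightarrow>
      t \<in> {0..1} \<Longrightarrow> c t \<in> N"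
proof -
  obtain V y where V: "subspace V" "openin (top_of_set V) (x ` U)"
    and y: "homeomorphism U (x ` U) x y" by (rule chartE[OF c(1)])
  obtain T where T: "open T" "x ` U = V \<inter> T" using V(2) by (auto simp: openin_open)
  have "x m \<in> T" using T(2) c(2) by blast
  then obtain \<rho>1 where \<rho>1: "\<rho>1 > 0" "cball (x m) \<rho>1 \<subseteq> T" using T(1) open_contains_cball by blast
  obtain \<rho>2 where \<rho>2: "\<rho>2 > 0" "\<And>m'. m' \<in> U \<Longrightarrow> dist (x m') (x m) < \<rho>2 \<Longrightarrow> m' \<in> N"
    using chart_nbhd[OF c(1) N(1) c(2) N(2)] by blast
  define \<rho> where "\<rho> = min \<rho>1 (\<rho>2 / 2)"
  have \<rho>: "\<rho> > 0" "\<rho> \<le> \<rho>1" "\<rho> < \<rho>2" unfolding \<rho>_def using \<rho>1(1) \<rho>2(1) by auto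
  define K where "K = y ` (V \<inter> cball (x m) \<rho>)"
  have sub: "V \<inter> cball (x m) \<rho> \<subseteq> x ` U" using T(2) \<rho>1(2) \<rho>(2) by auto
  have "compact (V \<inter> cball (x m) \<rho>)"
    using closed_subspace[OF V(1)] by (simp add: closed_Int_compact)
  then have "compact K" unfolding K_def
    using compact_continuous_image continuous_on_subset[OF homeomorphism_cont2[OF y] sub] by blast
  then have K: "closed K" by (rule compact_imp_closed)
  have KN: "K \<subseteq> N"
  proof
    fix m' assume "m' \<in> K"
    then obtain w where w: "w \<in> V \<inter> cball (x m) \<rho>" "m' = y w" unfolding K_def by blast
    with sub y have "m' \<in> U" "x m' = w" unfolding homeomorphism_def by auto
    then show "m' \<in> N" using w \<rho>(3) by (intro \<rho>2(2)) (auto simp: dist_commute)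
  qed
  have inK: "m' \<in> K" if "m' \<in> U" "dist (x m') (x m) \<le> \<rho>" for m'
  proof -
    have "x m' \<in> V \<inter> cball (x m) \<rho>" using that T(2) by (auto simp: dist_commute)
    moreover have "m' = y (x m')" using y that(1) by (simp add: homeomorphism_apply1)
    ultimately show ?thesis unfolding K_def by blast
  qed
  \<comment> \<open>The norm is at most the sum of the absolute coordinates, so coordinate speeds up
    to \<open>\<delta>\<close> during unit time give a displacement of at most
    \<open>\<rho>\<close>.\<close>
  define \<delta> where "\<delta> = \<rho> / DIM('e)"
  show ?thesis
  proof (rule that[of \<delta>])
    show "\<delta> > 0" unfolding \<delta>_def using \<rho>(1) by simp
    fix c t0 assume cu: "smooth_curve A c" and c0: "c 0 = m"
      and vel: "\<And>t i. i \<in> Basis \<Longrightarrow> c t \<in> N \<Longrightarrow> \<bar>velocity A c t (\<lambda>m. x m \<bullet> i)\<bar> \<le> \<delta>"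
      and t0: "t0 \<in> {0..1::real}"
    have cont: "continuous_on UNIV c" using cu unfolding smooth_curve_def by blast
    show "c t0 \<in> N"
    proof (rule ccontr)
      assume "c t0 \<notin> N"
      have "closed (c -` (- N))" using N(1) cont by (intro closed_vimage) auto
      then have "compact ({0..1} \<inter> c -` (- N))" by (intro compact_Int_closed) auto
      moreover have "{0..1} \<inter> c -` (- N) \<noteq> {}" using t0 \<open>c t0 \<notin> N\<close> by auto
      ultimately obtain t1 where "t1 \<in> {0..1} \<inter> c -` (- N)"
        and "\<forall>t\<in>{0..1} \<inter> c -` (- N). t1 \<le> t"
        using compact_attains_inf[of "{0..1} \<inter> c -` (- N)"] by blast
      then have t1: "t1 \<in> {0..1}" "c t1 \<notin> N"
        and least: "\<And>t. t \<in> {0..1} \<Longrightarrow> c t \<notin> N \<Longrightarrow> t1 \<le> t" by auto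
      have before: "c t \<in> K" if t: "0 \<le> t" "t < t1" for t
      proof -
        have cN: "c s \<in> N" if "0 \<le> s" "s \<le> t" for s
          using least[of s] that t t1(1) by fastforce
        have "\<bar>(x (c t) - x m) \<bullet> i\<bar> \<le> \<delta>" if i: "i \<in> Basis" for i
        proof (cases "t = 0")
          case True
          then show ?thesis using c0 \<open>\<delta> > 0\<close> by simp
        next
          case False
          have "\<exists>s. 0 < s \<and> s < t \<and> x (c t) \<bullet> i - x (c 0) \<bullet> i = (t - 0) * velocity A c s (\<lambda>m. x m \<bullet> i)"
          proof (rule MVT2)
            fix s assume "0 \<le> s" "s \<le> t"
            then have "c s \<in> U" using cN N(3) by blast
            then show "((\<lambda>s. x (c s) \<bullet> i) has_real_derivative velocity A c s (\<lambda>m. x m \<bullet> i)) (at s)"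
              by (intro smooth_curve_has_derivative[OF cu] chart_coord_smooth_at[OF \<open>(U, x) \<in> A\<close> _ i])
          qed (use False t in simp)
          then obtain s where s: "0 < s" "s < t"
            "x (c t) \<bullet> i - x (c 0) \<bullet> i = t * velocity A c s (\<lambda>m. x m \<bullet> i)" by auto
          have "\<bar>t * velocity A c s (\<lambda>m. x m \<bullet> i)\<bar> \<le> 1 * \<delta>"
            unfolding abs_mult using vel[OF i cN[of s]] s t t1(1) by (intro mult_mono) auto
          then show ?thesis using s(3) c0 by (simp add: inner_diff_left)
        qed
        then have "(\<Sum>i\<in>Basis. \<bar>(x (c t) - x m) \<bullet> i\<bar>) \<le> (\<Sum>i\<in>(Basis::'e set). \<delta>)"
          by (rule sum_mono)
        also have "\<dots> = \<rho>" unfolding \<delta>_def by simp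
        finally have "dist (x (c t)) (x m) \<le> \<rho>"
          using norm_le_l1[of "x (c t) - x m"] unfolding dist_norm by linarith
        then show ?thesis using inK cN[of t] t(1) N(3) by auto
      qed
      \<comment> \<open>\<open>before\<close> says nothing about the time \<open>t1\<close> itself;
        it is reached as a limit of earlier times, which requires \<open>t1 > 0\<close>.\<close>
      have "0 < t1" using t1 c0 N(2) by (cases "t1 = 0") auto
      then have "t1 \<in> closure {0..<t1}" by simp
      moreover have "closure {0..<t1} \<subseteq> c -` K"
        using before closed_vimage[OF K cont] by (intro closure_minimal) auto
      ultimately show False using t1(2) KN by auto
    qed
  qed
qed

end

subsection \<open>Finitely many linear forms\<close>

text \<open>Induction on the number of forms. If some \<open>w\<close> is annihilated by the earlier
  forms but not by \<open>p r\<close>, it dictates the coefficient \<open>f w / p r w\<close>;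
  otherwise \<open>p r\<close> receives the coefficient 0. The setting is a set of functionals
  closed under linear combinations, as a tangent space of derivations is.\<close>

lemma annihilator_span:
  fixes p :: "nat \<Rightarrow> ('a \<Rightarrow> real) \<Rightarrow> real" and f :: "('a \<Rightarrow> real) \<Rightarrow> real"
  assumes T: "\<And>v w a b. v \<in> T \<Longrightarrow> w \<in> T \<Longrightarrow> (\<lambda>u. a * v u + b * w u) \<in> T"
    and p: "\<And>j v w a b. v \<in> T \<Longrightarrow> w \<in> T \<Longrightarrow> p j (\<lambda>u. a * v u + b * w u) = a * p j v + b * p j w"
  shows "(\<And>v w a b. v \<in> T \<Longrightarrow> w \<in> T \<Longrightarrow> f (\<lambda>u. a * v u + b * w u) = a * f v + b * f w) \<Longrightarrow>
    (\<And>v. v \<in> T \<Longrightarrow> \<forall>j<r. p j v = 0 \<Longrightarrow> f v = 0) \<Longrightarrow>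
    \<exists>c. \<forall>v\<in>T. f v = (\<Sum>j<r. c j * p j v)"
proof (induction r arbitrary: f)
  case 0
  then show ?case by simp
next
  case (Suc r)
  show ?case
  proof (cases "\<forall>v\<in>T. (\<forall>j<r. p j v = 0) \<longrightarrow> p r v = 0")
    case True
    have "\<exists>c. \<forall>v\<in>T. f v = (\<Sum>j<r. c j * p j v)"
      by (rule Suc.IH[OF Suc.prems(1)]) (use True Suc.prems(2) in \<open>auto simp: less_Suc_eq\<close>)
    then obtain c where "\<forall>v\<in>T. f v = (\<Sum>j<r. c j * p j v)" ..
    then show ?thesis by (intro exI[of _ "c(r := 0)"]) auto
  next
    case False
    then obtain w where w: "w \<in> T" "\<forall>j<r. p j w = 0" "p r w \<noteq> 0" by blast
    let ?k = "f w / p r w"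
    have "\<exists>c. \<forall>v\<in>T. f v - ?k * p r v = (\<Sum>j<r. c j * p j v)"
    proof (rule Suc.IH)
      show "f (\<lambda>u. a * v u + b * w' u) - ?k * p r (\<lambda>u. a * v u + b * w' u) =
          a * (f v - ?k * p r v) + b * (f w' - ?k * p r w')" if "v \<in> T" "w' \<in> T" for v w' a b
        unfolding Suc.prems(1)[OF that] p[OF that] by (simp only: algebra_simps)
      show "f v - ?k * p r v = 0" if v: "v \<in> T" "\<forall>j<r. p j v = 0" for v
      proof -
        let ?v = "\<lambda>u. 1 * v u + (- (p r v / p r w)) * w u"
        have "\<forall>j<Suc r. p j ?v = 0"
          using v(2) w(2,3) unfolding p[OF v(1) w(1)] by (auto simp: less_Suc_eq)
        then have "f ?v = 0" using Suc.prems(2) T[OF v(1) w(1)] by blast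
        then show ?thesis unfolding Suc.prems(1)[OF v(1) w(1)] by simp
      qed
    qed
    then obtain c where c: "\<forall>v\<in>T. f v - ?k * p r v = (\<Sum>j<r. c j * p j v)" ..
    have "f v = (\<Sum>j<Suc r. (c(r := ?k)) j * p j v)" if "v \<in> T" for v
    proof -
      have "f v = (\<Sum>j<r. c j * p j v) + ?k * p r v" using c that by (simp add: diff_eq_eq)
      then show ?thesis by simp
    qed
    then show ?thesis by blast
  qed
qed

text \<open>A biorthogonal system: \<open>w i\<close> is a combination of evaluations at finitely
  many points that is dual to the family \<open>X\<close>. It is built like a Gram-Schmidt process,
  one index at a time.\<close>

lemma dual_tests:
  fixes X :: "'i \<Rightarrow> 'p \<Rightarrow> real"
  assumes "finite J"
  shows "(\<And>c. \<forall>p\<in>T. (\<Sum>j\<in>J. c j * X j p) = 0 \<Longrightarrow> \<forall>j\<in>J. c j = 0) \<Longrightarrow>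
    \<exists>F w. finite F \<and> F \<subseteq> T \<and> (\<forall>i\<in>J. \<forall>p. p \<notin> F \<longrightarrow> w i p = 0) \<and>
      (\<forall>i\<in>J. \<forall>j\<in>J. (\<Sum>p\<in>F. w i p * X j p) = (if i = j then 1 else 0))"
  using assms
proof (induction J)
  case empty
  then show ?case by (intro exI[of _ "{}"]) auto
next
  case (insert a J)
  have "\<forall>j\<in>J. c j = 0" if "\<forall>p\<in>T. (\<Sum>j\<in>J. c j * X j p) = 0" for c
  proof -
    have "(\<Sum>j\<in>J. (c(a := 0)) j * X j p) = (\<Sum>j\<in>J. c j * X j p)" for p
      using insert(2) by (intro sum.cong) auto
    then have "\<forall>p\<in>T. (\<Sum>j\<in>insert a J. (c(a := 0)) j * X j p) = 0"
      using that insert(1,2) by simp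
    from insert.prems[OF this] show ?thesis using insert(2) by (metis fun_upd_other insertCI)
  qed
  from insert.IH[OF this] obtain F w where F: "finite F" "F \<subseteq> T"
    and tests: "\<forall>i\<in>J. \<forall>p. p \<notin> F \<longrightarrow> w i p = 0"
      "\<forall>i\<in>J. \<forall>j\<in>J. (\<Sum>p\<in>F. w i p * X j p) = (if i = j then 1 else 0)" by blast
  then have w0: "\<And>i p. i \<in> J \<Longrightarrow> p \<notin> F \<Longrightarrow> w i p = 0"
    and w: "\<And>i j. i \<in> J \<Longrightarrow> j \<in> J \<Longrightarrow> (\<Sum>p\<in>F. w i p * X j p) = (if i = j then 1 else 0)"
    by simp_all
  define s where "s j = (\<Sum>q\<in>F. w j q * X a q)" for j
  \<comment> \<open>The old weights read off the components \<open>s j\<close> of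
    \<open>X a\<close>; \<open>Y\<close> is the residual after removing them. If it vanished on all
    of \<open>T\<close>, there would be a relation with coefficient 1 at \<open>a\<close>.\<close>
  define Y where "Y p = X a p - (\<Sum>j\<in>J. s j * X j p)" for p
  have "\<exists>p\<in>T. Y p \<noteq> 0"
  proof (rule ccontr)
    assume no: "\<not> (\<exists>p\<in>T. Y p \<noteq> 0)"
    let ?c = "\<lambda>j. if j = a then 1 else - s j"
    have "(\<Sum>j\<in>J. ?c j * X j p) = - (\<Sum>j\<in>J. s j * X j p)" for p
      unfolding sum_negf[symmetric] using insert(2) by (intro sum.cong) auto
    then have "\<forall>p\<in>T. (\<Sum>j\<in>insert a J. ?c j * X j p) = 0"
      using no insert(1,2) by (simp add: Y_def)
    from insert.prems[OF this] show False by auto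
  qed
  then obtain p0 where p0: "p0 \<in> T" "Y p0 \<noteq> 0" by blast
  define F' where "F' = insert p0 F"
  have F': "finite F'" "F' \<subseteq> T" unfolding F'_def using F p0 by auto
  have wF': "(\<Sum>p\<in>F'. w i p * g p) = (\<Sum>p\<in>F. w i p * g p)" if "i \<in> J" for i g
    using F'(1) w0[OF that] unfolding F'_def by (intro sum.mono_neutral_right) auto
  \<comment> \<open>Evaluation at \<open>p0\<close>, corrected by the old weights so as to
    annihilate every \<open>X j\<close> with \<open>j \<in> J\<close>. On \<open>X a\<close> the
    corrected evaluation gives \<open>Y p0\<close>, hence the division.\<close>
  define wa where "wa p = ((if p = p0 then 1 else 0) - (\<Sum>j\<in>J. X j p0 * w j p)) / Y p0" for p
  have wa: "(\<Sum>p\<in>F'. wa p * g p) = (g p0 - (\<Sum>j\<in>J. X j p0 * (\<Sum>p\<in>F. w j p * g p))) / Y p0" for g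
  proof -
    have "(\<Sum>p\<in>F'. wa p * g p) =
        ((\<Sum>p\<in>F'. (if p = p0 then 1 else 0) * g p) - (\<Sum>p\<in>F'. \<Sum>j\<in>J. X j p0 * (w j p * g p))) / Y p0"
      unfolding wa_def sum_subtractf[symmetric] sum_divide_distrib
      by (intro sum.cong refl) (simp add: left_diff_distrib sum_distrib_right mult.assoc)
    also have "(\<Sum>p\<in>F'. (if p = p0 then 1 else 0) * g p) = (\<Sum>p\<in>F'. if p = p0 then g p else 0)"
      by (intro sum.cong) auto
    also have "\<dots> = g p0" using F'(1) by (simp add: F'_def)
    also have "(\<Sum>p\<in>F'. \<Sum>j\<in>J. X j p0 * (w j p * g p)) = (\<Sum>j\<in>J. X j p0 * (\<Sum>p\<in>F. w j p * g p))"
      by (subst sum.swap) (auto simp: sum_distrib_left[symmetric] wF' intro!: sum.cong)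
    finally show ?thesis .
  qed
  have waJ: "(\<Sum>p\<in>F'. wa p * X i p) = 0" if "i \<in> J" for i
  proof -
    have "(\<Sum>j\<in>J. X j p0 * (\<Sum>p\<in>F. w j p * X i p)) = (\<Sum>j\<in>J. if j = i then X j p0 else 0)"
      using w that by (intro sum.cong) auto
    then show ?thesis using that insert(1) by (simp add: wa)
  qed
  have waa: "(\<Sum>p\<in>F'. wa p * X a p) = 1"
  proof -
    have "(\<Sum>p\<in>F'. wa p * X a p) = (X a p0 - (\<Sum>j\<in>J. X j p0 * s j)) / Y p0"
      unfolding wa s_def ..
    also have "\<dots> = Y p0 / Y p0" unfolding Y_def by (simp only: mult.commute)
    finally show ?thesis using p0(2) by simp
  qed
  \<comment> \<open>An old weight has the value \<open>s i\<close> on \<open>X a\<close>.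
    Subtracting \<open>s i * wa\<close> removes it and leaves the values on \<open>J\<close>
    unchanged.\<close>
  define w' where "w' i p = (if i = a then wa p else w i p - s i * wa p)" for i p
  have w'J: "(\<Sum>p\<in>F'. w' i p * X j p) = (\<Sum>p\<in>F. w i p * X j p) - s i * (\<Sum>p\<in>F'. wa p * X j p)"
    if "i \<in> J" for i j
  proof -
    have "i \<noteq> a" using that insert(2) by blast
    then have "(\<Sum>p\<in>F'. w' i p * X j p) = (\<Sum>p\<in>F'. w i p * X j p - s i * (wa p * X j p))"
      unfolding w'_def by (intro sum.cong) (auto simp: algebra_simps)
    then show ?thesis by (simp add: sum_subtractf sum_distrib_left wF'[OF that])
  qed
  have "wa p = 0" if "p \<notin> F'" for p
  proof -
    have "(\<Sum>j\<in>J. X j p0 * w j p) = 0" using that w0 by (intro sum.neutral) (auto simp: F'_def)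
    then show ?thesis using that by (auto simp: wa_def F'_def)
  qed
  then have "\<forall>i\<in>insert a J. \<forall>p. p \<notin> F' \<longrightarrow> w' i p = 0"
    using w0 by (auto simp: w'_def F'_def)
  moreover have "(\<Sum>p\<in>F'. w' i p * X j p) = (if i = j then 1 else 0)"
    if "i \<in> insert a J" "j \<in> insert a J" for i j
  proof (cases "i = a")
    case True
    then show ?thesis using that(2) waa waJ insert(2) by (auto simp: w'_def)
  next
    case False
    then have i: "i \<in> J" using that(1) by blast
    show ?thesis unfolding w'J[OF i]
      using that(2) w[OF i] waa waJ insert(2) i by (auto simp: s_def)
  qed
  ultimately show ?case using F' by (intro exI[of _ F'] exI[of _ w']) auto
qed

text \<open>The dual weights recover each coefficient from finitely many values. Independence
  becomes an inequality in this way, and an inequality tolerates small errors in the tests.\<close>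

lemma coercive_tests:
  fixes X :: "'i \<Rightarrow> 'p \<Rightarrow> real"
  assumes "finite J" "\<And>c. \<forall>p\<in>T. (\<Sum>j\<in>J. c j * X j p) = 0 \<Longrightarrow> \<forall>j\<in>J. c j = 0"
  obtains F K where "finite F" "F \<subseteq> T" "K > 0"
    "\<And>c. (\<Sum>j\<in>J. \<bar>c j\<bar>) \<le> K * (\<Sum>p\<in>F. \<bar>\<Sum>j\<in>J. c j * X j p\<bar>)"
proof -
  obtain F w where F: "finite F" "F \<subseteq> T"
    and w: "\<And>i j. i \<in> J \<Longrightarrow> j \<in> J \<Longrightarrow> (\<Sum>p\<in>F. w i p * X j p) = (if i = j then 1 else 0)"
    using dual_tests[where X = X and T = T, OF assms(1) assms(2)] by metis
  \<comment> \<open>The summand 1 keeps \<open>K\<close> positive even when \<open>J\<close> or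
    \<open>F\<close> is empty.\<close>
  define K where "K = (\<Sum>i\<in>J. \<Sum>p\<in>F. \<bar>w i p\<bar>) + 1"
  have "(\<Sum>j\<in>J. \<bar>c j\<bar>) \<le> K * (\<Sum>p\<in>F. \<bar>\<Sum>j\<in>J. c j * X j p\<bar>)" for c
  proof -
    define S where "S p = (\<Sum>j\<in>J. c j * X j p)" for p
    have ci: "c i = (\<Sum>p\<in>F. w i p * S p)" if i: "i \<in> J" for i
    proof -
      have "(\<Sum>p\<in>F. w i p * S p) = (\<Sum>p\<in>F. \<Sum>j\<in>J. c j * (w i p * X j p))"
        unfolding S_def sum_distrib_left by (simp add: mult_ac)
      also have "\<dots> = (\<Sum>j\<in>J. c j * (\<Sum>p\<in>F. w i p * X j p))"
        by (subst sum.swap) (simp add: sum_distrib_left)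
      also have "\<dots> = (\<Sum>j\<in>J. if j = i then c j else 0)"
        by (intro sum.cong refl) (use w i in auto)
      finally show ?thesis using i assms(1) by simp
    qed
    have "\<bar>c i\<bar> \<le> (\<Sum>p\<in>F. \<bar>w i p\<bar>) * (\<Sum>p\<in>F. \<bar>S p\<bar>)" if i: "i \<in> J" for i
    proof -
      have "\<bar>c i\<bar> \<le> (\<Sum>p\<in>F. \<bar>w i p\<bar> * \<bar>S p\<bar>)"
        unfolding ci[OF i] by (rule order_trans[OF sum_abs]) (simp add: abs_mult)
      also have "\<dots> \<le> (\<Sum>p\<in>F. \<bar>w i p\<bar> * (\<Sum>p\<in>F. \<bar>S p\<bar>))"
        by (intro sum_mono mult_left_mono member_le_sum) (use F(1) in auto)
      finally show ?thesis by (simp add: sum_distrib_right)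
    qed
    then have "(\<Sum>i\<in>J. \<bar>c i\<bar>) \<le> (\<Sum>i\<in>J. (\<Sum>p\<in>F. \<bar>w i p\<bar>) * (\<Sum>p\<in>F. \<bar>S p\<bar>))" by (rule sum_mono)
    also have "\<dots> \<le> K * (\<Sum>p\<in>F. \<bar>S p\<bar>)"
      unfolding K_def sum_distrib_right[symmetric]
      by (intro mult_right_mono) (auto intro: sum_nonneg)
    finally show ?thesis unfolding S_def .
  qed
  moreover have "K > 0" unfolding K_def by (intro add_nonneg_pos sum_nonneg) auto
  ultimately show ?thesis using that F by blast
qed

subsection \<open>Cech classes\<close>

text \<open>The closure properties that make \<open>cohomologous\<close> an equivalence relation on
  cocycles.\<close>

locale function_sheaf =
  fixes F :: "'b::topological_space fsheaf"
  assumes restrict: "f \<in> F U \<Longrightarrow> open V \<Longrightarrow> V \<subseteq> U \<Longrightarrow> f \<in> F V"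
    and diff: "open U \<Longrightarrow> f \<in> F U \<Longrightarrow> g \<in> F U \<Longrightarrow> (\<lambda>b. f b - g b) \<in> F U"
    and zero: "open U \<Longrightarrow> (\<lambda>b. 0) \<in> F U"
begin

lemma uminus: "open U \<Longrightarrow> f \<in> F U \<Longrightarrow> (\<lambda>b. - f b) \<in> F U"
  using diff[OF _ diff, of U f f f] by simp

lemma add: "open U \<Longrightarrow> f \<in> F U \<Longrightarrow> g \<in> F U \<Longrightarrow> (\<lambda>b. f b + g b) \<in> F U"
  using diff[OF _ _ uminus, of U f g] by simp

end

definition cobounds ::
    "'b::topological_space fsheaf \<Rightarrow> 'b set set \<Rightarrow> ('b set \<Rightarrow> 'b set \<Rightarrow> 'b \<Rightarrow> real) \<Rightarrow>
     'b set set \<Rightarrow> ('b set \<Rightarrow> 'b set \<Rightarrow> 'b \<Rightarrow> real) \<Rightarrow> 'b set set \<Rightarrow>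
     ('b set \<Rightarrow> 'b set) \<Rightarrow> ('b set \<Rightarrow> 'b set) \<Rightarrow> ('b set \<Rightarrow> 'b \<Rightarrow> real) \<Rightarrow> bool" where
  "cobounds F C z C' z' E \<tau> \<tau>' h \<longleftrightarrow> open_cover E \<and>
     (\<forall>U\<in>E. \<tau> U \<in> C \<and> U \<subseteq> \<tau> U \<and> \<tau>' U \<in> C' \<and> U \<subseteq> \<tau>' U \<and> h U \<in> F U) \<and>
     (\<forall>U\<in>E. \<forall>V\<in>E. \<forall>b \<in> U \<inter> V. z (\<tau> U) (\<tau> V) b - z' (\<tau>' U) (\<tau>' V) b = h V b - h U b)"

lemma coboundsD:
  assumes "cobounds F C z C' z' E \<tau> \<tau>' h"
  shows "open_cover E"
    and "\<And>U. U \<in> E \<Longrightarrow> \<tau> U \<in> C \<and> U \<subseteq> \<tau> U \<and> \<tau>' U \<in> C' \<and> U \<subseteq> \<tau>' U \<and> h U \<in> F U"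
    and "\<And>U V b. U \<in> E \<Longrightarrow> V \<in> E \<Longrightarrow> b \<in> U \<Longrightarrow> b \<in> V \<Longrightarrow>
      z (\<tau> U) (\<tau> V) b - z' (\<tau>' U) (\<tau>' V) b = h V b - h U b"
  using assms unfolding cobounds_def by blast+

lemma cohomologous_iff:
  "((C, z), (C', z')) \<in> cohomologous F \<longleftrightarrow>
    (C, z) \<in> cocycles F \<and> (C', z') \<in> cocycles F \<and> (\<exists>E \<tau> \<tau>' h. cobounds F C z C' z' E \<tau> \<tau>' h)"
  unfolding cohomologous_def cobounds_def by simp

lemma cohomologousD:
  assumes "((C, z), (C', z')) \<in> cohomologous F"
  obtains E \<tau> \<tau>' h where "(C, z) \<in> cocycles F" "(C', z') \<in> cocycles F" "cobounds F C z C' z' E \<tau> \<tau>' h"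
  using assms unfolding cohomologous_iff by (elim conjE exE) (rule that)

lemma cohomologousI:
  assumes "(C, z) \<in> cocycles F" "(C', z') \<in> cocycles F" "open_cover E"
    "\<And>U. U \<in> E \<Longrightarrow> \<tau> U \<in> C \<and> U \<subseteq> \<tau> U \<and> \<tau>' U \<in> C' \<and> U \<subseteq> \<tau>' U \<and> h U \<in> F U"
    "\<And>U V b. U \<in> E \<Longrightarrow> V \<in> E \<Longrightarrow> b \<in> U \<Longrightarrow> b \<in> V \<Longrightarrow>
      z (\<tau> U) (\<tau> V) b - z' (\<tau>' U) (\<tau>' V) b = h V b - h U b"
  shows "((C, z), (C', z')) \<in> cohomologous F"
proof -
  have "cobounds F C z C' z' E \<tau> \<tau>' h"
    unfolding cobounds_def
    by (intro conjI[OF assms(3)] conjI; use assms(4,5) in blast)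
  with assms(1,2) show ?thesis unfolding cohomologous_iff by blast
qed

lemma cocyclesD:
  assumes "(C, z) \<in> cocycles F"
  shows "open_cover C" "\<And>U V. U \<in> C \<Longrightarrow> V \<in> C \<Longrightarrow> z U V \<in> F (U \<inter> V)"
    "\<And>U V W b. U \<in> C \<Longrightarrow> V \<in> C \<Longrightarrow> W \<in> C \<Longrightarrow> b \<in> U \<Longrightarrow> b \<in> V \<Longrightarrow> b \<in> W \<Longrightarrow>
      z U V b + z V W b = z U W b"
  using assms unfolding cocycles_def by auto

lemma common_refinement:
  assumes "open_cover C" "open_cover C'"
  obtains E \<tau> \<tau>' where "open_cover E" "\<And>U. U \<in> E \<Longrightarrow> \<tau> U \<in> C \<and> \<tau>' U \<in> C' \<and> U = \<tau> U \<inter> \<tau>' U"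
proof -
  let ?E = "{U \<inter> U' | U U'. U \<in> C \<and> U' \<in> C'}"
  have cover: "open_cover ?E"
    unfolding open_cover_def
  proof (intro conjI ballI)
    show "open W" if "W \<in> ?E" for W using that assms unfolding open_cover_def by auto
    show "\<Union> ?E = UNIV"
    proof (intro equalityI subset_UNIV subsetI)
      fix b
      have "b \<in> \<Union>C" "b \<in> \<Union>C'" using assms unfolding open_cover_def by simp_all
      then show "b \<in> \<Union> ?E" by blast
    qed
  qed
  have "\<forall>W\<in>?E. \<exists>U. \<exists>U'. U \<in> C \<and> U' \<in> C' \<and> W = U \<inter> U'" by blast
  from bchoice[OF this] obtain \<tau> where "\<forall>W\<in>?E. \<exists>U'. \<tau> W \<in> C \<and> U' \<in> C' \<and> W = \<tau> W \<inter> U'" ..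
  from bchoice[OF this] obtain \<tau>' where "\<forall>W\<in>?E. \<tau> W \<in> C \<and> \<tau>' W \<in> C' \<and> W = \<tau> W \<inter> \<tau>' W" ..
  from that[OF cover bspec[OF this]] show ?thesis .
qed

context function_sheaf
begin

lemma cohomologous_refl:
  assumes "(C, z) \<in> cocycles F" shows "((C, z), (C, z)) \<in> cohomologous F"
proof (rule cohomologousI[OF assms assms cocyclesD(1)[OF assms], where \<tau> = id and \<tau>' = id and h = "\<lambda>U b. 0"])
  show "id U \<in> C \<and> U \<subseteq> id U \<and> id U \<in> C \<and> U \<subseteq> id U \<and> (\<lambda>b. 0) \<in> F U" if "U \<in> C" for U
    using that cocyclesD(1)[OF assms] zero unfolding open_cover_def by simp
qed simp

lemma cohomologous_sym:
  assumes "((C, z), (C', z')) \<in> cohomologous F" shows "((C', z'), (C, z)) \<in> cohomologous F"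
proof -
  obtain E \<tau> \<tau>' h where c1: "(C, z) \<in> cocycles F" "(C', z') \<in> cocycles F"
    and c1b: "cobounds F C z C' z' E \<tau> \<tau>' h"
    by (rule cohomologousD[OF assms])
  note * = c1 coboundsD[OF c1b]
  show ?thesis
  proof (rule cohomologousI[OF *(2,1,3), where \<tau> = \<tau>' and \<tau>' = \<tau> and h = "\<lambda>U b. - h U b"])
    show "\<tau>' U \<in> C' \<and> U \<subseteq> \<tau>' U \<and> \<tau> U \<in> C \<and> U \<subseteq> \<tau> U \<and> (\<lambda>b. - h U b) \<in> F U" if "U \<in> E" for U
      using *(4)[OF that] *(3) that uminus unfolding open_cover_def by blast
    show "z' (\<tau>' U) (\<tau>' V) b - z (\<tau> U) (\<tau> V) b = - h V b - - h U b"
      if "U \<in> E" "V \<in> E" "b \<in> U" "b \<in> V" for U V b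
      using *(5)[OF that] by simp
  qed
qed

lemma cohomologous_trans:
  assumes "((C, z), (C', z')) \<in> cohomologous F" "((C', z'), (C'', z'')) \<in> cohomologous F"
  shows "((C, z), (C'', z'')) \<in> cohomologous F"
proof -
  obtain E \<tau> \<tau>' h where c1: "(C, z) \<in> cocycles F" "(C', z') \<in> cocycles F"
    and c1b: "cobounds F C z C' z' E \<tau> \<tau>' h"
    by (rule cohomologousD[OF assms(1)])
  note * = c1 coboundsD[OF c1b]
  obtain E1 \<sigma> \<sigma>' k where c2: "(C', z') \<in> cocycles F" "(C'', z'') \<in> cocycles F"
    and c2b: "cobounds F C' z' C'' z'' E1 \<sigma> \<sigma>' k"
    by (rule cohomologousD[OF assms(2)])
  note ** = c2(2) coboundsD[OF c2b]
  obtain G \<alpha> \<beta> where G: "open_cover G" "\<And>U. U \<in> G \<Longrightarrow> \<alpha> U \<in> E \<and> \<beta> U \<in> E1 \<and> U = \<alpha> U \<inter> \<beta> U"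
    using common_refinement[OF *(3) **(2)] by blast
  \<comment> \<open>On the common refinement the middle cocycle is reached by two refinement maps,
    \<open>\<tau>'\<close> after \<open>\<alpha>\<close> and \<open>\<sigma>\<close> after
    \<open>\<beta>\<close>. By the cocycle identity the last term compensates for passing from one
    to the other.\<close>
  define l where "l U = (\<lambda>b. (h (\<alpha> U) b + k (\<beta> U) b) - z' (\<tau>' (\<alpha> U)) (\<sigma> (\<beta> U)) b)" for U
  show ?thesis
  proof (rule cohomologousI[OF *(1) **(1) G(1), where \<tau> = "\<lambda>U. \<tau> (\<alpha> U)" and \<tau>' = "\<lambda>U. \<sigma>' (\<beta> U)" and h = l])
    fix U assume U: "U \<in> G"
    note a = *(4)[of "\<alpha> U"] and b = **(3)[of "\<beta> U"] and g = G(2)[OF U]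
    have oU: "open U" using G(1) U unfolding open_cover_def by blast
    have "h (\<alpha> U) \<in> F U" using a g by (intro restrict[OF _ oU, of _ "\<alpha> U"]) auto
    moreover have "k (\<beta> U) \<in> F U" using b g by (intro restrict[OF _ oU, of _ "\<beta> U"]) auto
    moreover have "z' (\<tau>' (\<alpha> U)) (\<sigma> (\<beta> U)) \<in> F U"
      using a b g by (intro restrict[OF cocyclesD(2)[OF *(2)] oU]) auto
    ultimately have "l U \<in> F U" unfolding l_def by (intro diff[OF oU] add[OF oU])
    then show "\<tau> (\<alpha> U) \<in> C \<and> U \<subseteq> \<tau> (\<alpha> U) \<and> \<sigma>' (\<beta> U) \<in> C'' \<and> U \<subseteq> \<sigma>' (\<beta> U) \<and> l U \<in> F U"
      using a b g by blast
  next
    fix U V b assume UV: "U \<in> G" "V \<in> G" "b \<in> U" "b \<in> V"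
    have m: "b \<in> \<alpha> U" "b \<in> \<alpha> V" "b \<in> \<beta> U" "b \<in> \<beta> V" "\<alpha> U \<in> E" "\<alpha> V \<in> E" "\<beta> U \<in> E1" "\<beta> V \<in> E1"
      using G(2) UV by auto
    have n: "\<tau>' (\<alpha> U) \<in> C'" "\<tau>' (\<alpha> V) \<in> C'" "\<sigma> (\<beta> U) \<in> C'" "\<sigma> (\<beta> V) \<in> C'"
      "b \<in> \<tau>' (\<alpha> U)" "b \<in> \<tau>' (\<alpha> V)" "b \<in> \<sigma> (\<beta> U)" "b \<in> \<sigma> (\<beta> V)"
      using *(4)[OF m(5)] *(4)[OF m(6)] **(3)[OF m(7)] **(3)[OF m(8)] m(1-4) by auto
    show "z (\<tau> (\<alpha> U)) (\<tau> (\<alpha> V)) b - z'' (\<sigma>' (\<beta> U)) (\<sigma>' (\<beta> V)) b = l V b - l U b"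
      using *(5)[OF m(5,6,1,2)] **(4)[OF m(7,8,3,4)]
        cocyclesD(3)[OF *(2) n(1,3,4,5,7,8)] cocyclesD(3)[OF *(2) n(1,2,4,5,6,8)]
      unfolding l_def by simp
  qed
qed

lemma cohomologous_class_eq:
  assumes "((C, z), (C', z')) \<in> cohomologous F"
  shows "cohomologous F `` {(C, z)} = cohomologous F `` {(C', z')}"
proof (intro equalityI subsetI)
  show "x \<in> cohomologous F `` {(C', z')}" if "x \<in> cohomologous F `` {(C, z)}" for x
    using that assms cohomologous_sym cohomologous_trans by (cases x) blast
  show "x \<in> cohomologous F `` {(C, z)}" if "x \<in> cohomologous F `` {(C', z')}" for x
    using that assms cohomologous_trans by (cases x) blast
qed

text \<open>A coboundary with values in \<open>G\<close> is one with values in \<open>F\<close>, so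
  transitivity in \<open>F\<close> reduces the image of a class to the class of any one
  representative.\<close>

lemma H1_inclusion_class:
  assumes G: "function_sheaf G" and sub: "\<And>U. open U \<Longrightarrow> G U \<subseteq> F U" and c: "(C, z) \<in> cocycles G"
  shows "(C, z) \<in> cocycles F"
    and "H1_inclusion F (cohomologous G `` {(C, z)}) = cohomologous F `` {(C, z)}"
proof -
  interpret G: function_sheaf G by fact
  have coc: "(C', z') \<in> cocycles F" if c': "(C', z') \<in> cocycles G" for C' z'
  proof -
    have "z' U V \<in> F (U \<inter> V)" if "U \<in> C'" "V \<in> C'" for U V
    proof -
      have "open (U \<inter> V)" using cocyclesD(1)[OF c'] that unfolding open_cover_def by blast
      then show ?thesis using cocyclesD(2)[OF c' that] sub by blast
    qed
    then show ?thesis using c' unfolding cocycles_def by simp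
  qed
  then show "(C, z) \<in> cocycles F" using c .
  have mono: "((C, z), (C', z')) \<in> cohomologous F" if coh: "((C, z), (C', z')) \<in> cohomologous G" for C' z'
  proof -
    obtain E \<tau> \<tau>' h where c1: "(C, z) \<in> cocycles G" "(C', z') \<in> cocycles G"
    and c1b: "cobounds G C z C' z' E \<tau> \<tau>' h"
    by (rule cohomologousD[OF coh])
  note * = c1 coboundsD[OF c1b]
    show ?thesis
    proof (rule cohomologousI[where E = E and \<tau> = \<tau> and \<tau>' = \<tau>' and h = h])
      show "\<tau> U \<in> C \<and> U \<subseteq> \<tau> U \<and> \<tau>' U \<in> C' \<and> U \<subseteq> \<tau>' U \<and> h U \<in> F U" if "U \<in> E" for U
        using *(4)[OF that] sub *(3) that unfolding open_cover_def by blast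
    qed (rule coc[OF *(1)], rule coc[OF *(2)], rule *(3), rule *(5))
  qed
  show "H1_inclusion F (cohomologous G `` {(C, z)}) = cohomologous F `` {(C, z)}"
    unfolding H1_inclusion_def
  proof (intro equalityI subsetI)
    fix x assume "x \<in> cohomologous F `` (cohomologous G `` {(C, z)})"
    then obtain y where y: "((C, z), y) \<in> cohomologous G" "(y, x) \<in> cohomologous F" by blast
    then show "x \<in> cohomologous F `` {(C, z)}"
      using mono cohomologous_trans by (cases y; cases x) blast
  next
    fix x assume "x \<in> cohomologous F `` {(C, z)}"
    then show "x \<in> cohomologous F `` (cohomologous G `` {(C, z)})"
      using G.cohomologous_refl[OF c] by blast
  qed
qed

end

lemma const_sheaf_cong:
  assumes "f \<in> const_sheaf U" "\<And>b. b \<in> U \<Longrightarrow> f b = g b"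
  shows "g \<in> const_sheaf U"
  unfolding const_sheaf_def
proof (intro CollectI ballI)
  fix b assume b: "b \<in> U"
  then obtain W where W: "open W" "b \<in> W" "W \<subseteq> U" "\<forall>b'\<in>W. f b' = f b"
    using assms(1) unfolding const_sheaf_def by blast
  then have "\<forall>b'\<in>W. g b' = g b" using assms(2) b by (metis subsetD)
  with W(1-3) show "\<exists>W. open W \<and> b \<in> W \<and> W \<subseteq> U \<and> (\<forall>b'\<in>W. g b' = g b)" by blast
qed

lemma const_sheaf_function_sheaf: "function_sheaf const_sheaf"
proof
  fix f :: "'b::topological_space \<Rightarrow> real" and U V
  assume f: "f \<in> const_sheaf U" and V: "open V" "V \<subseteq> U"
  show "f \<in> const_sheaf V"
    unfolding const_sheaf_def
  proof (intro CollectI ballI)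
    fix b assume b: "b \<in> V"
    then obtain W where "open W" "b \<in> W" "\<forall>b'\<in>W. f b' = f b"
      using f V(2) unfolding const_sheaf_def by blast
    then show "\<exists>W. open W \<and> b \<in> W \<and> W \<subseteq> V \<and> (\<forall>b'\<in>W. f b' = f b)"
      using V(1) b by (intro exI[of _ "W \<inter> V"] conjI open_Int) blast+
  qed
next
  fix f g :: "'b::topological_space \<Rightarrow> real" and U
  assume fg: "f \<in> const_sheaf U" "g \<in> const_sheaf U"
  show "(\<lambda>b. f b - g b) \<in> const_sheaf U"
    unfolding const_sheaf_def
  proof (intro CollectI ballI)
    fix b assume b: "b \<in> U"
    obtain W where W: "open W" "b \<in> W" "W \<subseteq> U" "\<forall>b'\<in>W. f b' = f b"
      using fg(1) b unfolding const_sheaf_def by blast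
    obtain W' where W': "open W'" "b \<in> W'" "\<forall>b'\<in>W'. g b' = g b"
      using fg(2) b unfolding const_sheaf_def by blast
    have "\<forall>b'\<in>W \<inter> W'. f b' - g b' = f b - g b" using W(4) W'(3) by (metis IntE)
    then show "\<exists>W. open W \<and> b \<in> W \<and> W \<subseteq> U \<and> (\<forall>b'\<in>W. f b' - g b' = f b - g b)"
      using W(1-3) W'(1,2) by (intro exI[of _ "W \<inter> W'"] conjI open_Int) blast+
  qed
qed (auto simp: const_sheaf_def)

subsection \<open>Poisson structures\<close>

locale poisson_mfd = mfd n A
  for n :: nat and A :: "('m::{t2_space, second_countable_topology}, 'e::euclidean_space) atlas" +
  fixes P :: "'m bivector"
  assumes poisson: "poisson_manifold n A P"
begin

lemma bivector_skew:
  "\<xi> \<in> cotangent_space A m \<Longrightarrow> \<eta> \<in> cotangent_space A m \<Longrightarrow> P m \<xi> \<eta> = - P m \<eta> \<xi>"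
  using poisson[unfolded poisson_manifold_def, THEN conjunct2, THEN conjunct1] by blast

lemma bivector_linear:
  "\<xi> \<in> cotangent_space A m \<Longrightarrow> \<eta> \<in> cotangent_space A m \<Longrightarrow> \<zeta> \<in> cotangent_space A m \<Longrightarrow>
    P m (\<lambda>v. a * \<xi> v + b * \<eta> v) \<zeta> = a * P m \<xi> \<zeta> + b * P m \<eta> \<zeta>"
  using poisson[unfolded poisson_manifold_def, THEN conjunct2, THEN conjunct2, THEN conjunct1] by blast

lemma bivector_zero: "\<zeta> \<in> cotangent_space A m \<Longrightarrow> P m (\<lambda>v. 0) \<zeta> = 0"
  using bivector_linear[OF cotangent_zero cotangent_zero, of \<zeta> m 0 0] by simp

lemma bivector_sum:
  assumes "\<And>i. i \<in> I \<Longrightarrow> \<xi> i \<in> cotangent_space A m" and \<zeta>: "\<zeta> \<in> cotangent_space A m"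
  shows "P m (\<lambda>v. \<Sum>i\<in>I. c i * \<xi> i v) \<zeta> = (\<Sum>i\<in>I. c i * P m (\<xi> i) \<zeta>)"
proof (cases "finite I")
  case True
  then show ?thesis using assms(1)
  proof (induction I)
    case empty
    then show ?case by (simp add: bivector_zero[OF \<zeta>])
  next
    case (insert i I)
    have "(\<lambda>v. \<Sum>i\<in>I. c i * \<xi> i v) \<in> cotangent_space A m"
      by (rule cotangent_sum) (use insert.prems in auto)
    from bivector_linear[OF insert.prems[of i] this \<zeta>, of "c i" 1] insert show ?case by simp
  qed
qed (simp add: bivector_zero[OF \<zeta>])

lemma bracket_smooth:
  "open U \<Longrightarrow> smooth_fun A U f \<Longrightarrow> smooth_fun A U g \<Longrightarrow> smooth_fun A U (poisson_bracket A P f g)"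
  using poisson unfolding poisson_manifold_def by blast

lemma sharp_zero_iff: "sharp A P m \<xi> = (\<lambda>g. 0) \<longleftrightarrow> (\<forall>g. smooth_at A m g \<longrightarrow> P m \<xi> (differential A g m) = 0)"
  unfolding sharp_def fun_eq_iff by auto

lemma casimir_iff:
  "casimir A P U F \<longleftrightarrow> smooth_fun A U F \<and>
    (\<forall>m\<in>U. \<forall>g. smooth_at A m g \<longrightarrow> P m (differential A F m) (differential A g m) = 0)"
proof -
  have "P m (differential A g m) (differential A F m) = 0 \<longleftrightarrow> P m (differential A F m) (differential A g m) = 0" for m g
    using bivector_skew[OF differential_cotangent differential_cotangent, of m g F] by simp
  then show ?thesis
    unfolding casimir_def hamiltonian_vf_def poisson_bracket_def fun_eq_iff by auto
qed

end

lemma poisson_mfdI: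
  assumes "poisson_manifold n A P" shows "poisson_mfd n A P"
proof (intro poisson_mfd.intro mfd.intro poisson_mfd_axioms.intro)
  show "smooth_manifold n A" using assms[unfolded poisson_manifold_def] by (rule conjunct1)
qed fact

subsection \<open>The action bundle\<close>

locale nci =
  fixes S :: "('m::{t2_space, second_countable_topology}, 'e::euclidean_space,
               'b::{t2_space, second_countable_topology}, 'f::euclidean_space) nci_data"
    and dM dB r :: nat
    and D :: "'m \<Rightarrow> 'm vec set"
  assumes nci: "nci_system dM dB r D S"
begin

abbreviation "A \<equiv> atlasM S"
abbreviation "P \<equiv> poisM S"
abbreviation "B \<equiv> atlasB S"
abbreviation "Q \<equiv> poisB S"
abbreviation "\<phi> \<equiv> proj S"
abbreviation "dif \<equiv> differential B"
abbreviation "bracket q \<equiv> poisson_bracket A P (q \<circ> \<phi>)"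
abbreviation "cls \<equiv> action_class S"
abbreviation "CasM \<equiv> casM_sheaf S"
abbreviation "Ker \<equiv> ker_sharpM S"

lemma poisson_M: "poisson_manifold dM A P"
  using nci unfolding nci_system_def abstract_nci_def by (elim conjE)

lemma poisson_B: "poisson_manifold dB B Q"
  using nci unfolding nci_system_def by (elim conjE)

sublocale M: poisson_mfd dM A P
  by (intro poisson_mfdI poisson_M)

sublocale B: poisson_mfd dB B Q
  by (intro poisson_mfdI poisson_B)

lemma sub: "submersion A B \<phi>" and surj: "surj \<phi>" and poisson_map: "poisson_map A P B Q \<phi>"
  using nci unfolding nci_system_def by blast+

lemma smooth_map: "smooth_map A B \<phi>"
  using sub unfolding submersion_def by blast

lemma open_preimage: "open V \<Longrightarrow> open (\<phi> -` V)"
  using smooth_map open_vimage unfolding smooth_map_def by blast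

lemma smooth_fun_pullback: "open V \<Longrightarrow> smooth_fun B V f \<Longrightarrow> smooth_fun A (\<phi> -` V) (f \<circ> \<phi>)"
  using smooth_map unfolding smooth_map_def by blast

lemma smooth_at_pullback: "smooth_at B (\<phi> m) f \<Longrightarrow> smooth_at A m (f \<circ> \<phi>)"
  by (meson open_preimage smooth_at_def smooth_fun_pullback vimageI2)

lemma pushforward_tangent: "v \<in> tangent_space A m \<Longrightarrow> pushforward B \<phi> m v \<in> tangent_space B (\<phi> m)"
  using sub unfolding submersion_def by blast

lemma pullback_cotangent:
  assumes "\<xi> \<in> cotangent_space B (\<phi> m)" shows "pullback A B \<phi> m \<xi> \<in> cotangent_space A m"
proof -
  have "pushforward B \<phi> m (\<lambda>f. a * v f + b * w f) =
      (\<lambda>f. a * pushforward B \<phi> m v f + b * pushforward B \<phi> m w f)" for a b v w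
    by (auto simp: pushforward_def)
  then show ?thesis
    using assms pushforward_tangent unfolding cotangent_space_def pullback_def
    by (auto simp: tangent_lincomb)
qed

lemma pullback_differential:
  assumes "smooth_at B (\<phi> m) f" shows "pullback A B \<phi> m (dif f (\<phi> m)) = differential A (f \<circ> \<phi>) m"
  using assms pushforward_tangent by (auto simp: pullback_def differential_def pushforward_def)

text \<open>The derivative of \<open>u\<close> at \<open>m\<close> along the action vector field of
  the covector \<open>\<xi>\<close>. Without the smoothness guard in \<open>sharp\<close>, linearity
  in \<open>\<xi>\<close> holds for every \<open>u\<close>.\<close>

definition act :: "'m \<Rightarrow> 'b covec \<Rightarrow> ('m \<Rightarrow> real) \<Rightarrow> real" where
  "act m \<xi> u = P m (pullback A B \<phi> m \<xi>) (differential A u m)"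

lemma act_sum:
  assumes "\<And>i. i \<in> I \<Longrightarrow> \<xi> i \<in> cotangent_space B (\<phi> m)"
  shows "act m (\<lambda>v. \<Sum>i\<in>I. c i * \<xi> i v) u = (\<Sum>i\<in>I. c i * act m (\<xi> i) u)"
proof -
  have "pullback A B \<phi> m (\<lambda>v. \<Sum>i\<in>I. c i * \<xi> i v) = (\<lambda>v. \<Sum>i\<in>I. c i * pullback A B \<phi> m (\<xi> i) v)"
    by (auto simp: pullback_def)
  then show ?thesis
    unfolding act_def using M.bivector_sum[OF pullback_cotangent[OF assms] differential_cotangent] by simp
qed

lemma act_lincomb:
  assumes "\<xi> \<in> cotangent_space B (\<phi> m)" "\<eta> \<in> cotangent_space B (\<phi> m)"
  shows "act m (\<lambda>v. a * \<xi> v + b * \<eta> v) u = a * act m \<xi> u + b * act m \<eta> u"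
proof -
  have "pullback A B \<phi> m (\<lambda>v. a * \<xi> v + b * \<eta> v) = (\<lambda>v. a * pullback A B \<phi> m \<xi> v + b * pullback A B \<phi> m \<eta> v)"
    by (auto simp: pullback_def)
  then show ?thesis
    unfolding act_def using M.bivector_linear[OF pullback_cotangent pullback_cotangent differential_cotangent] assms
    by simp
qed

lemma act_diff:
  "\<xi> \<in> cotangent_space B (\<phi> m) \<Longrightarrow> \<eta> \<in> cotangent_space B (\<phi> m) \<Longrightarrow>
    act m (\<lambda>v. \<xi> v - \<eta> v) u = act m \<xi> u - act m \<eta> u"
  using act_lincomb[of \<xi> m \<eta> 1 "-1" u] by simp

lemma act_bracket:
  "smooth_at B (\<phi> m) f \<Longrightarrow> act m (dif f (\<phi> m)) u = bracket f u m"
  by (simp add: act_def poisson_bracket_def pullback_differential)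

lemma ker_sharpM_iff:
  "\<xi> \<in> Ker b \<longleftrightarrow> \<xi> \<in> cotangent_space B b \<and>
    (\<forall>m u. \<phi> m = b \<longrightarrow> smooth_at A m u \<longrightarrow> act m \<xi> u = 0)"
  unfolding ker_sharpM_def action_vf_form_def M.sharp_zero_iff act_def by auto

lemma ker_sharpM_lincomb:
  "\<xi> \<in> Ker b \<Longrightarrow> \<eta> \<in> Ker b \<Longrightarrow> (\<lambda>v. c * \<xi> v + d * \<eta> v) \<in> Ker b"
  unfolding ker_sharpM_iff by (auto simp: cotangent_lincomb act_lincomb)

lemma ker_sharpM_zero: "(\<lambda>v. 0) \<in> Ker b"
  unfolding ker_sharpM_iff using cotangent_zero act_sum[where I = "{}"] by auto

lemma ker_sharpM_sum:
  assumes "\<And>i. i \<in> I \<Longrightarrow> \<xi> i \<in> Ker b"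
  shows "(\<lambda>v. \<Sum>i\<in>I. c i * \<xi> i v) \<in> Ker b"
  unfolding ker_sharpM_iff
proof (intro conjI allI impI)
  show "(\<lambda>v. \<Sum>i\<in>I. c i * \<xi> i v) \<in> cotangent_space B b"
    using assms unfolding ker_sharpM_iff by (intro cotangent_sum) auto
  fix m u assume mu: "\<phi> m = b" "smooth_at A m u"
  have "act m (\<lambda>v. \<Sum>i\<in>I. c i * \<xi> i v) u = (\<Sum>i\<in>I. c i * act m (\<xi> i) u)"
    using assms mu(1) unfolding ker_sharpM_iff by (intro act_sum) auto
  also have "\<dots> = 0" using assms mu unfolding ker_sharpM_iff by (intro sum.neutral) auto
  finally show "act m (\<lambda>v. \<Sum>i\<in>I. c i * \<xi> i v) u = 0" .
qed

lemma ker_sharpM_add: "\<xi> \<in> Ker b \<Longrightarrow> \<eta> \<in> Ker b \<Longrightarrow> (\<lambda>v. \<xi> v + \<eta> v) \<in> Ker b"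
  using ker_sharpM_lincomb[of \<xi> b \<eta> 1 1] by simp

lemma ker_sharpM_diff: "\<xi> \<in> Ker b \<Longrightarrow> \<eta> \<in> Ker b \<Longrightarrow> (\<lambda>v. \<xi> v - \<eta> v) \<in> Ker b"
  using ker_sharpM_lincomb[of \<xi> b \<eta> 1 "-1"] by simp

lemma action_class_eq_iff:
  "cls b \<xi> = cls b \<eta> \<longleftrightarrow> (\<lambda>v. \<xi> v - \<eta> v) \<in> Ker b"
proof
  assume "cls b \<xi> = cls b \<eta>"
  moreover have "\<xi> \<in> cls b \<xi>"
    unfolding action_class_def using ker_sharpM_zero by force
  ultimately obtain \<kappa> where "\<kappa> \<in> Ker b" "\<xi> = (\<lambda>v. \<eta> v + \<kappa> v)"
    unfolding action_class_def by blast
  then show "(\<lambda>v. \<xi> v - \<eta> v) \<in> Ker b" by simp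
next
  assume d: "(\<lambda>v. \<xi> v - \<eta> v) \<in> Ker b"
  have *: "cls b \<xi>' \<subseteq> cls b \<eta>'" if "(\<lambda>v. \<xi>' v - \<eta>' v) \<in> Ker b" for \<xi>' \<eta>'
  proof
    fix \<zeta> assume "\<zeta> \<in> cls b \<xi>'"
    then obtain \<kappa> where \<kappa>: "\<kappa> \<in> Ker b" "\<zeta> = (\<lambda>v. \<xi>' v + \<kappa> v)"
      unfolding action_class_def by blast
    have "\<zeta> = (\<lambda>v. \<eta>' v + ((\<xi>' v - \<eta>' v) + \<kappa> v))" unfolding \<kappa>(2) by simp
    then show "\<zeta> \<in> cls b \<eta>'"
      unfolding action_class_def using ker_sharpM_add[OF that \<kappa>(1)]
      by (intro CollectI exI[of _ "\<lambda>v. (\<xi>' v - \<eta>' v) + \<kappa> v"] conjI)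
  qed
  have "(\<lambda>v. \<eta> v - \<xi> v) \<in> Ker b" using ker_sharpM_diff[OF ker_sharpM_zero d] by simp
  with d show "cls b \<xi> = cls b \<eta>" using * by blast
qed

lemma action_class_some:
  obtains \<kappa> where "\<kappa> \<in> Ker b" "(SOME \<eta>. \<eta> \<in> cls b \<xi>) = (\<lambda>v. \<xi> v + \<kappa> v)"
proof -
  have "\<exists>\<eta>. \<eta> \<in> cls b \<xi>"
    unfolding action_class_def using ker_sharpM_zero by blast
  then have "(SOME \<eta>. \<eta> \<in> cls b \<xi>) \<in> cls b \<xi>" by (rule someI_ex)
  then show ?thesis using that unfolding action_class_def by blast
qed

text \<open>The representatives picked by \<open>SOME\<close> differ from the \<open>\<xi> i\<close>
  by elements of \<open>Ker b\<close>, which is closed under linear combinations.\<close>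

lemma int_combination_class:
  "int_combination S r b (\<lambda>i. cls b (\<xi> i)) k = cls b (\<lambda>v. \<Sum>i<r. of_int (k i) * \<xi> i v)"
proof -
  have "\<forall>i. \<exists>\<kappa>. \<kappa> \<in> Ker b \<and> (SOME \<eta>. \<eta> \<in> cls b (\<xi> i)) = (\<lambda>v. \<xi> i v + \<kappa> v)"
  proof
    show "\<exists>\<kappa>. \<kappa> \<in> Ker b \<and> (SOME \<eta>. \<eta> \<in> cls b (\<xi> i)) = (\<lambda>v. \<xi> i v + \<kappa> v)" for i
      by (rule action_class_some[of b "\<xi> i"]) blast
  qed
  from choice[OF this] obtain \<kappa> where \<kappa>: "\<And>i. \<kappa> i \<in> Ker b"
    "\<And>i. (SOME \<eta>. \<eta> \<in> cls b (\<xi> i)) = (\<lambda>v. \<xi> i v + \<kappa> i v)" by blast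
  have "(\<lambda>v. (\<Sum>i<r. of_int (k i) * (\<xi> i v + \<kappa> i v)) - (\<Sum>i<r. of_int (k i) * \<xi> i v)) =
      (\<lambda>v. \<Sum>i<r. of_int (k i) * \<kappa> i v)"
    by (simp add: sum_subtractf[symmetric] algebra_simps)
  then show ?thesis
    unfolding int_combination_def \<kappa>(2) action_class_eq_iff using ker_sharpM_sum[OF \<kappa>(1)] by simp
qed

lemma action_vf_class:
  assumes "\<xi> \<in> cotangent_space B (\<phi> m)" "smooth_at A m u"
  shows "action_vf S (cls (\<phi> m) \<xi>) m u = act m \<xi> u"
proof -
  obtain \<kappa> where \<kappa>: "\<kappa> \<in> Ker (\<phi> m)"
    "(SOME \<eta>. \<eta> \<in> cls (\<phi> m) \<xi>) = (\<lambda>v. \<xi> v + \<kappa> v)"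
    by (rule action_class_some)
  have "action_vf S (cls (\<phi> m) \<xi>) m u = act m (\<lambda>v. \<xi> v + \<kappa> v) u"
    using assms(2) by (simp add: action_vf_def \<kappa>(2) action_vf_form_def sharp_def act_def)
  also have "\<dots> = act m \<xi> u + act m \<kappa> u"
    using act_lincomb[of \<xi> m \<kappa> 1 1 u] assms(1) \<kappa>(1) unfolding ker_sharpM_iff by simp
  also have "act m \<kappa> u = 0" using \<kappa>(1) assms(2) unfolding ker_sharpM_iff by blast
  finally show ?thesis by simp
qed

text \<open>The velocity is compared with \<open>Y\<close> on smooth functions only, so
  \<open>Y\<close> may be an expression in \<open>act\<close> that obeys no convention on other
  functions.\<close>

definition closed_orbit :: "'b \<Rightarrow> ('m \<Rightarrow> 'm vec) \<Rightarrow> 'm \<Rightarrow> (real \<Rightarrow> 'm) \<Rightarrow> bool" where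
  "closed_orbit b Y m c \<longleftrightarrow> smooth_curve A c \<and> c 0 = m \<and> c 1 = m \<and> (\<forall>t. \<phi> (c t) = b) \<and>
    (\<forall>t u. smooth_at A (c t) u \<longrightarrow> velocity A c t u = Y (c t) u)"

lemma lattice_orbit:
  assumes "cls b \<xi> \<in> action_lattice S b" "\<xi> \<in> cotangent_space B b" "\<phi> m = b"
  shows "\<exists>c. closed_orbit b (\<lambda>m. act m \<xi>) m c"
proof -
  obtain \<Phi> where fl: "is_flow_on A (\<phi> -` {b}) (action_vf S (cls b \<xi>)) \<Phi>"
    and "\<forall>m \<in> \<phi> -` {b}. \<Phi> 1 m = m"
    using assms(1) unfolding action_lattice_def by blast
  have m: "m \<in> \<phi> -` {b}" using assms(3) by simp
  have fl: "\<Phi> 0 m = m" "smooth_curve A (\<lambda>t. \<Phi> t m)" "\<And>t. \<Phi> t m \<in> \<phi> -` {b}"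
    "\<And>t. velocity A (\<lambda>t. \<Phi> t m) t = action_vf S (cls b \<xi>) (\<Phi> t m)"
    using bspec[OF fl[unfolded is_flow_on_def] m] by auto
  have \<phi>: "\<phi> (\<Phi> t m) = b" for t using fl(3)[of t] by simp
  have "velocity A (\<lambda>t. \<Phi> t m) t u = act (\<Phi> t m) \<xi> u" if "smooth_at A (\<Phi> t m) u" for t u
    using action_vf_class[of \<xi> "\<Phi> t m", OF _ that] assms(2) unfolding fl(4) \<phi> by simp
  then have "closed_orbit b (\<lambda>m. act m \<xi>) m (\<lambda>t. \<Phi> t m)"
    unfolding closed_orbit_def using fl(1,2) \<phi> m \<open>\<forall>m \<in> \<phi> -` {b}. \<Phi> 1 m = m\<close> by blast
  then show ?thesis by (rule exI[of _ "\<lambda>t. \<Phi> t m"])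
qed

end

section \<open>Casimirs on M and on B, and the sheaf \<open>CasM\<close>\<close>

lemma (in poisson_mfd) casimir_sum:
  assumes "\<And>i. i \<in> I \<Longrightarrow> casimir A P U (f i)" "open U"
  shows "casimir A P U (\<lambda>x. \<Sum>i\<in>I. c i * f i x)"
  unfolding casimir_iff
proof (intro conjI ballI allI impI)
  have sm: "smooth_fun A U (f i)" if "i \<in> I" for i using assms(1)[OF that] by (simp add: casimir_iff)
  then show "smooth_fun A U (\<lambda>x. \<Sum>i\<in>I. c i * f i x)"
    by (intro smooth_fun_sum smooth_fun_mult smooth_fun_const)
  fix m g assume m: "m \<in> U" and g: "smooth_at A m g"
  have "P m (differential A (\<lambda>x. \<Sum>i\<in>I. c i * f i x) m) (differential A g m) =
      (\<Sum>i\<in>I. c i * P m (differential A (f i) m) (differential A g m))"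
    using smooth_atI[OF sm assms(2) m]
    by (simp add: differential_sum bivector_sum[OF differential_cotangent differential_cotangent])
  also have "\<dots> = 0" using assms(1) m g by (intro sum.neutral) (simp add: casimir_iff)
  finally show "P m (differential A (\<lambda>x. \<Sum>i\<in>I. c i * f i x) m) (differential A g m) = 0" .
qed

lemma (in poisson_mfd) casimir_subset: "casimir A P U f \<Longrightarrow> V \<subseteq> U \<Longrightarrow> casimir A P V f"
  unfolding casimir_def by (auto intro: smooth_fun_subset)

lemma (in poisson_mfd) casimir_diff:
  assumes "casimir A P U f" "casimir A P U g" "open U"
  shows "casimir A P U (\<lambda>x. f x - g x)"
  using casimir_sum[of "{True, False}" U "\<lambda>b. if b then f else g" "\<lambda>b. if b then 1 else -1"] assms
  by simp

lemma isCont_eventually_close: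
  fixes g :: "'a::t2_space \<Rightarrow> real"
  assumes "isCont g m" "0 < \<epsilon>"
  shows "\<forall>\<^sub>F x in nhds m. \<bar>g x - g m\<bar> < \<epsilon>"
proof -
  have "(g \<longlongrightarrow> g m) (nhds m)" using assms(1) by (simp add: isCont_def tendsto_at_iff_tendsto_nhds)
  from tendstoD[OF this assms(2)] show ?thesis by (simp add: dist_real_def)
qed

lemma eventually_mem_open: "open U \<Longrightarrow> m \<in> U \<Longrightarrow> \<forall>\<^sub>F x in nhds m. x \<in> U"
  by (rule eventually_nhds_in_open)

context nci
begin

text \<open>Pullback commutes with differentials, so the Casimir equation for
  \<open>F \<circ> \<phi>\<close> on M says that the class of \<open>dF\<close> in the action bundle
  is zero. On Casimirs of B this is exactness of the Casimir sequence at its middle term.\<close>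

lemma casM_sheaf_iff:
  assumes "open V"
  shows "F \<in> CasM V \<longleftrightarrow> smooth_fun B V F \<and> (\<forall>b\<in>V. dif F b \<in> Ker b)"
proof -
  have *: "dif F b \<in> Ker b \<longleftrightarrow>
      (\<forall>m u. \<phi> m = b \<longrightarrow> smooth_at A m u \<longrightarrow> P m (differential A (F \<circ> \<phi>) m) (differential A u m) = 0)"
    if "smooth_fun B V F" "b \<in> V" for b
    using smooth_atI[OF that(1) assms that(2)]
    by (auto simp: ker_sharpM_iff differential_cotangent act_def pullback_differential)
  show ?thesis
    unfolding casM_sheaf_def M.casimir_iff
    using * smooth_fun_pullback[OF assms] by auto
qed

lemma casM_sheaf_function_sheaf: "function_sheaf (CasM)"
proof
  show "f \<in> CasM V" if "f \<in> CasM U" "open V" "V \<subseteq> U" for f U V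
    using that M.casimir_subset[of "\<phi> -` U" "f \<circ> \<phi>" "\<phi> -` V"]
    unfolding casM_sheaf_def by (auto intro: smooth_fun_subset)
  show "(\<lambda>b. f b - g b) \<in> CasM U" if U: "open U" and "f \<in> CasM U" "g \<in> CasM U" for f g U
  proof -
    have "dif (\<lambda>b. f b - g b) b = (\<lambda>v. dif f b v - dif g b v)" if "b \<in> U" for b
      using that \<open>f \<in> CasM U\<close> \<open>g \<in> CasM U\<close>
      by (intro differential_diff) (auto simp: casM_sheaf_iff[OF U] intro: smooth_atI[OF _ U])
    then show ?thesis
      using that by (simp add: casM_sheaf_iff ker_sharpM_diff smooth_fun_diff)
  qed
  show "(\<lambda>b. 0) \<in> CasM U" if U: "open U" for U
  proof -
    have "dif (\<lambda>b. 0) b = (\<lambda>v. 0)" for b by (auto simp: differential_def tangent_const)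
    then show ?thesis using U by (simp add: casM_sheaf_iff smooth_fun_const ker_sharpM_zero)
  qed
qed

lemma const_subset_casM_sheaf: 
  assumes F: "F \<in> const_sheaf V" and V: "open V"
  shows "F \<in> CasM V"
proof -
  have loc: "\<exists>W. open W \<and> b \<in> W \<and> (\<forall>b'\<in>W. F b' = F b)" if "b \<in> V" for b
    using F that unfolding const_sheaf_def by blast
  have "dif F b = (\<lambda>v. 0)" if "b \<in> V" for b
    using loc[OF that] B.differential_locally_constant by blast
  moreover have "smooth_fun B V F"
    unfolding smooth_fun_def smooth_in_chart_def
  proof (intro ballI)
    fix c b assume c: "c \<in> B" and b: "b \<in> V \<inter> fst c"
    obtain U y where [simp]: "c = (U, y)" by (cases c)
    obtain W where W: "open W" "b \<in> W" "\<forall>b'\<in>W. F b' = F b"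
      using loc[OF IntD1[OF b]] by (elim exE conjE) (rule that)
    have cU: "(U, y) \<in> B" "b \<in> U" using c b by simp_all
    obtain \<rho> where \<rho>: "\<rho> > 0" "\<And>b'. b' \<in> U \<Longrightarrow> dist (y b') (y b) < \<rho> \<Longrightarrow> b' \<in> W"
      by (rule B.chart_nbhd[OF cU(1) W(1) cU(2) W(2)]) (rule that)
    show "\<exists>Q g. open Q \<and> snd c b \<in> Q \<and> Cinf_on Q g \<and>
        (\<forall>m' \<in> V \<inter> fst c. snd c m' \<in> Q \<longrightarrow> F m' = g (snd c m'))"
    proof (intro exI conjI ballI impI)
      show "F b' = (\<lambda>_. F b) (snd c b')" if "b' \<in> V \<inter> fst c" "snd c b' \<in> ball (y b) \<rho>" for b'
        using that by (intro bspec[OF W(3)] \<rho>(2)) (auto simp: dist_commute)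
    qed (use \<rho>(1) in \<open>auto intro: Cinf_on_const\<close>)
  qed
  ultimately show ?thesis using V by (simp add: casM_sheaf_iff ker_sharpM_zero)
qed

text \<open>A bracket on B can be evaluated at any point of the fiber, since \<open>\<phi>\<close>
  is a surjective Poisson map, and there it vanishes.\<close>

lemma casM_sheaf_casimir:
  assumes "open V" and F: "F \<in> CasM V"
  shows "casimir B Q V F"
  unfolding B.casimir_iff
proof (intro conjI ballI allI impI)
  show sF: "smooth_fun B V F" using F unfolding casM_sheaf_def by blast
  fix b g assume b: "b \<in> V" and "smooth_at B b g"
  then obtain W where W: "open W" "b \<in> W" "smooth_fun B W g" unfolding smooth_at_def by blast
  obtain m where m: "\<phi> m = b" using surj by (metis surjD)
  have sg: "smooth_at A m (g \<circ> \<phi>)" using smooth_at_pullback m \<open>smooth_at B b g\<close> by simp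
  have "poisson_bracket A P (F \<circ> \<phi>) (g \<circ> \<phi>) m = poisson_bracket B Q F g (\<phi> m)"
    using poisson_map[unfolded poisson_map_def, THEN conjunct2, rule_format, of "V \<inter> W" F g m]
      assms(1) W sF b m smooth_fun_subset[of B V F "V \<inter> W"] smooth_fun_subset[of B W g "V \<inter> W"] by auto
  moreover have "poisson_bracket A P (F \<circ> \<phi>) (g \<circ> \<phi>) m = 0"
    using F b m sg unfolding casM_sheaf_def M.casimir_iff poisson_bracket_def by auto
  ultimately show "Q b (dif F b) (dif g b) = 0"
    unfolding poisson_bracket_def m by simp
qed

subsection \<open>Lattice bases are linearly independent over the reals\<close>

lemma act_family_isCont:
  assumes "open V" "\<phi> m \<in> V" "smooth_fun B V q" "smooth_at A m u"
  shows "isCont (bracket q u) m"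
proof -
  obtain U where U: "open U" "m \<in> U" "smooth_fun A U u" using assms(4) unfolding smooth_at_def by blast
  have "smooth_fun A (\<phi> -` V \<inter> U) (bracket q u)"
    using smooth_fun_pullback[OF assms(1,3)] U open_preimage[OF assms(1)]
    by (intro M.bracket_smooth) (auto intro: smooth_fun_subset)
  then show ?thesis
    using U assms(2) open_preimage[OF assms(1)]
    by (intro M.smooth_at_isCont smooth_atI[of A "\<phi> -` V \<inter> U"]) auto
qed

text \<open>The function \<open>u\<close> takes the same value at times 0 and 1, so its derivative
  along the orbit is 0 at some time between. At that point each bracket with \<open>u\<close>
  differs from its value at \<open>m\<close> by less than \<open>\<epsilon>\<close>, so the
  combination at \<open>m\<close> is small relative to the coefficients. As \<open>\<delta>\<close>
  is fixed before \<open>e\<close> and \<open>c\<close>, it serves all sufficiently small lattice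
  elements.\<close>

lemma periodic_orbit_estimate:
  assumes V: "open V" "b \<in> V" and J: "finite J" and p: "\<And>j. j \<in> J \<Longrightarrow> smooth_fun B V (p j)"
    and m: "\<phi> m = b" and u: "smooth_at A m u" and \<epsilon>: "\<epsilon> > 0"
  obtains \<delta> where "\<delta> > 0"
    "\<And>e c. \<forall>j\<in>J. \<bar>e j\<bar> \<le> \<delta> \<Longrightarrow>
      closed_orbit b (\<lambda>m w. \<Sum>j\<in>J. e j * act m (dif (p j) b) w) m c \<Longrightarrow>
      \<bar>\<Sum>j\<in>J. e j * act m (dif (p j) b) u\<bar> \<le> \<epsilon> * (\<Sum>j\<in>J. \<bar>e j\<bar>)"
proof -
  define f where "f j w = bracket (p j) w" for j w
  have act: "act m' (dif (p j) b) w = f j w m'" if "j \<in> J" "\<phi> m' = b" for j m' w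
    using act_bracket[of m' "p j" w] smooth_atI[OF p[OF that(1)] V] that(2) by (simp add: f_def)
  have cont: "isCont (f j w) m" if "j \<in> J" "smooth_at A m w" for j w
    unfolding f_def using act_family_isCont[OF V(1) _ p[OF that(1)] that(2)] m V(2) by simp
  obtain U x where c: "(U, x) \<in> A" "m \<in> U" using M.chart_exists .
  obtain U' where U': "open U'" "m \<in> U'" "smooth_fun A U' u" using u unfolding smooth_at_def by blast
  define X where "X i = (\<lambda>m. x m \<bullet> i)" for i
  have X: "smooth_at A m' (X i)" if "m' \<in> U" "i \<in> Basis" for m' i
    unfolding X_def using M.chart_coord_smooth_at[OF c(1) that] .
  \<comment> \<open>Brackets with \<open>u\<close> must vary by less than \<open>\<epsilon>\<close>
    for the final estimate. For those with the coordinates any fixed bound would do; it limits the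
    speed of orbits that are still in \<open>N\<close>.\<close>
  have "\<forall>\<^sub>F m' in nhds m. m' \<in> U \<inter> U' \<and> (\<forall>j\<in>J. \<bar>f j u m' - f j u m\<bar> < \<epsilon>) \<and>
      (\<forall>j\<in>J. \<forall>i\<in>Basis. \<bar>f j (X i) m' - f j (X i) m\<bar> < 1)"
    using M.chart_open[OF c(1)] U'(1,2) c(2) J cont u X \<epsilon>
    by (intro eventually_conj eventually_ball_finite eventually_mem_open isCont_eventually_close ballI) auto
  then obtain N where N: "open N" "m \<in> N"
    and NU: "\<And>m'. m' \<in> N \<Longrightarrow> m' \<in> U \<inter> U'"
    and Nu: "\<And>m' j. m' \<in> N \<Longrightarrow> j \<in> J \<Longrightarrow> \<bar>f j u m' - f j u m\<bar> < \<epsilon>"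
    and NX: "\<And>m' j i. m' \<in> N \<Longrightarrow> j \<in> J \<Longrightarrow> i \<in> Basis \<Longrightarrow> \<bar>f j (X i) m' - f j (X i) m\<bar> < 1"
    unfolding eventually_nhds by blast
  obtain \<delta>0 where \<delta>0: "\<delta>0 > 0"
    and stay: "\<And>c t. smooth_curve A c \<Longrightarrow> c 0 = m \<Longrightarrow>
      (\<And>t i. i \<in> Basis \<Longrightarrow> c t \<in> N \<Longrightarrow> \<bar>velocity A c t (X i)\<bar> \<le> \<delta>0) \<Longrightarrow>
      t \<in> {0..1} \<Longrightarrow> c t \<in> N"
    using M.slow_curve_stays[OF c N] NU unfolding X_def by blast
  \<comment> \<open>The 1 inside each summand absorbs the variation of the brackets over
    \<open>N\<close>. In \<open>\<delta>0 / (C + 1)\<close> the further 1 covers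
    \<open>C = 0\<close>, the case of an empty \<open>J\<close>.\<close>
  define C where "C = (\<Sum>i\<in>Basis. \<Sum>j\<in>J. \<bar>f j (X i) m\<bar> + 1)"
  have C: "C \<ge> 0" unfolding C_def by (intro sum_nonneg) auto
  show ?thesis
  proof (rule that[of "\<delta>0 / (C + 1)"])
    show \<delta>: "\<delta>0 / (C + 1) > 0" using \<delta>0 C by simp
    fix e c assume e': "\<forall>j\<in>J. \<bar>e j\<bar> \<le> \<delta>0 / (C + 1)"
      and orb: "closed_orbit b (\<lambda>m w. \<Sum>j\<in>J. e j * act m (dif (p j) b) w) m c"
    have e: "\<bar>e j\<bar> \<le> \<delta>0 / (C + 1)" if "j \<in> J" for j using e' that by blast
    have cu: "smooth_curve A c" and c01: "c 0 = m" "c 1 = m" and fib: "\<And>t. \<phi> (c t) = b"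
      and vel: "\<And>t w. smooth_at A (c t) w \<Longrightarrow>
        velocity A c t w = (\<Sum>j\<in>J. e j * act (c t) (dif (p j) b) w)"
      using orb unfolding closed_orbit_def by simp_all
    have vel: "velocity A c t w = (\<Sum>j\<in>J. e j * f j w (c t))" if "smooth_at A (c t) w" for t w
      using vel[OF that] act[OF _ fib] by (simp cong: sum.cong)
    have "\<bar>velocity A c t (X i)\<bar> \<le> \<delta>0" if i: "i \<in> Basis" and ct: "c t \<in> N" for t i
    proof -
      have "\<bar>velocity A c t (X i)\<bar> \<le> (\<Sum>j\<in>J. \<bar>e j\<bar> * \<bar>f j (X i) (c t)\<bar>)"
        using vel[OF X[OF _ i]] NU[OF ct] sum_abs[of "\<lambda>j. e j * f j (X i) (c t)" J]
        by (simp add: abs_mult)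
      also have "\<dots> \<le> (\<Sum>j\<in>J. \<delta>0 / (C + 1) * (\<bar>f j (X i) m\<bar> + 1))"
        using e NX[OF ct _ i] \<delta> by (intro sum_mono mult_mono) (force simp: less_imp_le)+
      also have "\<dots> = \<delta>0 / (C + 1) * (\<Sum>j\<in>J. \<bar>f j (X i) m\<bar> + 1)" by (simp add: sum_distrib_left)
      also have "\<dots> \<le> \<delta>0 / (C + 1) * C"
        unfolding C_def[symmetric]
        by (intro mult_left_mono) (use \<delta> i in \<open>auto simp: C_def intro!: member_le_sum sum_nonneg\<close>)
      also have "\<dots> \<le> \<delta>0" using \<delta>0 C by (simp add: field_simps)
      finally show ?thesis .
    qed
    then have inN: "c t \<in> N" if "t \<in> {0..1}" for t using stay[OF cu c01(1) _ that] by blast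
    have "\<exists>z>0. z < 1 \<and> u (c 1) - u (c 0) = (1 - 0) * velocity A c z u"
    proof (rule MVT2)
      fix t :: real assume "0 \<le> t" "t \<le> 1"
      then have "c t \<in> U'" using inN[of t] NU by auto
      then show "((\<lambda>t. u (c t)) has_real_derivative velocity A c t u) (at t)"
        using smooth_atI[OF U'(3,1)] smooth_curve_has_derivative[OF cu] by blast
    qed simp
    then obtain z where z: "0 < z" "z < 1" "velocity A c z u = 0" using c01 by auto
    have cz: "c z \<in> N" using inN z by simp
    then have "(\<Sum>j\<in>J. e j * f j u (c z)) = 0"
      using vel[of z u] smooth_atI[OF U'(3,1)] NU z(3) by auto
    then have "\<bar>\<Sum>j\<in>J. e j * f j u m\<bar> = \<bar>\<Sum>j\<in>J. e j * (f j u m - f j u (c z))\<bar>"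
      by (simp add: right_diff_distrib sum_subtractf)
    also have "\<dots> \<le> (\<Sum>j\<in>J. \<bar>e j\<bar> * \<bar>f j u m - f j u (c z)\<bar>)"
      using sum_abs[of "\<lambda>j. e j * (f j u m - f j u (c z))" J] by (simp add: abs_mult)
    also have "\<dots> \<le> (\<Sum>j\<in>J. \<bar>e j\<bar> * \<epsilon>)"
      using Nu[OF cz] by (intro sum_mono mult_left_mono) (auto simp: abs_minus_commute less_imp_le)
    finally show "\<bar>\<Sum>j\<in>J. e j * act m (dif (p j) b) u\<bar> \<le> \<epsilon> * (\<Sum>j\<in>J. \<bar>e j\<bar>)"
      using act[OF _ m] by (simp add: sum_distrib_left mult.commute cong: sum.cong)
  qed
qed

text \<open>Injectivity of integral combinations excludes integral relations only. Given a real one,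
  take a maximal independent subfamily \<open>J\<close> and a relation with coefficient 1 at one
  further index \<open>i1\<close>. Multiplying it by an integer \<open>q\<close> and rounding
  produces a lattice element whose class is a small combination over \<open>J\<close>. The orbit
  estimates force its coefficients to be exactly 0, so the rounded numbers form an integral
  relation, and its entry at \<open>i1\<close> is \<open>q > 0\<close>.\<close>

lemma lattice_real_independent:
  assumes V: "open V" "b \<in> V" and p: "\<And>j. j < r \<Longrightarrow> smooth_fun B V (p j)"
    and basis: "lattice_basis S r b (\<lambda>i. cls b (dif (p i) b))"
    and a: "(\<lambda>v. \<Sum>i<r. a i * dif (p i) b v) \<in> Ker b"
  shows "\<forall>i<r. a i = 0"
proof (rule ccontr)
  assume a0: "\<not> (\<forall>i<r. a i = 0)"
  define \<xi> where "\<xi> i = dif (p i) b" for i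
  define rel where "rel c \<longleftrightarrow> (\<lambda>v. \<Sum>i<r. c i * \<xi> i v) \<in> Ker b" for c :: "nat \<Rightarrow> real"
  have \<xi>: "\<xi> i \<in> cotangent_space B b" for i unfolding \<xi>_def by (rule differential_cotangent)
  have rel_scale: "rel (\<lambda>i. s * c i)" if "rel c" for s c
    using ker_sharpM_lincomb[OF that[unfolded rel_def] ker_sharpM_zero, of s 0]
    unfolding rel_def by (simp add: sum_distrib_left mult.assoc)
  have rel_cong: "rel c" if "rel d" "\<And>i. i < r \<Longrightarrow> c i = d i" for c d
    using that unfolding rel_def by simp
  define indep where "indep J \<longleftrightarrow> J \<subseteq> {..<r} \<and> (\<forall>c. (\<forall>i. i \<notin> J \<longrightarrow> c i = 0) \<longrightarrow> rel c \<longrightarrow> (\<forall>i\<in>J. c i = 0))" for J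
  have "indep {}" unfolding indep_def by simp
  moreover have "\<forall>J. indep J \<longrightarrow> card J < Suc r"
    unfolding indep_def using card_mono[OF finite_lessThan, of _ r] by (auto simp: less_Suc_eq_le)
  ultimately obtain J where J: "indep J" and max: "\<And>J'. indep J' \<Longrightarrow> card J' \<le> card J"
    using ex_has_greatest_nat[of indep "{}" card "Suc r"] by blast
  have Jr: "J \<subseteq> {..<r}" and finJ: "finite J" using J unfolding indep_def by (auto intro: finite_subset)
  have "J \<noteq> {..<r}"
  proof
    assume eq: "J = {..<r}"
    let ?a = "\<lambda>i. if i < r then a i else 0"
    have "rel ?a" by (rule rel_cong[of a]) (use a in \<open>auto simp: rel_def \<xi>_def\<close>)
    moreover have "(\<forall>i. i \<notin> J \<longrightarrow> ?a i = 0) \<longrightarrow> rel ?a \<longrightarrow> (\<forall>i\<in>J. ?a i = 0)"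
      using J[unfolded indep_def, THEN conjunct2] by (rule spec)
    ultimately have "\<forall>i\<in>J. ?a i = 0" using eq by simp
    then show False using a0 eq by auto
  qed
  then obtain i1 where i1: "i1 < r" "i1 \<notin> J" using Jr by auto
  have "\<exists>c. (\<forall>i. i \<notin> insert i1 J \<longrightarrow> c i = 0) \<and> rel c \<and> (\<exists>i\<in>insert i1 J. c i \<noteq> 0)"
  proof (rule ccontr)
    assume "\<not> ?thesis"
    then have "\<forall>i\<in>insert i1 J. c i = 0" if "\<forall>i. i \<notin> insert i1 J \<longrightarrow> c i = 0" "rel c" for c
      using that by meson
    then have "indep (insert i1 J)" unfolding indep_def using Jr i1(1) by simp
    from max[OF this] show False using i1(2) finJ by simp
  qed
  then obtain c where c': "\<forall>i. i \<notin> insert i1 J \<longrightarrow> c i = 0" "rel c" "\<exists>i\<in>insert i1 J. c i \<noteq> 0"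
    by (elim exE conjE) (rule that)
  then have c: "\<And>i. i \<notin> insert i1 J \<Longrightarrow> c i = 0" "rel c" "\<exists>i\<in>insert i1 J. c i \<noteq> 0" by simp_all
  have "c i1 \<noteq> 0"
  proof
    assume z: "c i1 = 0"
    then have "\<forall>i. i \<notin> J \<longrightarrow> c i = 0" using c(1) by (metis insertE)
    then have "\<forall>i\<in>J. c i = 0" using J c(2) unfolding indep_def by blast
    then show False using c(3) z by auto
  qed
  define d where "d i = c i / c i1" for i
  have "d = (\<lambda>i. 1 / c i1 * c i)" by (simp add: d_def fun_eq_iff)
  then have d: "rel d" "d i1 = 1" "\<And>i. i \<notin> insert i1 J \<Longrightarrow> d i = 0"
    using rel_scale[OF c(2), of "1 / c i1"] c(1) \<open>c i1 \<noteq> 0\<close> by (simp_all add: d_def)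
  \<comment> \<open>A test is a point of the fiber with a function smooth near it. By
    \<open>ker_sharpM_iff\<close>, a combination is zero in \<open>E_b\<close> exactly when it
    vanishes in all tests, so independence of \<open>J\<close> is the hypothesis of
    \<open>coercive_tests\<close>.\<close>
  define T where "T = {(m, u). \<phi> m = b \<and> smooth_at A m u}"
  define X where "X j = (\<lambda>(m, u). act m (\<xi> j) u)" for j
  have "\<forall>j\<in>J. c j = 0" if z: "\<forall>p\<in>T. (\<Sum>j\<in>J. c j * X j p) = 0" for c
  proof -
    let ?c = "\<lambda>i. if i \<in> J then c i else 0"
    have sum_J: "(\<Sum>i<r. ?c i * g i) = (\<Sum>j\<in>J. c j * g j)" for g :: "nat \<Rightarrow> real"
      using Jr by (intro sum.mono_neutral_cong_right) auto
    have "rel ?c"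
      unfolding rel_def ker_sharpM_iff
    proof (intro conjI allI impI)
      show "(\<lambda>v. \<Sum>i<r. ?c i * \<xi> i v) \<in> cotangent_space B b" by (rule cotangent_sum) (rule \<xi>)
      fix m u assume mu: "\<phi> m = b" "smooth_at A m u"
      have "act m (\<lambda>v. \<Sum>i<r. ?c i * \<xi> i v) u = (\<Sum>i<r. ?c i * act m (\<xi> i) u)"
        by (rule act_sum) (use \<xi> mu(1) in auto)
      also have "\<dots> = (\<Sum>j\<in>J. c j * X j (m, u))" unfolding sum_J by (simp add: X_def)
      also have "\<dots> = 0" using z mu by (auto simp: T_def)
      finally show "act m (\<lambda>v. \<Sum>i<r. ?c i * \<xi> i v) u = 0" .
    qed
    moreover have "(\<forall>i. i \<notin> J \<longrightarrow> ?c i = 0) \<longrightarrow> rel ?c \<longrightarrow> (\<forall>i\<in>J. ?c i = 0)"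
      using J[unfolded indep_def, THEN conjunct2] by (rule spec)
    ultimately show ?thesis by simp
  qed
  from coercive_tests[of J T X, OF finJ this] obtain F K where F: "finite F" "F \<subseteq> T" and K: "K > 0"
    "\<And>c. (\<Sum>j\<in>J. \<bar>c j\<bar>) \<le> K * (\<Sum>p\<in>F. \<bar>\<Sum>j\<in>J. c j * X j p\<bar>)" by blast
  \<comment> \<open>Summed over the tests in \<open>F\<close>, the relative errors are multiplied by
    \<open>K * card F\<close>; the choice makes the product at most 1/2. The summand 1 covers an
    empty \<open>F\<close>.\<close>
  define \<epsilon> where "\<epsilon> = 1 / (2 * K * (card F + 1))"
  have \<epsilon>: "\<epsilon> > 0" unfolding \<epsilon>_def using K(1) by simp
  define est where "est q \<delta> \<longleftrightarrow> (\<forall>e c. (\<forall>j\<in>J. \<bar>e j\<bar> \<le> \<delta>) \<longrightarrow>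
      closed_orbit b (\<lambda>m w. \<Sum>j\<in>J. e j * act m (\<xi> j) w) (fst q) c \<longrightarrow>
      \<bar>\<Sum>j\<in>J. e j * X j q\<bar> \<le> \<epsilon> * (\<Sum>j\<in>J. \<bar>e j\<bar>))" for q \<delta>
  have "\<exists>\<delta>>0. est q \<delta>" if "q \<in> F" for q
  proof -
    obtain m u where q: "q = (m, u)" by (cases q)
    have mu: "\<phi> m = b" "smooth_at A m u" using that F(2) q unfolding T_def by auto
    have pJ: "smooth_fun B V (p j)" if "j \<in> J" for j using p that Jr by blast
    show ?thesis
      by (rule periodic_orbit_estimate[OF V finJ pJ mu \<epsilon>]) (auto simp: est_def q X_def \<xi>_def)
  qed
  then have "\<forall>q\<in>F. \<exists>\<delta>>0. est q \<delta>" by blast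
  from bchoice[OF this] obtain \<delta> where \<delta>: "\<And>q. q \<in> F \<Longrightarrow> \<delta> q > 0" and est: "\<And>q. q \<in> F \<Longrightarrow> est q (\<delta> q)"
    by blast
  \<comment> \<open>One bound for all tests; the inserted 1 makes the minimum meaningful when
    \<open>F\<close> is empty.\<close>
  define \<delta>' where "\<delta>' = Min (insert 1 (\<delta> ` F))"
  have \<delta>': "\<delta>' > 0" "\<And>q. q \<in> F \<Longrightarrow> \<delta>' \<le> \<delta> q"
    unfolding \<delta>'_def using F(1) \<delta> by (auto simp: Min_gr_iff)
  obtain N :: nat where N: "N > 0" "1 / N < \<delta>'"
    using reals_Archimedean[OF \<delta>'(1)] by (metis inverse_eq_divide of_nat_0_less_iff zero_less_Suc of_nat_Suc)
  obtain q k' where q: "0 < q" "\<And>i. i < r \<Longrightarrow> \<bar>of_int q * d i - of_int (k' i)\<bar> < 1 / N"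
    using Dirichlet_approx_simult[OF N(1), of r d] by metis
  \<comment> \<open>The relation \<open>d\<close> is 1 at \<open>i1\<close> and 0 outside
    \<open>insert i1 J\<close>, so there \<open>q * d\<close> is already integral. Hence the
    rounding errors \<open>e\<close> live on \<open>J\<close> only.\<close>
  define k where "k i = (if i = i1 then q else if i \<in> J then k' i else 0)" for i
  define e where "e i = of_int (k i) - of_int q * d i" for i
  have e0: "e i = 0" if "i \<notin> J" for i
    using that d(2,3) by (auto simp: e_def k_def)
  have eJ: "\<bar>e i\<bar> \<le> \<delta>'" if "i \<in> J" for i
    using q(2)[of i] that Jr i1(2) N(2) by (auto simp: e_def k_def abs_minus_commute)
  have relqd: "rel (\<lambda>i. of_int q * d i)" using rel_scale[OF d(1)] .
  let ?K = "{k :: nat \<Rightarrow> int. \<forall>i\<ge>r. k i = 0}"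
  have kK: "k \<in> ?K" "(\<lambda>_. 0) \<in> ?K" using i1(1) Jr by (auto simp: k_def)
  have bij: "bij_betw (\<lambda>k. cls b (\<lambda>v. \<Sum>i<r. of_int (k i) * \<xi> i v)) ?K (action_lattice S b)"
    using basis unfolding lattice_basis_def \<xi>_def[symmetric] int_combination_class by blast
  have lat: "cls b (\<lambda>v. \<Sum>i<r. of_int (k i) * \<xi> i v) \<in> action_lattice S b"
    using bij kK(1) by (auto simp: bij_betw_def)
  have k\<xi>: "(\<lambda>v. \<Sum>i<r. of_int (k i) * \<xi> i v) \<in> cotangent_space B b" by (rule cotangent_sum) (rule \<xi>)
  \<comment> \<open>The relation multiplied by \<open>q\<close> contributes nothing to the action
    field, so only the rounding errors remain.\<close>
  have act_k: "act m (\<lambda>v. \<Sum>i<r. of_int (k i) * \<xi> i v) u = (\<Sum>j\<in>J. e j * act m (\<xi> j) u)"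
    if "\<phi> m = b" "smooth_at A m u" for m u
  proof -
    have "act m (\<lambda>v. \<Sum>i<r. (of_int q * d i) * \<xi> i v) u = 0"
      using relqd that unfolding rel_def ker_sharpM_iff by blast
    moreover have "act m (\<lambda>v. \<Sum>i<r. g i * \<xi> i v) u = (\<Sum>i<r. g i * act m (\<xi> i) u)" for g :: "nat \<Rightarrow> real"
      by (rule act_sum) (use \<xi> that(1) in auto)
    ultimately have "act m (\<lambda>v. \<Sum>i<r. of_int (k i) * \<xi> i v) u = (\<Sum>i<r. e i * act m (\<xi> i) u)"
      by (simp add: e_def left_diff_distrib sum_subtractf)
    also have "\<dots> = (\<Sum>j\<in>J. e j * act m (\<xi> j) u)"
      using Jr e0 by (intro sum.mono_neutral_right) auto
    finally show ?thesis .
  qed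
  have bound: "\<bar>\<Sum>j\<in>J. e j * X j q\<bar> \<le> \<epsilon> * (\<Sum>j\<in>J. \<bar>e j\<bar>)" if q: "q \<in> F" for q
  proof -
    have "\<phi> (fst q) = b" using F(2) q unfolding T_def by auto
    then obtain c where "closed_orbit b (\<lambda>m. act m (\<lambda>v. \<Sum>i<r. of_int (k i) * \<xi> i v)) (fst q) c"
      using lattice_orbit[OF lat k\<xi>] by blast
    then have "closed_orbit b (\<lambda>m w. \<Sum>j\<in>J. e j * act m (\<xi> j) w) (fst q) c"
      unfolding closed_orbit_def using act_k by simp
    moreover have "\<forall>j\<in>J. \<bar>e j\<bar> \<le> \<delta> q" using eJ \<delta>'(2)[OF q] by force
    ultimately show ?thesis using est[OF q] unfolding est_def by blast
  qed
  define s where "s = (\<Sum>j\<in>J. \<bar>e j\<bar>)"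
  have "s \<le> K * (\<Sum>q\<in>F. \<bar>\<Sum>j\<in>J. e j * X j q\<bar>)" unfolding s_def by (rule K(2))
  also have "\<dots> \<le> K * (\<Sum>q\<in>F. \<epsilon> * s)"
    using bound K(1) unfolding s_def by (intro mult_left_mono sum_mono) auto
  also have "\<dots> = s * (K * card F * \<epsilon>)" by simp
  also have "\<dots> \<le> s * (1 / 2)"
  proof (rule mult_left_mono)
    have "K * card F * \<epsilon> = card F / (2 * (card F + 1))" using K(1) by (simp add: \<epsilon>_def)
    also have "\<dots> \<le> 1 / 2" by (simp add: field_simps)
    finally show "K * card F * \<epsilon> \<le> 1 / 2" .
    show "0 \<le> s" unfolding s_def by (intro sum_nonneg) auto
  qed
  finally have "s \<le> 0" by simp
  moreover have "s \<ge> 0" unfolding s_def by (intro sum_nonneg) auto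
  ultimately have "(\<Sum>j\<in>J. \<bar>e j\<bar>) = 0" unfolding s_def by linarith
  then have "\<forall>j\<in>J. e j = 0" using sum_nonneg_eq_0_iff[OF finJ, of "\<lambda>j. \<bar>e j\<bar>"] by simp
  then have "e i = 0" for i using e0 by blast
  \<comment> \<open>Without rounding errors the integers \<open>k\<close> equal the multiple
    \<open>q * d\<close> of the relation, and injectivity of the integral combinations applies to
    them.\<close>
  then have "rel (\<lambda>i. of_int (k i))" using rel_cong[OF relqd, of "\<lambda>i. of_int (k i)"] by (simp add: e_def)
  then have "cls b (\<lambda>v. \<Sum>i<r. of_int (k i) * \<xi> i v) =
      cls b (\<lambda>v. \<Sum>i<r. of_int ((\<lambda>_. 0) i) * \<xi> i v)"
    unfolding action_class_eq_iff rel_def by simp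
  then have "k = (\<lambda>_. 0)" using bij kK by (auto simp: bij_betw_def inj_on_def)
  then show False using q(1) by (auto simp: k_def fun_eq_iff split: if_splits)
qed

end

text \<open>In a chart each differential is the inner product with a vector of the model subspace
  \<open>V\<close>, and \<open>dim V = n\<close> bounds the number of independent vectors
  there.\<close>

lemma (in mfd) independent_differentials_le_dim:
  assumes f: "\<And>j. j < r \<Longrightarrow> smooth_at A m (f j)"
    and ind: "\<And>a :: nat \<Rightarrow> real. (\<lambda>v. \<Sum>j<r. a j * differential A (f j) m v) = (\<lambda>v. 0) \<Longrightarrow> \<forall>j<r. a j = 0"
  shows "r \<le> n"
proof -
  obtain U x where c: "(U, x) \<in> A" "m \<in> U" using chart_exists .
  obtain V where V: "subspace V" "dim V = n" "openin (top_of_set V) (x ` U)" by (rule chartE[OF c(1)])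
  have "\<exists>u\<in>V. \<forall>v\<in>tangent_space A m. v (f j) = u \<bullet> chart_vec x v" if j: "j < r" for j
  proof -
    obtain \<rho> g where \<rho>: "\<rho> > 0" and g: "Cinf_on (ball (x m) \<rho>) g"
      "\<And>m'. m' \<in> U \<Longrightarrow> x m' \<in> ball (x m) \<rho> \<Longrightarrow> f j m' = g (x m')"
      by (rule smooth_at_local_rep[OF f[OF j] c]) (rule that)
    define h where "h = (\<Sum>i\<in>Basis. \<partial> g (x m) i *\<^sub>R i)"
    have lin: "linear (\<partial> g (x m))"
      using has_derivative_linear[OF Cinf_on_has_derivative[OF g(1), of "x m"]] \<rho> by simp
    have h: "\<partial> g (x m) w = h \<bullet> w" for w
      unfolding linear_real_expand[OF lin, of w] h_def inner_sum_left
      by (intro sum.cong) (simp_all add: inner_commute mult.commute)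
    obtain u z where u: "u \<in> span V" "\<And>w. w \<in> span V \<Longrightarrow> orthogonal z w" "h = u + z"
      using orthogonal_subspace_decomp_exists[of V h] by blast
    have "v (f j) = u \<bullet> chart_vec x v" if v: "v \<in> tangent_space A m" for v
    proof -
      have "chart_vec x v \<in> span V" using chart_vec_in_subspace[OF c v V(1,3)] span_base by blast
      then have "z \<bullet> chart_vec x v = 0" using u(2) by (simp add: orthogonal_def)
      then show ?thesis using tangent_chart[OF c v \<rho> g] u(3) by (simp add: h inner_add_left)
    qed
    then show ?thesis using u(1) V(1) by (metis span_eq_iff)
  qed
  then have "\<forall>j\<in>{..<r}. \<exists>u. u \<in> V \<and> (\<forall>v\<in>tangent_space A m. v (f j) = u \<bullet> chart_vec x v)" by blast
  from bchoice[OF this] obtain u where uV: "\<And>j. j < r \<Longrightarrow> u j \<in> V"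
    and u: "\<And>j v. j < r \<Longrightarrow> v \<in> tangent_space A m \<Longrightarrow> v (f j) = u j \<bullet> chart_vec x v" by blast
  have zero: "\<forall>j<r. a j = 0" if "(\<Sum>j<r. a j *\<^sub>R u j) = 0" for a :: "nat \<Rightarrow> real"
  proof (rule ind)
    have "(\<Sum>j<r. a j * v (f j)) = 0" if v: "v \<in> tangent_space A m" for v
    proof -
      have "(\<Sum>j<r. a j * v (f j)) = (\<Sum>j<r. a j *\<^sub>R u j) \<bullet> chart_vec x v"
        using u[OF _ v] by (simp add: inner_sum_left)
      then show ?thesis using \<open>(\<Sum>j<r. a j *\<^sub>R u j) = 0\<close> by simp
    qed
    then have "(\<Sum>j<r. a j * differential A (f j) m v) = 0" for v
      by (cases "v \<in> tangent_space A m") (simp_all add: differential_def)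
    then show "(\<lambda>v. \<Sum>j<r. a j * differential A (f j) m v) = (\<lambda>v. 0)" by blast
  qed
  have inj: "inj_on u {..<r}"
  proof (rule inj_onI, rule ccontr)
    fix i j assume ij: "i \<in> {..<r}" "j \<in> {..<r}" "u i = u j" "i \<noteq> j"
    let ?a = "\<lambda>k. if k = i then 1 else if k = j then -1 else (0::real)"
    have "(\<Sum>k<r. ?a k *\<^sub>R u k) = (\<Sum>k\<in>{i, j}. ?a k *\<^sub>R u k)"
      using ij by (intro sum.mono_neutral_right) auto
    also have "\<dots> = 0" using ij(3,4) by simp
    finally have "\<forall>k<r. ?a k = 0" by (rule zero)
    then show False using ij(1) by auto
  qed
  have "independent (u ` {..<r})"
  proof (rule independent_if_scalars_zero)
    fix s y assume s: "(\<Sum>y\<in>u ` {..<r}. s y *\<^sub>R y) = 0" and y: "y \<in> u ` {..<r}"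
    then have "(\<Sum>j<r. s (u j) *\<^sub>R u j) = 0" by (simp add: sum.reindex[OF inj] comp_def)
    then show "s y = 0" using zero[of "\<lambda>j. s (u j)"] y by auto
  qed simp
  then have "card (u ` {..<r}) \<le> dim V"
    using independent_card_le_dim[of "u ` {..<r}" V] uV by auto
  then show ?thesis using card_image[OF inj] V(2) by simp
qed

text \<open>\<open>foliation\<close> counts the defining functions as \<open>n - k\<close>. With
  \<open>k = n - r\<close> this truncated difference is \<open>r\<close> only if
  \<open>r \<le> n\<close>, which the independence of the differentials supplies.\<close>

lemma (in mfd) common_kernel_foliation:
  assumes loc: "\<And>m. \<exists>U y. open U \<and> m \<in> U \<and> (\<forall>j<r. smooth_fun A U (y j)) \<and>
      (\<forall>m'\<in>U. \<forall>a :: nat \<Rightarrow> real. (\<lambda>v. \<Sum>j<r. a j * differential A (y j) m' v) = (\<lambda>v. 0) \<longrightarrow> (\<forall>j<r. a j = 0)) \<and>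
      (\<forall>m'\<in>U. F m' = {v \<in> tangent_space A m'. \<forall>j<r. differential A (y j) m' v = 0})"
  shows "foliation n (n - r) A F"
proof -
  \<comment> \<open>\<open>undefined\<close> serves as some point of the manifold, which is a type
    and therefore not empty.\<close>
  obtain U y where U: "open U" "undefined \<in> U" "\<forall>j<r. smooth_fun A U (y j)"
    and ind: "\<forall>m'\<in>U. \<forall>a :: nat \<Rightarrow> real.
      (\<lambda>v. \<Sum>j<r. a j * differential A (y j) m' v) = (\<lambda>v. 0) \<longrightarrow> (\<forall>j<r. a j = 0)"
    using loc[of undefined] by (elim exE conjE) (rule that)
  have "r \<le> n"
  proof (rule independent_differentials_le_dim)
    show "smooth_at A undefined (y j)" if "j < r" for j
      using smooth_atI[OF _ U(1,2)] U(3) that by blast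
    show "\<forall>j<r. a j = 0" if "(\<lambda>v. \<Sum>j<r. a j * differential A (y j) undefined v) = (\<lambda>v. 0)" for a
      using bspec[OF ind U(2), THEN spec[of _ a]] that by (rule mp)
  qed
  then have "n - (n - r) = r" by simp
  then show ?thesis unfolding foliation_def using loc by simp
qed

context nci
begin

subsection \<open>Integral coefficients are locally constant\<close>

text \<open>In a chart of B the form is a combination of coordinate differentials with smooth
  coefficients, so the expression becomes a sum of products of pulled back functions and Poisson
  brackets.\<close>

lemma act_form_isCont:
  assumes W: "open W" "\<phi> m \<in> W" and \<omega>: "smooth_form B W \<omega>" and u: "smooth_at A m u"
  shows "isCont (\<lambda>m'. act m' (\<omega> (\<phi> m')) u) m"
proof -
  obtain U y where c: "(U, y) \<in> B" "\<phi> m \<in> U" using B.chart_exists .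
  obtain a where a: "\<And>i. i \<in> Basis \<Longrightarrow> smooth_fun B (W \<inter> U) (a i)"
    "\<And>b. b \<in> W \<inter> U \<Longrightarrow> \<omega> b = (\<lambda>v. \<Sum>i\<in>Basis. a i b * dif (\<lambda>b. y b \<bullet> i) b v)"
    using bspec[OF \<omega>[unfolded smooth_form_def, THEN conjunct2] c(1)] by auto
  have o: "open (W \<inter> U)" "\<phi> m \<in> W \<inter> U" using W B.chart_open[OF c(1)] c(2) by auto
  have sy: "smooth_fun B U (\<lambda>b. y b \<bullet> i)" if "i \<in> Basis" for i
    using B.chart_coord_smooth[OF c(1) that] .
  let ?g = "\<lambda>m'. \<Sum>i\<in>Basis. a i (\<phi> m') * poisson_bracket A P ((\<lambda>b. y b \<bullet> i) \<circ> \<phi>) u m'"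
  have "isCont ?g m"
  proof (intro continuous_sum continuous_mult)
    fix i :: 'f assume i: "i \<in> Basis"
    show "isCont (\<lambda>m'. a i (\<phi> m')) m"
      using M.smooth_at_isCont[OF smooth_at_pullback[OF smooth_atI[OF a(1)[OF i] o]]] by (simp add: comp_def)
    show "isCont (poisson_bracket A P ((\<lambda>b. y b \<bullet> i) \<circ> \<phi>) u) m"
      using act_family_isCont[OF B.chart_open[OF c(1)] c(2) sy[OF i] u] .
  qed
  moreover have "\<forall>\<^sub>F m' in nhds m. ?g m' = act m' (\<omega> (\<phi> m')) u"
    unfolding eventually_nhds
  proof (intro exI[of _ "\<phi> -` (W \<inter> U)"] conjI ballI)
    fix m' assume "m' \<in> \<phi> -` (W \<inter> U)"
    then have m': "\<phi> m' \<in> W \<inter> U" by simp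
    have "act m' (\<omega> (\<phi> m')) u = (\<Sum>i\<in>Basis. a i (\<phi> m') * act m' (dif (\<lambda>b. y b \<bullet> i) (\<phi> m')) u)"
      unfolding a(2)[OF m'] by (rule act_sum) (rule differential_cotangent)
    also have "\<dots> = ?g m'"
      using smooth_atI[OF sy B.chart_open[OF c(1)]] m' by (intro sum.cong refl) (simp add: act_bracket)
    finally show "?g m' = act m' (\<omega> (\<phi> m')) u" by simp
  qed (use o(2) open_preimage[OF o(1)] in simp_all)
  ultimately show ?thesis using isCont_cong[of ?g "\<lambda>m'. act m' (\<omega> (\<phi> m')) u" m] by simp
qed

text \<open>The coefficients \<open>\<kappa> b'\<close> come from the lattice basis of each fiber
  separately. A smooth form representing \<open>s\<close> makes the corresponding action field
  continuous on M, which forces \<open>\<kappa> b'\<close> to nearly agree with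
  \<open>\<kappa> b\<close> in finitely many tests; integrality turns this into equality.\<close>

lemma locally_integral_combination:
  assumes s: "lattice_section S UNIV s" and V: "open V" "b \<in> V" and av: "action_variables S r V p"
  obtains W k where "open W" "b \<in> W" "W \<subseteq> V"
    "\<And>b'. b' \<in> W \<Longrightarrow> s b' = cls b' (\<lambda>v. \<Sum>i<r. of_int (k i) * dif (p i) b' v)"
proof -
  have p: "smooth_fun B V (p i)" if "i < r" for i
    using av that unfolding action_variables_def B.casimir_iff by blast
  have basis: "lattice_basis S r b' (\<lambda>i. cls b' (dif (p i) b'))" if "b' \<in> V" for b'
    using av that unfolding action_variables_def lattice_trivialization_def by blast
  have dcot: "dif (p i) b' \<in> cotangent_space B b'" for i b' by (rule differential_cotangent)
  have "\<forall>b'\<in>V. \<exists>k. s b' = cls b' (\<lambda>v. \<Sum>i<r. of_int (k i) * dif (p i) b' v)"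
  proof
    fix b' assume b': "b' \<in> V"
    have "s b' \<in> action_lattice S b'" using s unfolding lattice_section_def by blast
    then have "s b' \<in> int_combination S r b' (\<lambda>i. cls b' (dif (p i) b')) ` {k. \<forall>i\<ge>r. k i = 0}"
      using basis[OF b'] unfolding lattice_basis_def bij_betw_def by simp
    then obtain k where "s b' = int_combination S r b' (\<lambda>i. cls b' (dif (p i) b')) k"
      by (rule imageE)
    then show "\<exists>k. s b' = cls b' (\<lambda>v. \<Sum>i<r. of_int (k i) * dif (p i) b' v)"
      unfolding int_combination_class by (rule exI[of _ k])
  qed
  from bchoice[OF this] obtain \<kappa> where
    \<kappa>': "\<forall>b'\<in>V. s b' = cls b' (\<lambda>v. \<Sum>i<r. of_int (\<kappa> b' i) * dif (p i) b' v)" ..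
  note \<kappa> = bspec[OF \<kappa>']
  have "action_section S UNIV s" using s unfolding lattice_section_def by (rule conjunct1)
  from bspec[OF this[unfolded action_section_def] UNIV_I, of b] obtain W0 \<omega>
    where W0: "open W0" "b \<in> W0" and \<omega>1: "smooth_form B W0 \<omega>"
      and \<omega>2: "\<forall>b'\<in>W0. \<omega> b' \<in> ker_sharpB S b' \<and> s b' = cls b' (\<omega> b')"
    by (elim exE conjE) (rule that)
  have \<omega>: "smooth_form B W0 \<omega>" "\<And>b'. b' \<in> W0 \<Longrightarrow> s b' = cls b' (\<omega> b')"
    using \<omega>1 bspec[OF \<omega>2] by blast+
  have \<omega>cot: "\<omega> b' \<in> cotangent_space B b'" if "b' \<in> W0" for b'
    using \<omega>(1) that unfolding smooth_form_def by blast
  define k where "k = \<kappa> b"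
  \<comment> \<open>The form minus the combination with coefficients frozen at \<open>b\<close>: it
    is continuous in \<open>m'\<close> and vanishes on the fiber over \<open>b\<close>. Over other
    points it measures the difference of \<open>\<kappa>\<close> and \<open>k\<close>.\<close>
  define h where "h m' u = act m' (\<omega> (\<phi> m')) u - (\<Sum>i<r. of_int (k i) * bracket (p i) u m')" for m' u
  have act: "act m' (dif (p i) (\<phi> m')) u = bracket (p i) u m'"
    if "\<phi> m' \<in> V" "i < r" for m' i u
    using act_bracket smooth_atI[OF p[OF that(2)] V(1) that(1)] by blast
  have h: "h m' u = (\<Sum>i<r. of_int (\<kappa> (\<phi> m') i - k i) * bracket (p i) u m')"
    if m': "\<phi> m' \<in> V \<inter> W0" and u: "smooth_at A m' u" for m' u
  proof -
    let ?\<eta> = "\<lambda>v. \<Sum>i<r. of_int (\<kappa> (\<phi> m') i) * dif (p i) (\<phi> m') v"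
    have "(\<lambda>v. \<omega> (\<phi> m') v - ?\<eta> v) \<in> Ker (\<phi> m')"
      using \<kappa>[of "\<phi> m'"] \<omega>(2)[of "\<phi> m'"] m' unfolding action_class_eq_iff[symmetric] by simp
    then have "act m' (\<lambda>v. \<omega> (\<phi> m') v - ?\<eta> v) u = 0" using u unfolding ker_sharpM_iff by blast
    moreover have "act m' (\<lambda>v. \<omega> (\<phi> m') v - ?\<eta> v) u = act m' (\<omega> (\<phi> m')) u - act m' ?\<eta> u"
      using m' by (intro act_diff \<omega>cot cotangent_sum dcot) auto
    moreover have "act m' ?\<eta> u = (\<Sum>i<r. of_int (\<kappa> (\<phi> m') i) * bracket (p i) u m')"
      using act_sum[of "{..<r}" "\<lambda>i. dif (p i) (\<phi> m')" m'] dcot act m' by simp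
    ultimately show ?thesis unfolding h_def by (simp add: sum_subtractf[symmetric] left_diff_distrib)
  qed
  define T where "T = {(m, u). \<phi> m = b \<and> smooth_at A m u}"
  define X where "X i = (\<lambda>(m, u). bracket (p i) u m)" for i
  have "\<forall>j\<in>{..<r}. c j = 0" if z: "\<forall>q\<in>T. (\<Sum>j<r. c j * X j q) = 0" for c
  proof -
    have "(\<lambda>v. \<Sum>i<r. c i * dif (p i) b v) \<in> Ker b"
      unfolding ker_sharpM_iff
    proof (intro conjI allI impI)
      show "(\<lambda>v. \<Sum>i<r. c i * dif (p i) b v) \<in> cotangent_space B b"
        by (rule cotangent_sum) (rule dcot)
      fix m u assume mu: "\<phi> m = b" "smooth_at A m u"
      have "act m (\<lambda>v. \<Sum>i<r. c i * dif (p i) b v) u = (\<Sum>j<r. c j * X j (m, u))"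
        using act_sum[of "{..<r}" "\<lambda>i. dif (p i) b" m] dcot act[of m] mu(1) V(2) by (simp add: X_def)
      then show "act m (\<lambda>v. \<Sum>i<r. c i * dif (p i) b v) u = 0" using z mu by (auto simp: T_def)
    qed
    from lattice_real_independent[OF V p basis[OF V(2)] this] show ?thesis by blast
  qed
  from coercive_tests[of "{..<r}" T X, OF finite_lessThan this]
  obtain F K where F: "finite F" "F \<subseteq> T" and K: "K > 0"
    "\<And>c. (\<Sum>j<r. \<bar>c j\<bar>) \<le> K * (\<Sum>q\<in>F. \<bar>\<Sum>j<r. c j * X j q\<bar>)" by blast
  \<comment> \<open>Two errors of size \<open>\<epsilon> * s\<close> will be added, from the
    brackets and from \<open>h\<close>; with the factor 4 the bound for \<open>s\<close> is still
    \<open>s / 2\<close>.\<close>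
  define \<epsilon> where "\<epsilon> = 1 / (4 * K * (card F + 1))"
  have \<epsilon>: "\<epsilon> > 0" unfolding \<epsilon>_def using K(1) by simp
  \<comment> \<open>\<open>y\<close> stands for the brackets at some point over \<open>b'\<close>
    close to the point of the test \<open>q\<close>. Keeping only these values turns a statement
    about M into one about \<open>b'\<close>.\<close>
  define near where "near b' q \<longleftrightarrow> (\<exists>y. (\<forall>i<r. \<bar>y i - X i q\<bar> < \<epsilon>) \<and>
      \<bar>\<Sum>i<r. of_int (\<kappa> b' i - k i) * y i\<bar> < \<epsilon>)" for b' q
  have "\<exists>W. open W \<and> b \<in> W \<and> (\<forall>b'\<in>W \<inter> V. near b' q)" if q: "q \<in> F" for q
  proof -
    obtain m u where qe: "q = (m, u)" by (cases q)
    have m: "\<phi> m = b" and u: "smooth_at A m u" using q qe F(2) unfolding T_def by auto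
    obtain U where U: "open U" "m \<in> U" "smooth_fun A U u" using u unfolding smooth_at_def by blast
    have "h m u = 0" using h[of m u] m u V(2) W0(2) by (simp add: k_def)
    moreover have cX: "isCont (bracket (p i) u) m" if "i < r" for i
      using act_family_isCont[OF V(1) _ p[OF that] u] m V(2) by simp
    then have "isCont (\<lambda>m'. h m' u) m"
      unfolding h_def using act_form_isCont[OF W0(1) _ \<omega>(1) u] m W0(2)
      by (intro continuous_diff continuous_sum continuous_mult continuous_const) auto
    ultimately have ev1: "\<forall>\<^sub>F m' in nhds m. \<bar>h m' u\<bar> < \<epsilon>"
      using isCont_eventually_close[OF _ \<epsilon>] by fastforce
    have ev2: "\<forall>\<^sub>F m' in nhds m. \<forall>i\<in>{..<r}. \<bar>bracket (p i) u m' - X i q\<bar> < \<epsilon>"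
      using isCont_eventually_close[OF cX \<epsilon>] by (intro eventually_ball_finite) (auto simp: X_def qe)
    have "m \<in> U \<inter> \<phi> -` W0" using U(2) m W0(2) by simp
    with U(1) open_preimage[OF W0(1)] have ev3: "\<forall>\<^sub>F m' in nhds m. m' \<in> U \<inter> \<phi> -` W0"
      by (intro eventually_mem_open open_Int)
    obtain N where N: "open N" "m \<in> N"
      and N_near: "\<And>m'. m' \<in> N \<Longrightarrow> \<bar>h m' u\<bar> < \<epsilon> \<and> m' \<in> U \<inter> \<phi> -` W0 \<and>
        (\<forall>i\<in>{..<r}. \<bar>bracket (p i) u m' - X i q\<bar> < \<epsilon>)"
      using eventually_conj[OF ev1 eventually_conj[OF ev3 ev2]] unfolding eventually_nhds by blast
    \<comment> \<open>Openness of \<open>\<phi>\<close>: every \<open>b'\<close> in \<open>W\<close>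
      has a point of its fiber in \<open>N\<close>, so the estimates on \<open>N\<close> reach all
      of \<open>W\<close>.\<close>
    obtain W where W: "open W" "\<phi> m \<in> W" "W \<subseteq> \<phi> ` N"
      by (rule submersion_open_map[OF M.smooth_mfd B.smooth_mfd sub N]) (rule that)
    show ?thesis
    proof (intro exI[of _ W] conjI ballI)
      fix b' assume b': "b' \<in> W \<inter> V"
      then obtain m' where m': "m' \<in> N" "\<phi> m' = b'" using W(3) by blast
      have "h m' u = (\<Sum>i<r. of_int (\<kappa> b' i - k i) * bracket (p i) u m')"
        using h[of m' u] N_near[OF m'(1)] b' m'(2) smooth_atI[OF U(3,1), of m'] by auto
      then show "near b' q"
        using N_near[OF m'(1)] unfolding near_def
        by (intro exI[of _ "\<lambda>i. bracket (p i) u m'"]) auto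
    qed (use W(1,2) m in auto)
  qed
  then have "\<forall>q\<in>F. \<exists>W. open W \<and> b \<in> W \<and> (\<forall>b'\<in>W \<inter> V. near b' q)" by blast
  from bchoice[OF this] obtain WF where WF: "\<And>q. q \<in> F \<Longrightarrow> open (WF q) \<and> b \<in> WF q"
    and near: "\<And>q b'. q \<in> F \<Longrightarrow> b' \<in> WF q \<inter> V \<Longrightarrow> near b' q" by blast
  define W where "W = V \<inter> (\<Inter>q\<in>F. WF q)"
  have "open W" unfolding W_def using V(1) F(1) WF by (intro open_Int open_INT ballI) blast+
  moreover have "b \<in> W" "W \<subseteq> V" unfolding W_def using V(2) WF by blast+
  ultimately have W: "open W" "b \<in> W" "W \<subseteq> V" .
  have same: "\<forall>i<r. \<kappa> b' i = k i" if b': "b' \<in> W" for b'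
  proof (rule ccontr)
    assume ne: "\<not> (\<forall>i<r. \<kappa> b' i = k i)"
    define e where "e i = real_of_int (\<kappa> b' i - k i)" for i
    define s where "s = (\<Sum>i<r. \<bar>e i\<bar>)"
    obtain i0 where i0: "i0 < r" "\<kappa> b' i0 \<noteq> k i0" using ne by blast
    \<comment> \<open>A nonzero integral difference has size at least 1, so the absolute error
      \<open>\<epsilon>\<close> in \<open>near\<close> is at most the relative error
      \<open>\<epsilon> * s\<close>.\<close>
    have "1 \<le> \<bar>e i0\<bar>" using i0(2) unfolding e_def by linarith
    also have "\<dots> \<le> s" unfolding s_def using i0(1) by (intro member_le_sum) auto
    finally have s1: "1 \<le> s" .
    have bound: "\<bar>\<Sum>i<r. e i * X i q\<bar> \<le> 2 * \<epsilon> * s" if q: "q \<in> F" for q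
    proof -
      obtain y where y: "\<forall>i<r. \<bar>y i - X i q\<bar> < \<epsilon>" "\<bar>\<Sum>i<r. e i * y i\<bar> < \<epsilon>"
        using near[OF q, of b'] b' q unfolding W_def e_def near_def by auto
      have "\<bar>\<Sum>i<r. e i * (y i - X i q)\<bar> \<le> (\<Sum>i<r. \<bar>e i\<bar> * \<bar>y i - X i q\<bar>)"
        using sum_abs[of "\<lambda>i. e i * (y i - X i q)"] by (simp add: abs_mult)
      also have "\<dots> \<le> (\<Sum>i<r. \<bar>e i\<bar> * \<epsilon>)"
        using y(1) by (intro sum_mono mult_left_mono) (auto simp: less_imp_le)
      also have "\<dots> = \<epsilon> * s" unfolding s_def by (simp add: sum_distrib_left mult.commute)
      finally have 1: "\<bar>\<Sum>i<r. e i * (y i - X i q)\<bar> \<le> \<epsilon> * s" .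
      have 2: "\<epsilon> \<le> \<epsilon> * s" using s1 \<epsilon> by simp
      have "(\<Sum>i<r. e i * X i q) = (\<Sum>i<r. e i * y i) - (\<Sum>i<r. e i * (y i - X i q))"
        by (simp add: right_diff_distrib sum_subtractf)
      then have "\<bar>\<Sum>i<r. e i * X i q\<bar> \<le> \<epsilon> * s + \<epsilon> * s" using 1 2 y(2) by linarith
      then show ?thesis by simp
    qed
    have "s \<le> K * (\<Sum>q\<in>F. \<bar>\<Sum>j<r. e j * X j q\<bar>)" unfolding s_def by (rule K(2))
    also have "\<dots> \<le> K * (\<Sum>q\<in>F. 2 * \<epsilon> * s)"
      using bound K(1) by (intro mult_left_mono sum_mono) auto
    also have "\<dots> = s * (2 * K * card F * \<epsilon>)" by simp
    also have "\<dots> \<le> s * (1 / 2)"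
    proof (rule mult_left_mono)
      have "2 * K * card F * \<epsilon> = card F / (2 * (card F + 1))"
      proof -
        have "2 * K * n * (1 / (4 * K * l)) = n / (2 * l)" if "l > 0" for n l :: real
          using K(1) that by (simp add: field_simps)
        from this[of "card F + 1" "card F"] show ?thesis by (simp add: \<epsilon>_def)
      qed
      also have "\<dots> \<le> 1 / 2" by (simp add: field_simps)
      finally show "2 * K * card F * \<epsilon> \<le> 1 / 2" .
      show "0 \<le> s" using s1 by simp
    qed
    finally show False using s1 by simp
  qed
  have "s b' = cls b' (\<lambda>v. \<Sum>i<r. of_int (k i) * dif (p i) b' v)" if b': "b' \<in> W" for b'
    using \<kappa>[of b'] same[OF b'] W(3) b' by auto
  with W show ?thesis using that by blast
qed

subsection \<open>Lifts to Casimirs\<close>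

text \<open>The data from which \<open>Obs\<close> forms its cocycles, isolated so that different
  lifts of the same section can be compared.\<close>

definition lift :: "('b \<Rightarrow> 'b covec set) \<Rightarrow> 'b set set \<Rightarrow> ('b set \<Rightarrow> 'b \<Rightarrow> real) \<Rightarrow> bool" where
  "lift s C g \<longleftrightarrow> open_cover C \<and> (\<forall>U\<in>C. g U \<in> cas_sheaf S U \<and>
     (\<forall>b\<in>U. s b = cls b (dif (g U) b)))"

text \<open>Equal classes mean that the differentials differ by an element of \<open>Ker b\<close>.
  \<open>W\<close> is tied to the intersection by an equation so that the lemma also fits a member
  of a refinement that equals one.\<close>

lemma lift_diff:
  assumes "open U" "open V" "W = U \<inter> V" and f: "casimir B Q U f" and g: "casimir B Q V g"
    and "\<And>b. b \<in> U \<Longrightarrow> s b = cls b (dif f b)"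
    and "\<And>b. b \<in> V \<Longrightarrow> s b = cls b (dif g b)"
  shows "(\<lambda>b. g b - f b) \<in> CasM W"
proof -
  have W: "open W" unfolding assms(3) using assms(1,2) by (rule open_Int)
  have sm: "smooth_fun B U f" "smooth_fun B V g" using f g by (simp_all add: B.casimir_iff)
  have "dif (\<lambda>b. g b - f b) b \<in> Ker b" if b: "b \<in> W" for b
  proof -
    have bUV: "b \<in> U" "b \<in> V" using b assms(3) by auto
    have "dif (\<lambda>b. g b - f b) b = (\<lambda>v. dif g b v - dif f b v)"
      using smooth_atI[OF sm(1) assms(1) bUV(1)] smooth_atI[OF sm(2) assms(2) bUV(2)]
      by (simp add: differential_diff)
    moreover have "cls b (dif g b) = cls b (dif f b)"
      using assms(6)[OF bUV(1)] assms(7)[OF bUV(2)] by simp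
    ultimately show ?thesis unfolding action_class_eq_iff by simp
  qed
  moreover have "smooth_fun B W (\<lambda>b. g b - f b)"
    using sm assms(3) by (intro smooth_fun_diff) (auto intro: smooth_fun_subset)
  ultimately show ?thesis using W by (simp add: casM_sheaf_iff)
qed

lemma liftD:
  assumes "lift s C g" "U \<in> C"
  shows "open U" "casimir B Q U (g U)" "\<And>b. b \<in> U \<Longrightarrow> s b = cls b (dif (g U) b)"
  using assms unfolding lift_def open_cover_def cas_sheaf_def by auto

lemma lift_cocycle:
  assumes "lift s C g" shows "(C, \<lambda>U V b. g V b - g U b) \<in> cocycles (CasM)"
  unfolding cocycles_def
proof (clarify, intro conjI ballI)
  show "open_cover C" using assms unfolding lift_def by blast
  show "(\<lambda>b. g V b - g U b) \<in> CasM (U \<inter> V)" if "U \<in> C" "V \<in> C" for U V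
    by (rule lift_diff[OF liftD(1)[OF assms that(1)] liftD(1)[OF assms that(2)] refl
          liftD(2)[OF assms that(1)] liftD(2)[OF assms that(2)]])
       (rule liftD(3)[OF assms that(1)] liftD(3)[OF assms that(2)]; assumption)+
qed simp

lemma lifts_cohomologous:
  assumes "lift s C g" "lift s C' g'"
  shows "((C, \<lambda>U V b. g V b - g U b), (C', \<lambda>U V b. g' V b - g' U b)) \<in> cohomologous (CasM)"
proof -
  have "open_cover C" "open_cover C'" using assms unfolding lift_def by blast+
  then obtain E \<alpha> \<beta> where E: "open_cover E" "\<And>U. U \<in> E \<Longrightarrow> \<alpha> U \<in> C \<and> \<beta> U \<in> C' \<and> U = \<alpha> U \<inter> \<beta> U"
    by (rule common_refinement) (rule that)
  show ?thesis
  proof (rule cohomologousI[where E = E and \<tau> = \<alpha> and \<tau>' = \<beta> and h = "\<lambda>U b. g (\<alpha> U) b - g' (\<beta> U) b"])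
    fix U assume U: "U \<in> E"
    have a: "\<alpha> U \<in> C" and b: "\<beta> U \<in> C'" and eq: "U = \<beta> U \<inter> \<alpha> U" using E(2)[OF U] by auto
    have "(\<lambda>b. g (\<alpha> U) b - g' (\<beta> U) b) \<in> CasM U"
      by (rule lift_diff[OF liftD(1)[OF assms(2) b] liftD(1)[OF assms(1) a] eq
            liftD(2)[OF assms(2) b] liftD(2)[OF assms(1) a]])
         (rule liftD(3)[OF assms(2) b] liftD(3)[OF assms(1) a]; assumption)+
    then show "\<alpha> U \<in> C \<and> U \<subseteq> \<alpha> U \<and> \<beta> U \<in> C' \<and> U \<subseteq> \<beta> U \<and> (\<lambda>b. g (\<alpha> U) b - g' (\<beta> U) b) \<in> CasM U"
      using a b eq by blast
  qed (use lift_cocycle assms E(1) in auto)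
qed

text \<open>The connecting homomorphism is well defined: any two lifts have cohomologous cocycles,
  so a single one determines \<open>Obs\<close>.\<close>

lemma Obs_lift:
  assumes "lift s C g"
  shows "Obs S s = cohomologous (CasM) `` {(C, \<lambda>U V b. g V b - g U b)}"
proof -
  interpret function_sheaf "CasM" by (rule casM_sheaf_function_sheaf)
  have Obs: "Obs S s = cohomologous (CasM) `` {(C, \<lambda>U V b. g V b - g U b) | C g. lift s C g}"
    unfolding Obs_def lift_def ..
  show ?thesis
  proof (intro equalityI subsetI)
    fix x assume "x \<in> Obs S s"
    then obtain C' g' where "lift s C' g'" "((C', \<lambda>U V b. g' V b - g' U b), x) \<in> cohomologous (CasM)"
      unfolding Obs by blast
    then show "x \<in> cohomologous (CasM) `` {(C, \<lambda>U V b. g V b - g U b)}"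
      using cohomologous_class_eq[OF lifts_cohomologous[OF assms]] by blast
  next
    fix x assume "x \<in> cohomologous (CasM) `` {(C, \<lambda>U V b. g V b - g U b)}"
    then show "x \<in> Obs S s" unfolding Obs using assms by blast
  qed
qed

text \<open>A coboundary relating the cocycle of a lift to a constant cocycle consists of elements
  of \<open>CasM\<close>. Subtracting them from the lift leaves its classes unchanged and makes its
  differences locally constant. Conversely, such differences are themselves a cocycle of
  constants.\<close>

lemma representable_iff_lift:
  "representable_by_constants S (Obs S s) \<longleftrightarrow>
    (\<exists>C g. lift s C g \<and> (\<forall>U\<in>C. \<forall>V\<in>C. (\<lambda>b. g V b - g U b) \<in> const_sheaf (U \<inter> V)))"
proof -
  interpret function_sheaf "CasM" by (rule casM_sheaf_function_sheaf)
  interpret const: function_sheaf "const_sheaf :: 'b fsheaf" by (rule const_sheaf_function_sheaf)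
  have incl: "H1_inclusion (CasM) (cohomologous const_sheaf `` {(C, z)}) =
      cohomologous (CasM) `` {(C, z)}" "(C, z) \<in> cocycles (CasM)"
    if "(C, z) \<in> cocycles const_sheaf" for C z
    using H1_inclusion_class[OF const_sheaf_function_sheaf _ that] const_subset_casM_sheaf by blast+
  show ?thesis
  proof
    assume "representable_by_constants S (Obs S s)"
    then obtain k where "k \<in> H1 const_sheaf" and Obs: "Obs S s = H1_inclusion (CasM) k"
      unfolding representable_by_constants_def by blast
    then obtain C0 z0 where c0: "(C0, z0) \<in> cocycles const_sheaf" and k: "k = cohomologous const_sheaf `` {(C0, z0)}"
      unfolding H1_def quotient_def by auto
    \<comment> \<open>Membership of the constant cocycle shows in particular that \<open>Obs\<close>
      is not empty, so a lift exists.\<close>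
    have "(C0, z0) \<in> Obs S s"
      unfolding Obs k incl(1)[OF c0] using cohomologous_refl[OF incl(2)[OF c0]] by blast
    then obtain C g where lift: "lift s C g"
      and coh: "((C, \<lambda>U V b. g V b - g U b), (C0, z0)) \<in> cohomologous (CasM)"
      unfolding Obs_def lift_def by blast
    obtain E \<tau> \<tau>' h where "cobounds CasM C (\<lambda>U V b. g V b - g U b) C0 z0 E \<tau> \<tau>' h"
      by (rule cohomologousD[OF coh])
    note E = coboundsD[OF this]
    \<comment> \<open>By the coboundary equation the differences of the corrected lift are exactly
      those of \<open>z0\<close>.\<close>
    define q where "q U = (\<lambda>b. g (\<tau> U) b - h U b)" for U
    have oE: "open U" if "U \<in> E" for U using E(1) that unfolding open_cover_def by blast
    have "casimir B Q U (q U) \<and> (\<forall>b\<in>U. s b = cls b (dif (q U) b))" if U: "U \<in> E" for U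
    proof (intro conjI ballI)
      have \<tau>: "\<tau> U \<in> C" "U \<subseteq> \<tau> U" and hU: "h U \<in> CasM U" using E(2)[OF U] by auto
      have gc: "casimir B Q U (g (\<tau> U))" using B.casimir_subset[OF liftD(2)[OF lift \<tau>(1)] \<tau>(2)] .
      show "casimir B Q U (q U)"
        unfolding q_def by (rule B.casimir_diff[OF gc casM_sheaf_casimir[OF oE[OF U] hU] oE[OF U]])
      fix b assume b: "b \<in> U"
      have "smooth_at B b (g (\<tau> U))" "smooth_at B b (h U)"
        using gc hU b smooth_atI[OF _ oE[OF U] b] unfolding B.casimir_iff casM_sheaf_def by blast+
      then have "dif (q U) b = (\<lambda>v. dif (g (\<tau> U)) b v - dif (h U) b v)"
        unfolding q_def by (rule differential_diff)
      moreover have "dif (h U) b \<in> Ker b"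
        using hU b oE[OF U] by (simp add: casM_sheaf_iff)
      ultimately have "cls b (dif (g (\<tau> U)) b) = cls b (dif (q U) b)"
        unfolding action_class_eq_iff by simp
      then show "s b = cls b (dif (q U) b)"
        using liftD(3)[OF lift \<tau>(1)] b \<tau>(2) by auto
    qed
    then have "lift s E q" unfolding lift_def cas_sheaf_def using E(1) by blast
    moreover have "(\<lambda>b. q V b - q U b) \<in> const_sheaf (U \<inter> V)" if UV: "U \<in> E" "V \<in> E" for U V
    proof -
      have "z0 (\<tau>' U) (\<tau>' V) \<in> const_sheaf (U \<inter> V)"
        using const.restrict[OF cocyclesD(2)[OF c0], of "\<tau>' U" "\<tau>' V" "U \<inter> V"] E(2) UV oE by blast
      moreover have "z0 (\<tau>' U) (\<tau>' V) b = q V b - q U b" if "b \<in> U \<inter> V" for b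
        using E(3)[OF UV, of b] that by (simp add: q_def)
      ultimately show ?thesis by (rule const_sheaf_cong)
    qed
    ultimately show "\<exists>C g. lift s C g \<and> (\<forall>U\<in>C. \<forall>V\<in>C. (\<lambda>b. g V b - g U b) \<in> const_sheaf (U \<inter> V))" by blast
  next
    assume "\<exists>C g. lift s C g \<and> (\<forall>U\<in>C. \<forall>V\<in>C. (\<lambda>b. g V b - g U b) \<in> const_sheaf (U \<inter> V))"
    then obtain C g where lift: "lift s C g" and "\<forall>U\<in>C. \<forall>V\<in>C. (\<lambda>b. g V b - g U b) \<in> const_sheaf (U \<inter> V)"
      by blast
    then have c: "(C, \<lambda>U V b. g V b - g U b) \<in> cocycles const_sheaf"
      unfolding cocycles_def using lift by (auto simp: lift_def)
    then have "cohomologous const_sheaf `` {(C, \<lambda>U V b. g V b - g U b)} \<in> H1 const_sheaf"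
      unfolding H1_def by (rule quotientI)
    then show "representable_by_constants S (Obs S s)"
      unfolding representable_by_constants_def Obs_lift[OF lift] incl(1)[OF c, symmetric] by (rule imageI)
  qed
qed

text \<open>The condition on \<open>\<AA>\<close> in \<open>good\<close> is what fixes the
  differential of a lift: adding an element of \<open>CasM\<close> keeps the class in the action
  bundle but need not keep the vanishing on \<open>\<AA>\<close>.\<close>

lemma representable_if_action_foliation:
  assumes fol: "action_foliation S dB r \<AA>" and s: "lattice_section S UNIV s"
  shows "representable_by_constants S (Obs S s)"
proof -
  have local: "\<exists>V p. open V \<and> b \<in> V \<and> action_variables S r V p \<and>
      (\<forall>b'\<in>V. \<AA> b' = {v \<in> tangent_space B b'. \<forall>i<r. dif (p i) b' v = 0})" for b
    using fol unfolding action_foliation_def by blast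
  define good where "good U q \<longleftrightarrow> open U \<and> casimir B Q U q \<and>
      (\<forall>b\<in>U. s b = cls b (dif q b)) \<and>
      (\<forall>b\<in>U. \<forall>v\<in>\<AA> b. dif q b v = 0)" for U q
  \<comment> \<open>Cochains are indexed by the members of the cover, so the cover consists of all
    open sets that carry a good Casimir, and one such Casimir is chosen per set.\<close>
  define C where "C = {U. \<exists>q. good U q}"
  define g where "g U = (SOME q. good U q)" for U
  have good: "good U (g U)" if "U \<in> C" for U
    using that someI_ex[of "good U"] unfolding C_def g_def by blast
  have gsmooth: "smooth_at B b (g U)" if "U \<in> C" "b \<in> U" for U b
    using good[OF that(1)] that(2) smooth_atI unfolding good_def B.casimir_iff by blast
  have "\<exists>U\<in>C. b \<in> U" for b
  proof -
    obtain V p where V: "open V" "b \<in> V" and av: "action_variables S r V p"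
      and \<AA>: "\<forall>b'\<in>V. \<AA> b' = {v \<in> tangent_space B b'. \<forall>i<r. dif (p i) b' v = 0}"
      using local[of b] by (elim exE conjE) (rule that)
    have cas: "casimir B Q V (p i)" if "i < r" for i
      using av that unfolding action_variables_def by blast
    obtain W k where W: "open W" "b \<in> W" "W \<subseteq> V" and sW:
      "\<And>b'. b' \<in> W \<Longrightarrow> s b' = cls b' (\<lambda>v. \<Sum>i<r. of_int (k i) * dif (p i) b' v)"
      by (rule locally_integral_combination[OF s V av]) (rule that)
    let ?q = "\<lambda>b. \<Sum>i<r. of_int (k i) * p i b"
    have d: "dif ?q b' = (\<lambda>v. \<Sum>i<r. of_int (k i) * dif (p i) b' v)" if "b' \<in> W" for b'
    proof (rule differential_sum)
      show "smooth_at B b' (p i)" if "i \<in> {..<r}" for i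
        using cas[of i] that \<open>b' \<in> W\<close> W(3) by (auto simp: B.casimir_iff intro: smooth_atI[OF _ V(1)])
    qed
    have "casimir B Q W ?q"
      using cas B.casimir_subset[OF _ W(3)] by (intro B.casimir_sum W(1)) auto
    moreover have "dif ?q b' v = 0" if "b' \<in> W" "v \<in> \<AA> b'" for b' v
      using that \<AA> W(3) by (auto simp: d intro!: sum.neutral)
    ultimately have "good W ?q" unfolding good_def using W(1) sW d by simp
    then show ?thesis unfolding C_def using W(2) by blast
  qed
  then have cover: "open_cover C"
    unfolding open_cover_def using good unfolding good_def by blast
  have lift: "lift s C g"
    unfolding lift_def cas_sheaf_def using cover good unfolding good_def by blast
  have "(\<lambda>b. g V b - g U b) \<in> const_sheaf (U \<inter> V)" if UV: "U \<in> C" "V \<in> C" for U V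
  proof -
    let ?f = "\<lambda>b. g V b - g U b"
    have f: "?f \<in> CasM (U \<inter> V)" using cocyclesD(2)[OF lift_cocycle[OF lift] UV] .
    have o: "open (U \<inter> V)" using good[OF UV(1)] good[OF UV(2)] unfolding good_def by blast
    have "dif ?f b = (\<lambda>v. 0)" if b: "b \<in> U \<inter> V" for b
    proof -
      obtain W p where W: "open W" "b \<in> W" and av: "action_variables S r W p"
        and \<AA>: "\<forall>b'\<in>W. \<AA> b' = {v \<in> tangent_space B b'. \<forall>i<r. dif (p i) b' v = 0}"
        using local[of b] by (elim exE conjE) (rule that)
      have fK: "dif ?f b \<in> Ker b" using f b o by (simp add: casM_sheaf_iff)
      have df: "dif ?f b v = dif (g V) b v - dif (g U) b v" for v
        using differential_diff[OF gsmooth[OF UV(2)] gsmooth[OF UV(1)]] b by simp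
      \<comment> \<open>The difference annihilates \<open>\<AA> b\<close>, which is the common
        kernel of the \<open>dp j\<close>, and is therefore a combination of them; its class is zero
        because it comes from \<open>CasM\<close>.\<close>
      have "\<exists>c. \<forall>v\<in>tangent_space B b. dif ?f b v = (\<Sum>j<r. c j * dif (p j) b v)"
      proof (rule annihilator_span)
        show "(\<lambda>u. c * v u + d * w u) \<in> tangent_space B b"
          if "v \<in> tangent_space B b" "w \<in> tangent_space B b" for v w c d
          using that by (rule tangent_lincomb)
        show "dif (p j) b (\<lambda>u. c * v u + d * w u) = c * dif (p j) b v + d * dif (p j) b w"
          if "v \<in> tangent_space B b" "w \<in> tangent_space B b" for j v w c d
          using covec_linear[OF differential_cotangent that] .
        show "dif ?f b (\<lambda>u. c * v u + d * w u) = c * dif ?f b v + d * dif ?f b w"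
          if "v \<in> tangent_space B b" "w \<in> tangent_space B b" for v w c d
          using covec_linear[OF differential_cotangent that] .
        show "dif ?f b v = 0"
          if "v \<in> tangent_space B b" "\<forall>j<r. dif (p j) b v = 0" for v
        proof -
          have "v \<in> \<AA> b" using that \<AA> W(2) by blast
          then have "dif (g V) b v = 0" "dif (g U) b v = 0"
            using good[OF UV(1)] good[OF UV(2)] b unfolding good_def by blast+
          then show ?thesis unfolding df by simp
        qed
      qed
      then obtain c where c: "\<forall>v\<in>tangent_space B b. dif ?f b v = (\<Sum>j<r. c j * dif (p j) b v)" ..
      have eq: "dif ?f b = (\<lambda>v. \<Sum>j<r. c j * dif (p j) b v)"
      proof
        fix v
        show "dif ?f b v = (\<Sum>j<r. c j * dif (p j) b v)"
          using c by (cases "v \<in> tangent_space B b") (simp_all add: differential_def)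
      qed
      have "\<forall>j<r. c j = 0"
      proof (rule lattice_real_independent[OF W])
        show "smooth_fun B W (p j)" if "j < r" for j
          using av that unfolding action_variables_def B.casimir_iff by blast
        show "lattice_basis S r b (\<lambda>i. cls b (dif (p i) b))"
          using av W(2) unfolding action_variables_def lattice_trivialization_def by blast
        show "(\<lambda>v. \<Sum>i<r. c i * dif (p i) b v) \<in> Ker b" using fK unfolding eq .
      qed
      then show ?thesis unfolding eq by simp
    qed
    moreover have "smooth_fun B (U \<inter> V) ?f" using f unfolding casM_sheaf_def by blast
    ultimately show ?thesis
      unfolding const_sheaf_def
    proof (intro CollectI ballI)
      fix b assume sm: "smooth_fun B (U \<inter> V) ?f" and b: "b \<in> U \<inter> V"
        and d: "\<And>b. b \<in> U \<inter> V \<Longrightarrow> dif ?f b = (\<lambda>v. 0)"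
      obtain W where "open W" "b \<in> W" "W \<subseteq> U \<inter> V" "\<And>b'. b' \<in> W \<Longrightarrow> ?f b' = ?f b"
        by (rule B.differential_zero_locally_constant[OF sm o d b]) (assumption, rule that)
      then show "\<exists>W. open W \<and> b \<in> W \<and> W \<subseteq> U \<inter> V \<and> (\<forall>b'\<in>W. ?f b' = ?f b)"
        by (intro exI[of _ W] conjI ballI)
    qed
  qed
  then show ?thesis unfolding representable_iff_lift using lift by blast
qed

text \<open>\<open>int_combination\<close> sums over \<open>i < r\<close> only, so the values of the
  family at other indices do not enter.\<close>

lemma lattice_basis_cong:
  "lattice_basis S r b \<alpha> \<Longrightarrow> (\<And>i. i < r \<Longrightarrow> \<alpha> i = \<beta> i) \<Longrightarrow> lattice_basis S r b \<beta>"
  unfolding lattice_basis_def int_combination_def[abs_def] by simp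

text \<open>Locally constant differences leave the differentials of the lifts independent of the
  member of the cover, so their common kernel is defined on all of B. The lifts themselves are local
  action variables, because their classes are the given \<open>l i\<close>.\<close>

lemma action_foliation_if_representable:
  assumes triv: "lattice_trivialization S r UNIV l"
    and rep: "\<And>i. i < r \<Longrightarrow> representable_by_constants S (Obs S (l i))"
  shows "\<exists>\<AA>. action_foliation S dB r \<AA>"
proof -
  have "\<forall>i\<in>{..<r}. \<exists>C g. lift (l i) C g \<and> (\<forall>U\<in>C. \<forall>V\<in>C. (\<lambda>b. g V b - g U b) \<in> const_sheaf (U \<inter> V))"
    using rep unfolding representable_iff_lift by blast
  from bchoice[OF this] obtain C where
    "\<forall>i\<in>{..<r}. \<exists>g. lift (l i) (C i) g \<and> (\<forall>U\<in>C i. \<forall>V\<in>C i. (\<lambda>b. g V b - g U b) \<in> const_sheaf (U \<inter> V))" ..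
  from bchoice[OF this] obtain g where lift: "\<And>i. i < r \<Longrightarrow> lift (l i) (C i) (g i)"
    and const: "\<And>i U V. i < r \<Longrightarrow> U \<in> C i \<Longrightarrow> V \<in> C i \<Longrightarrow> (\<lambda>b. g i V b - g i U b) \<in> const_sheaf (U \<inter> V)"
    by blast
  have sm: "smooth_at B b (g i U)" if "i < r" "U \<in> C i" "b \<in> U" for i U b
    using liftD(1,2)[OF lift[OF that(1)] that(2)] that(3) by (auto simp: B.casimir_iff intro: smooth_atI)
  have same: "dif (g i U) b = dif (g i V) b"
    if i: "i < r" and UV: "U \<in> C i" "V \<in> C i" "b \<in> U" "b \<in> V" for i U V b
  proof -
    obtain W where W: "open W" "b \<in> W" "\<forall>b'\<in>W. g i V b' - g i U b' = g i V b - g i U b"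
      using const[OF i UV(1,2)] UV(3,4) unfolding const_sheaf_def by blast
    have "dif (\<lambda>b. g i V b - g i U b) b = (\<lambda>v. 0)"
      by (rule B.differential_locally_constant[OF W(1,2)]) (rule bspec[OF W(3)])
    moreover have "dif (\<lambda>b. g i V b - g i U b) b =
        (\<lambda>v. dif (g i V) b v - dif (g i U) b v)"
      by (rule differential_diff[OF sm[OF i UV(2,4)] sm[OF i UV(1,3)]])
    ultimately show ?thesis by (auto simp: fun_eq_iff)
  qed
  \<comment> \<open>Quantifying over all members that contain \<open>b\<close> avoids a choice; by
    \<open>same\<close> each of them imposes the same condition.\<close>
  define \<AA> where "\<AA> b = {v \<in> tangent_space B b. \<forall>i<r. \<forall>U\<in>C i. b \<in> U \<longrightarrow> dif (g i U) b v = 0}" for b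
  have local: "\<exists>W p. open W \<and> b \<in> W \<and> action_variables S r W p \<and>
      (\<forall>b'\<in>W. \<AA> b' = {v \<in> tangent_space B b'. \<forall>i<r. dif (p i) b' v = 0})" for b
  proof -
    have "\<forall>i\<in>{..<r}. \<exists>U. U \<in> C i \<and> b \<in> U"
      using lift unfolding lift_def open_cover_def by (metis UNIV_I Union_iff lessThan_iff)
    from bchoice[OF this] obtain U where U: "\<And>i. i < r \<Longrightarrow> U i \<in> C i \<and> b \<in> U i" by blast
    define p where "p i = g i (U i)" for i
    define W where "W = (\<Inter>i\<in>{..<r}. U i)"
    have oW: "open W"
      unfolding W_def using liftD(1)[OF lift] U by (intro open_INT) auto
    have bW: "b \<in> W" unfolding W_def using U by blast
    have WU: "b' \<in> U i" if "b' \<in> W" "i < r" for b' i using that unfolding W_def by blast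
    have cas: "casimir B Q W (p i)" if i: "i < r" for i
      unfolding p_def
      by (rule B.casimir_subset[OF liftD(2)[OF lift[OF i]]]) (use U[OF i] WU i in blast)+
    have cls: "l i b' = cls b' (dif (p i) b')" if "i < r" "b' \<in> W" for i b'
      unfolding p_def using liftD(3)[OF lift[OF that(1)]] U[OF that(1)] WU[OF that(2,1)] by blast
    have "lattice_trivialization S r W (\<lambda>i b. cls b (dif (p i) b))"
      unfolding lattice_trivialization_def
    proof (intro conjI allI impI ballI)
      fix i assume i: "i < r"
      have li: "lattice_section S UNIV (l i)" using triv i unfolding lattice_trivialization_def by blast
      show "lattice_section S W (\<lambda>b. cls b (dif (p i) b))"
        unfolding lattice_section_def action_section_def
      proof (intro conjI ballI)
        fix b' assume b': "b' \<in> W"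
        show "cls b' (dif (p i) b') \<in> action_lattice S b'"
          using li cls[OF i b'] unfolding lattice_section_def by (metis UNIV_I)
        \<comment> \<open>The form that represents \<open>l i\<close> also represents the class of
          \<open>dp i\<close>, as the two classes agree on \<open>W\<close>; it only has to be
          restricted to a neighborhood inside \<open>W\<close>.\<close>
        have "action_section S UNIV (l i)" using li unfolding lattice_section_def by (rule conjunct1)
        from bspec[OF this[unfolded action_section_def] UNIV_I, of b'] obtain N \<omega>
          where N: "open N" "b' \<in> N" and \<omega>: "smooth_form B N \<omega>"
            "\<forall>c\<in>N. \<omega> c \<in> ker_sharpB S c \<and> l i c = cls c (\<omega> c)"
          by (elim exE conjE) (rule that)
        have "smooth_form B (N \<inter> W) \<omega>"
          unfolding smooth_form_def
        proof (intro conjI ballI)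
          show "\<omega> c \<in> cotangent_space B c" if "c \<in> N \<inter> W" for c
            using \<omega>(1) that unfolding smooth_form_def by blast
          fix cc assume cc: "cc \<in> B"
          obtain X x where [simp]: "cc = (X, x)" by (cases cc)
          obtain a where a: "\<And>i. i \<in> Basis \<Longrightarrow> smooth_fun B (N \<inter> X) (a i)"
            "\<And>m. m \<in> N \<inter> X \<Longrightarrow> \<omega> m = (\<lambda>v. \<Sum>i\<in>Basis. a i m * dif (\<lambda>m. x m \<bullet> i) m v)"
            using bspec[OF \<omega>(1)[unfolded smooth_form_def, THEN conjunct2] cc] by auto
          have "smooth_fun B (N \<inter> W \<inter> X) (a i)" if "i \<in> Basis" for i
            by (rule smooth_fun_subset[OF a(1)[OF that]]) blast
          moreover have "\<omega> m = (\<lambda>v. \<Sum>i\<in>Basis. a i m * dif (\<lambda>m. x m \<bullet> i) m v)"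
            if "m \<in> N \<inter> W \<inter> X" for m
            by (rule a(2)) (use that in blast)
          ultimately show "case cc of (U, x) \<Rightarrow> \<exists>a. (\<forall>i\<in>Basis. smooth_fun B (N \<inter> W \<inter> U) (a i)) \<and>
              (\<forall>m\<in>N \<inter> W \<inter> U. \<omega> m = (\<lambda>v. \<Sum>i\<in>Basis. a i m * dif (\<lambda>m. x m \<bullet> i) m v))"
            unfolding \<open>cc = (X, x)\<close> prod.case by (intro exI[of _ a] conjI ballI)
        qed
        moreover have "\<omega> c \<in> ker_sharpB S c \<and>
            cls c (dif (p i) c) = cls c (\<omega> c)" if "c \<in> N \<inter> W" for c
          using bspec[OF \<omega>(2), of c] cls[OF i, of c] that by simp
        ultimately show "\<exists>N \<omega>. open N \<and> b' \<in> N \<and> N \<subseteq> W \<and> smooth_form B N \<omega> \<and>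
            (\<forall>c\<in>N. \<omega> c \<in> ker_sharpB S c \<and> cls c (dif (p i) c) = cls c (\<omega> c))"
          using N oW b' by (intro exI[of _ "N \<inter> W"] exI[of _ \<omega>] conjI ballI open_Int) auto
      qed
    next
      fix b' assume b': "b' \<in> W"
      have "lattice_basis S r b' (\<lambda>i. l i b')" using triv unfolding lattice_trivialization_def by blast
      then show "lattice_basis S r b' (\<lambda>i. cls b' (dif (p i) b'))"
        by (rule lattice_basis_cong) (rule cls[OF _ b'])
    qed
    then have "action_variables S r W p" unfolding action_variables_def using cas by blast
    moreover have "\<AA> b' = {v \<in> tangent_space B b'. \<forall>i<r. dif (p i) b' v = 0}" if b': "b' \<in> W" for b'
    proof -
      have *: "(\<forall>V\<in>C i. b' \<in> V \<longrightarrow> dif (g i V) b' v = 0) \<longleftrightarrow> dif (p i) b' v = 0"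
        if i: "i < r" for i v
        using same[OF i _ _ _ WU[OF b' i]] U[OF i] WU[OF b' i] unfolding p_def by metis
      show ?thesis unfolding \<AA>_def by (intro Collect_cong conj_cong all_cong1 imp_cong refl *)
    qed
    ultimately show ?thesis using oW bW by blast
  qed
  have "foliation dB (dB - r) B \<AA>"
  proof (rule B.common_kernel_foliation)
    fix b
    obtain W p where W: "open W" "b \<in> W" and av: "action_variables S r W p"
      and \<AA>: "\<forall>b'\<in>W. \<AA> b' = {v \<in> tangent_space B b'. \<forall>i<r. dif (p i) b' v = 0}"
      using local[of b] by (elim exE conjE) (rule that)
    have p: "smooth_fun B W (p j)" if "j < r" for j
      using av that unfolding action_variables_def B.casimir_iff by blast
    \<comment> \<open>A relation among the covectors \<open>dp j\<close> is in particular a relation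
      among their classes, so real independence in the action bundle gives independence of the
      differentials.\<close>
    have "\<forall>j<r. a j = 0" if b': "b' \<in> W" and a: "(\<lambda>v. \<Sum>j<r. a j * dif (p j) b' v) = (\<lambda>v. 0)"
      for b' and a :: "nat \<Rightarrow> real"
    proof (rule lattice_real_independent[OF W(1) b' p])
      show "lattice_basis S r b' (\<lambda>i. cls b' (dif (p i) b'))"
        using av b' unfolding action_variables_def lattice_trivialization_def by blast
      show "(\<lambda>v. \<Sum>i<r. a i * dif (p i) b' v) \<in> Ker b'"
        unfolding a by (rule ker_sharpM_zero)
    qed
    then show "\<exists>U y. open U \<and> b \<in> U \<and> (\<forall>j<r. smooth_fun B U (y j)) \<and>
        (\<forall>m'\<in>U. \<forall>a :: nat \<Rightarrow> real. (\<lambda>v. \<Sum>j<r. a j * dif (y j) m' v) = (\<lambda>v. 0) \<longrightarrow> (\<forall>j<r. a j = 0)) \<and>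
        (\<forall>m'\<in>U. \<AA> m' = {v \<in> tangent_space B m'. \<forall>j<r. dif (y j) m' v = 0})"
      using W p \<AA> by (intro exI[of _ W] exI[of _ p] conjI) blast+
  qed
  then have "action_foliation S dB r \<AA>" unfolding action_foliation_def using local by blast
  then show ?thesis by (rule exI[of _ \<AA>])
qed

end

theorem proposition3p11:
  fixes S :: "('m::{t2_space, second_countable_topology}, 'e::euclidean_space,
               'b::{t2_space, second_countable_topology}, 'f::euclidean_space) nci_data"
    and dM dB r :: nat
    and D :: "'m \<Rightarrow> 'm vec set"
    and l :: "nat \<Rightarrow> 'b \<Rightarrow> 'b covec set"
  assumes "nci_system dM dB r D S"
    and "compact_fibers S"
    and "lattice_trivialization S r UNIV l"
  shows "(\<exists>\<AA>. action_foliation S dB r \<AA>) \<longleftrightarrow>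
         (\<forall>i<r. representable_by_constants S (Obs S (l i)))"
proof -
  interpret nci S dM dB r D by standard fact
  show ?thesis
  proof (intro iffI allI impI)
    fix i assume "\<exists>\<AA>. action_foliation S dB r \<AA>" "i < r"
    moreover have "lattice_section S UNIV (l i)"
      using assms(3) \<open>i < r\<close> unfolding lattice_trivialization_def by blast
    ultimately show "representable_by_constants S (Obs S (l i))"
      using representable_if_action_foliation by blast
  next
    assume "\<forall>i<r. representable_by_constants S (Obs S (l i))"
    then show "\<exists>\<AA>. action_foliation S dB r \<AA>"
      using action_foliation_if_representable[OF assms(3)] by blast
  qed
qed

end
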